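(* Let $\mathfrak g=\mathfrak l\oplus\mathfrak m$ be a reductive decomposition of a Lie algebra, $\mathcal G=(\mathfrak g,[\,,\,],\varpi,\varphi)$ a Lie quasi-bialgebra canonically compatible with it, with canonical double $\mathfrak d$, and $l=l^{\mathrm{can}}:U\to\mathcal A(\mathfrak g^*,\mathfrak g)$ the canonical dynamical $\ell$-matrix. Write $\mathrm{ad}=\mathrm{ad}^{\mathfrak d}$. Then the bundle map $$\theta:U\times\mathfrak l^*\to N(U)=U\times\mathfrak l\times\mathfrak g^*,\qquad(p,\alpha)\mapsto\Big(p,\ \frac{\sinh\mathrm{ad}_{sp}-\mathrm{ad}_{sp}}{\mathrm{ad}_{sp}^2}s\alpha,\ \frac{\sinh\mathrm{ad}_{sp}}{\mathrm{ad}_{sp}}s\alpha\Big)$$ is a flat connection on the Lie algebroid $N(U)$, and it satisfies $$[\theta\alpha,\psi X]^{N(U)}=\psi\big(dX(\alpha)\big)$$ for all smooth sections $\alpha\in\Gamma(U\times\mathfrak l^* )$ and $X\in\Gamma(U\times\mathfrak g^\star_0)$, where $\psi:U\times\mathfrak g^\star_0\to\mathrm{Ker}\,a^{N(U)}$ is the bundle map $\psi(p,X)=(p,-\phi_p^{-1}X)$ with $\phi_p:\mathfrak g_p^\star\to\mathfrak g_0^\star$, $\phi_p(X)=\mathrm{Ad}^{\mathfrak d}_{e^{-sp}}\tau_{l_p}X$.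
   Context: Conventions: vector spaces are finite-dimensional over $\mathbb K=\mathbb R$ or $\mathbb C$; $f^*$ is the transpose of $f$; $\mathcal A(\mathfrak g^*,\mathfrak g)$ is the set of linear $t:\mathfrak g^*\to\mathfrak g$ with $t^*=-t$; $\mathrm{ad}^*_x$ is the transpose of $\mathrm{ad}_x$; $A^\perp$ is the annihilator of $A$. Lie quasi-bialgebra: $\mathcal G=(\mathfrak g,[\,,\,],\varpi,\varphi)$ with $\varpi:\mathfrak g\to\mathcal A(\mathfrak g^*,\mathfrak g)$ linear satisfying $\varpi_{[x,y]}=\mathrm{ad}_x\varpi_y+\varpi_y\mathrm{ad}^*_x-\mathrm{ad}_y\varpi_x-\varpi_x\mathrm{ad}^*_y$, $\varphi\in\wedge^3\mathfrak g$, such that $\mathfrak d=\mathfrak g\oplus\mathfrak g^*$ with $[x,y]_{\mathfrak d}=[x,y]$, $[x,\xi]_{\mathfrak d}=\varpi_x\xi-\mathrm{ad}^*_x\xi$, $[\xi,\eta]_{\mathfrak d}=\langle\eta,\varpi_\bullet\xi\rangle+\langle\xi\otimes\eta\otimes1,\varphi\rangle$ is a Lie algebra (the canonical double). $\mathrm p_{\mathfrak g}$ is the projection of $\mathfrak d$ on $\mathfrak g$ along $\mathfrak g^*$, $i_{\mathfrak g}:\mathfrak g\to\mathfrak d$ the inclusion, $\mathrm{Ad}^{\mathfrak d}_{e^X}=\exp(\mathrm{ad}^{\mathfrak d}_X)$. For $t\in\mathcal A(\mathfrak g^*,\mathfrak g)$, $\tau_t(x+\xi)=x+t\xi+\xi$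 on $\mathfrak g\oplus\mathfrak g^*$. Reductive decomposition: $\mathfrak g=\mathfrak l\oplus\mathfrak m$, $\mathfrak l$ a subalgebra, $[\mathfrak l,\mathfrak m]\subset\mathfrak m$; $i:\mathfrak l\to\mathfrak g$ the inclusion, $\mathrm p_{\mathfrak l}$ the projection onto $\mathfrak l$ along $\mathfrak m$, $s=\mathrm p_{\mathfrak l}^*:\mathfrak l^*\to\mathfrak g^*$. $\mathcal G$ is canonically compatible with it if $\varpi_z=0$ for $z\in\mathfrak l$; $\langle\xi,\varpi_x\eta\rangle=0$ for $x\in\mathfrak g$, $\xi,\eta\in\mathfrak m^\perp$; $\varphi\in\mathrm{Alt}(\mathfrak l\otimes\mathfrak l\otimes\mathfrak l\oplus\mathfrak l\otimes\mathfrak m\otimes\mathfrak m\oplus\mathfrak m\otimes\mathfrak m\otimes\mathfrak m)$ and $\varphi$ vanishes on $(\mathfrak l^\perp)^3$. Canonical $\ell$-matrix: with $\mathfrak l\oplus\mathfrak l^*$ the double of the Lie quasi-bialgebra $(\mathfrak l,[\,,\,]_{\mathfrak l},0,\mathrm p_{\mathfrak l}^{\otimes3}\varphi)$, let $U=\{p\in\mathfrak l^*:\mathrm{Sp}(\mathrm{ad}^{\mathfrak l\oplus\mathfrak l^*}_p)\cap\mathrm i\pi(\mathbb Z\setminus\{0\})=\emptyset,\ \mathrm p_{\mathfrak g}\mathrm{Ad}^{\mathfrak d}_{e^{-sp}}i_{\mathfrak g}\text{ invertible}\}$ and, for $p\in U$, $\alpha\in\mathfrak l^*$, $\xi\in\mathfrak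 l^\perp$, $l^{\mathrm{can}}_p(s\alpha+\xi)=F(\mathrm{ad}^{\mathfrak l\oplus\mathfrak l^*}_p)\alpha-(\mathrm p_{\mathfrak g}\mathrm{Ad}^{\mathfrak d}_{e^{-sp}}i_{\mathfrak g})^{-1}\mathrm p_{\mathfrak g}\mathrm{Ad}^{\mathfrak d}_{e^{-sp}}\xi$ with $F(z)=\coth z-1/z$. $\mathfrak g^\star_p=\{z+\xi:\ z\in\mathfrak l,\ \xi\in\mathfrak g^*,\ i^*\xi=\mathrm{ad}^*_zp\}\subset\mathfrak g\oplus\mathfrak g^*$; $\mathfrak g^\star_0=\mathfrak l\oplus\mathfrak l^\perp$. The map $\phi_p$ is a bijection $\mathfrak g_p^\star\to\mathfrak g_0^\star$ for $p\in U$. Quotients such as $\frac{\sinh\mathrm{ad}_{sp}}{\mathrm{ad}_{sp}}$ denote the corresponding entire power series in $\mathrm{ad}_{sp}$. Lie algebroid $N(U)=U\times\mathfrak l\times\mathfrak g^*$ over $U$: anchor $a^{N(U)}_p(z,\xi)=i^*\xi-\mathrm{ad}^*_zp$, and bracket on sections $$[(z,\xi),(z',\xi')]^{N(U)}_p=\big(d_pz'(a_p(z_p,\xi_p))-d_pz(a_p(z'_p,\xi'_p))-[z_p,z'_p]+\langle\xi_p,d_pl(\cdot)\xi'_p\rangle,\ d_p\xi'(a_p(z_p,\xi_p))-d_p\xi(a_p(z'_p,\xi'_p))+\mathrm{ad}^*_{z_p}\xi'_p-\mathrm{ad}^*_{z'_p}\xi_p+\langle\xi_p,\varpi_\bullet\xi'_p\rangle+\mathrm{ad}^*_{l_p\xi_p}\xi'_p-\mathrm{ad}^*_{l_p\xi'_p}\xi_p\big).$$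 A flat connection on $N(U)$ is a bundle map $\theta:TU=U\times\mathfrak l^*\to N(U)$ with $a^{N(U)}\circ\theta=\mathrm{id}$ and $[\theta\alpha,\theta\beta]^{N(U)}=\theta[\alpha,\beta]$ for all vector fields $\alpha,\beta$ on $U$. $dX(\alpha)$ is the derivative of $X:U\to\mathfrak g_0^\star$ along $\alpha$. *)

theory Defs
  imports "HOL-Analysis.Analysis" "HOL-Computational_Algebra.Formal_Power_Series"
begin

section \<open>Scalars and finite-dimensional vector spaces\<close>

text \<open>
  The isometric field embedding into the complex numbers, which is the identity on the reals,
  forces an instance of this class to be a copy of \<open>\<real>\<close> or of \<open>\<complex>\<close>.
\<close>

class real_or_complex = real_normed_field + banach +
  fixes to_complex :: "'a \<Rightarrow> complex"
  assumes to_complex_add: "to_complex (x + y) = to_complex x + to_complex y"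
    and to_complex_mult: "to_complex (x * y) = to_complex x * to_complex y"
    and to_complex_scaleR: "to_complex (scaleR r x) = scaleR r (to_complex x)"
    and to_complex_one: "to_complex 1 = 1"
    and norm_to_complex: "norm (to_complex x) = norm x"

instantiation real :: real_or_complex
begin
definition to_complex_real :: "real \<Rightarrow> complex" where "to_complex_real = of_real"
instance by standard (simp_all add: to_complex_real_def scaleR_conv_of_real)
end

instantiation complex :: real_or_complex
begin
definition to_complex_complex :: "complex \<Rightarrow> complex" where "to_complex_complex = (\<lambda>z. z)"
instance by standard (simp_all add: to_complex_complex_def)
end

text \<open>
  A finite-dimensional vector space over \<open>\<bbbK>\<close>. The norm only serves to give access to limits and
  derivatives: such a norm always exists and all of them are equivalent. The type class
  \<^class>\<open>real_normed_vector\<close> does not exclude the zero space.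
\<close>

locale fd_space = vector_space scale
  for scale :: "'k::real_or_complex \<Rightarrow> 'v::real_normed_vector \<Rightarrow> 'v" +
  assumes scale_of_real: "scale (of_real r) x = r *\<^sub>R x"
    and norm_scale: "norm (scale c x) = norm c * norm x"
    and finite_dim: "\<exists>B. finite B \<and> span B = UNIV"

text \<open>
  A vector space \<open>V\<close> (type \<open>'v\<close>) together with its dual \<open>V\<^sup>*\<close> (type \<open>'w\<close>). The dual is represented
  by a space in perfect duality with \<open>V\<close>; every linear functional on \<open>V\<close> is \<open>pairing P \<omega>\<close> for a
  unique \<open>\<omega>\<close>. Boundedness of the pairing is automatic in finite dimension.
\<close>

record ('k, 'v, 'w) dual_pair =
  scal :: "'k \<Rightarrow> 'v \<Rightarrow> 'v"
  coscal :: "'k \<Rightarrow> 'w \<Rightarrow> 'w"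
  pairing :: "'w \<Rightarrow> 'v \<Rightarrow> 'k"

definition is_dual_pair ::
    "('k::real_or_complex, 'v::real_normed_vector, 'w::real_normed_vector, 'm) dual_pair_scheme \<Rightarrow> bool" where
  "is_dual_pair P \<longleftrightarrow> fd_space (scal P) \<and> fd_space (coscal P) \<and> bounded_bilinear (pairing P) \<and>
     (\<forall>c \<omega> v. pairing P (coscal P c \<omega>) v = c * pairing P \<omega> v) \<and>
     (\<forall>c \<omega> v. pairing P \<omega> (scal P c v) = c * pairing P \<omega> v) \<and>
     (\<forall>\<omega>. (\<forall>v. pairing P \<omega> v = 0) \<longrightarrow> \<omega> = 0) \<and>
     (\<forall>v. (\<forall>\<omega>. pairing P \<omega> v = 0) \<longrightarrow> v = 0)"

text \<open>The element of \<open>V\<^sup>*\<close> given by a functional on \<open>V\<close>, and the element of \<open>V\<close> given by a functional on \<open>V\<^sup>*\<close>.\<close>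

definition covector_of :: "('k, 'v, 'w, 'm) dual_pair_scheme \<Rightarrow> ('v \<Rightarrow> 'k) \<Rightarrow> 'w" where
  "covector_of P f = (THE \<omega>. \<forall>v. pairing P \<omega> v = f v)"

definition vector_of :: "('k, 'v, 'w, 'm) dual_pair_scheme \<Rightarrow> ('w \<Rightarrow> 'k) \<Rightarrow> 'v" where
  "vector_of P f = (THE v. \<forall>\<omega>. pairing P \<omega> v = f \<omega>)"

definition transpose_map ::
    "('k, 'v, 'w, 'm) dual_pair_scheme \<Rightarrow> ('k, 'v', 'w', 'n) dual_pair_scheme \<Rightarrow>
     ('v \<Rightarrow> 'v') \<Rightarrow> 'w' \<Rightarrow> 'w" where
  "transpose_map P Q f \<omega> = covector_of P (\<lambda>v. pairing Q \<omega> (f v))"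

definition annihilator :: "('k::zero, 'v, 'w, 'm) dual_pair_scheme \<Rightarrow> 'v set \<Rightarrow> 'w set" where
  "annihilator P A = {\<omega>. \<forall>v\<in>A. pairing P \<omega> v = 0}"

definition pair_scale :: "('k \<Rightarrow> 'a \<Rightarrow> 'a) \<Rightarrow> ('k \<Rightarrow> 'b \<Rightarrow> 'b) \<Rightarrow> 'k \<Rightarrow> 'a \<times> 'b \<Rightarrow> 'a \<times> 'b" where
  "pair_scale s t c = map_prod (s c) (t c)"

text \<open>
  The (complex) spectrum of a linear endomorphism: its eigenvalues if \<open>\<bbbK> = \<complex>\<close>, and those of its
  complexification, with eigenvector \<open>u + \<i>v\<close>, if \<open>\<bbbK> = \<real>\<close>.
\<close>

definition spectrum_of :: "('k::real_or_complex \<Rightarrow> 'v::real_vector \<Rightarrow> 'v) \<Rightarrow> ('v \<Rightarrow> 'v) \<Rightarrow> complex set" where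
  "spectrum_of sc A =
     (if surj (to_complex :: 'k \<Rightarrow> complex)
      then {to_complex c |c. \<exists>v. v \<noteq> 0 \<and> A v = sc c v}
      else {\<mu>. \<exists>u v. (u, v) \<noteq> (0, 0) \<and>
                A u = Re \<mu> *\<^sub>R u - Im \<mu> *\<^sub>R v \<and> A v = Im \<mu> *\<^sub>R u + Re \<mu> *\<^sub>R v})"


section \<open>Power series of endomorphisms\<close>

definition fps_op :: "real fps \<Rightarrow> ('v::real_normed_vector \<Rightarrow> 'v) \<Rightarrow> 'v \<Rightarrow> 'v" where
  "fps_op F A v = (\<Sum>n. fps_nth F n *\<^sub>R (A ^^ n) v)"

definition sinh_fps :: "real fps" where
  "sinh_fps = fps_const (1/2) * (fps_exp 1 - fps_exp (-1))"

definition cosh_fps :: "real fps" where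
  "cosh_fps = fps_const (1/2) * (fps_exp 1 + fps_exp (-1))"

text \<open>
  \<open>F(A)\<close> for \<open>F(z) = coth z - 1/z\<close>. As meromorphic functions \<open>F = N / D\<close> with the entire functions
  \<open>N(z) = (z cosh z - sinh z) / z\<^sup>2\<close> and \<open>D(z) = sinh z / z\<close>. The zeros of \<open>D\<close> are the
  points of \<open>\<i>\<pi>(\<int> - {0})\<close>, so \<open>D(A)\<close> is invertible, and \<open>F(A) = N(A) D(A)\<^sup>-\<^sup>1\<close>, when the
  spectrum of \<open>A\<close> avoids these points.
\<close>

definition coth_minus_inverse_op :: "('v::real_normed_vector \<Rightarrow> 'v) \<Rightarrow> 'v \<Rightarrow> 'v" where
  "coth_minus_inverse_op A v =
     fps_op ((fps_X * cosh_fps - sinh_fps) / fps_X ^ 2) A (inv (fps_op (sinh_fps / fps_X) A) v)"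


section \<open>Smooth maps\<close>

text \<open>
  Smoothness is meant over \<open>\<real>\<close>, on an open set. For \<open>\<bbbK> = \<complex>\<close> holomorphic maps are smooth
  in this sense.
\<close>

primrec times_differentiable_on ::
    "nat \<Rightarrow> 'a::real_normed_vector set \<Rightarrow> ('a \<Rightarrow> 'b::real_normed_vector) \<Rightarrow> bool" where
  "times_differentiable_on 0 U f \<longleftrightarrow> continuous_on U f"
| "times_differentiable_on (Suc k) U f \<longleftrightarrow>
     (\<forall>x\<in>U. f differentiable at x) \<and>
     (\<forall>v. times_differentiable_on k U (\<lambda>x. frechet_derivative f (at x) v))"

definition smooth_on :: "'a::real_normed_vector set \<Rightarrow> ('a \<Rightarrow> 'b::real_normed_vector) \<Rightarrow> bool" where
  "smooth_on U f \<longleftrightarrow> (\<forall>k. times_differentiable_on k U f)"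


section \<open>Lie quasi-bialgebras\<close>

definition lie_bracket :: "('k::field \<Rightarrow> 'v::ab_group_add \<Rightarrow> 'v) \<Rightarrow> ('v \<Rightarrow> 'v \<Rightarrow> 'v) \<Rightarrow> bool" where
  "lie_bracket sc br \<longleftrightarrow>
     (\<forall>x. Vector_Spaces.linear sc sc (br x)) \<and>
     (\<forall>y. Vector_Spaces.linear sc sc (\<lambda>x. br x y)) \<and>
     (\<forall>x. br x x = 0) \<and>
     (\<forall>x y z. br x (br y z) + br y (br z x) + br z (br x y) = 0)"

text \<open>
  Elements of \<open>V \<otimes> V \<otimes> V\<close> are regarded as trilinear forms on \<open>V\<^sup>*\<close>.
  \<open>alt_tensors P S\<close> is the set of all \<open>Alt(\<Sum>\<^sub>j a\<^sub>j \<otimes> b\<^sub>j \<otimes> c\<^sub>j)\<close> with all \<open>(a\<^sub>j, b\<^sub>j, c\<^sub>j)\<close> in \<open>S\<close>;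
  a normalising factor of \<open>Alt\<close> would not change it. So \<open>alt_tensors P UNIV\<close> is \<open>\<and>\<^sup>3V\<close>.
\<close>

definition alternation :: "('w \<Rightarrow> 'w \<Rightarrow> 'w \<Rightarrow> 'k::ab_group_add) \<Rightarrow> 'w \<Rightarrow> 'w \<Rightarrow> 'w \<Rightarrow> 'k" where
  "alternation T \<xi> \<eta> \<zeta> = T \<xi> \<eta> \<zeta> + T \<eta> \<zeta> \<xi> + T \<zeta> \<xi> \<eta> - T \<eta> \<xi> \<zeta> - T \<xi> \<zeta> \<eta> - T \<zeta> \<eta> \<xi>"

definition alt_tensors ::
    "('k::comm_ring_1, 'v, 'w, 'm) dual_pair_scheme \<Rightarrow> ('v \<times> 'v \<times> 'v) set \<Rightarrow> ('w \<Rightarrow> 'w \<Rightarrow> 'w \<Rightarrow> 'k) set" where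
  "alt_tensors P S =
     {alternation (\<lambda>\<xi> \<eta> \<zeta>. \<Sum>j<N. pairing P \<xi> (a j) * pairing P \<eta> (b j) * pairing P \<zeta> (c j)) |
        (N::nat) a b c. \<forall>j<N. (a j, b j, c j) \<in> S}"

record ('k, 'v, 'w) quasi_bialgebra = "('k, 'v, 'w) dual_pair" +
  bracket :: "'v \<Rightarrow> 'v \<Rightarrow> 'v"
  cobracket :: "'v \<Rightarrow> 'w \<Rightarrow> 'v"           \<comment> \<open>\<open>\<varpi>\<close>\<close>
  associator :: "'w \<Rightarrow> 'w \<Rightarrow> 'w \<Rightarrow> 'k"     \<comment> \<open>\<open>\<phi>\<close>\<close>

definition coad :: "('k, 'v, 'w) quasi_bialgebra \<Rightarrow> 'v \<Rightarrow> 'w \<Rightarrow> 'w" where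
  "coad G x = transpose_map G G (bracket G x)"

definition covector_cobracket :: "('k, 'v, 'w) quasi_bialgebra \<Rightarrow> 'w \<Rightarrow> 'w \<Rightarrow> 'w" where
  \<comment> \<open>\<open>\<langle>\<xi>, \<varpi>\<^sub>\<bullet>\<eta>\<rangle>\<close>\<close>
  "covector_cobracket G \<xi> \<eta> = covector_of G (\<lambda>x. pairing G \<xi> (cobracket G x \<eta>))"

text \<open>The bracket of the canonical double \<open>V \<oplus> V\<^sup>*\<close>; an element \<open>x + \<xi>\<close> is the pair \<open>(x, \<xi>)\<close>.\<close>

definition double_bracket ::
    "('k, 'v::ab_group_add, 'w::ab_group_add) quasi_bialgebra \<Rightarrow> 'v \<times> 'w \<Rightarrow> 'v \<times> 'w \<Rightarrow> 'v \<times> 'w" where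
  "double_bracket G = (\<lambda>(x, \<xi>) (y, \<eta>).
     (bracket G x y + cobracket G x \<eta> - cobracket G y \<xi> + vector_of G (associator G \<xi> \<eta>),
      coad G y \<xi> - coad G x \<eta> + covector_cobracket G \<eta> \<xi>))"

definition lie_quasi_bialgebra ::
    "('k::real_or_complex, 'v::real_normed_vector, 'w::real_normed_vector) quasi_bialgebra \<Rightarrow> bool" where
  "lie_quasi_bialgebra G \<longleftrightarrow> is_dual_pair G \<and> lie_bracket (scal G) (bracket G) \<and>
     (\<forall>x. Vector_Spaces.linear (coscal G) (scal G) (cobracket G x)) \<and>
     (\<forall>x \<xi> \<eta>. pairing G \<xi> (cobracket G x \<eta>) = - pairing G \<eta> (cobracket G x \<xi>)) \<and>
     (\<forall>\<xi>. Vector_Spaces.linear (scal G) (scal G) (\<lambda>x. cobracket G x \<xi>)) \<and>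
     (\<forall>x y \<xi>. cobracket G (bracket G x y) \<xi> =
        bracket G x (cobracket G y \<xi>) + cobracket G y (coad G x \<xi>)
        - bracket G y (cobracket G x \<xi>) - cobracket G x (coad G y \<xi>)) \<and>
     associator G \<in> alt_tensors G UNIV \<and>
     lie_bracket (pair_scale (scal G) (coscal G)) (double_bracket G)"

definition Ad_exp ::
    "('k, 'v::real_normed_vector, 'w::real_normed_vector) quasi_bialgebra \<Rightarrow> 'v \<times> 'w \<Rightarrow> 'v \<times> 'w \<Rightarrow> 'v \<times> 'w" where
  "Ad_exp G X = fps_op (fps_exp 1) (double_bracket G X)"

definition tau :: "('w \<Rightarrow> 'v::plus) \<Rightarrow> 'v \<times> 'w \<Rightarrow> 'v \<times> 'w" where
  "tau t = (\<lambda>(x, \<xi>). (x + t \<xi>, \<xi>))"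


section \<open>Reductive decompositions, the canonical \<open>\<ell>\<close>-matrix and the Lie algebroid\<close>

text \<open>
  \<open>G\<close> lives on \<open>\<gg>\<close> (type \<open>'g\<close>, dual \<open>'h\<close>). The subalgebra \<open>\<ll>\<close> is the image of the injection \<open>i\<close>
  from a type \<open>'l\<close>, whose dual \<open>\<ll>\<^sup>*\<close> (type \<open>'q\<close>) is specified by \<open>L\<close>; \<open>M\<close> is the complement \<open>\<mm>\<close>.
\<close>

context
  fixes G :: "('k::real_or_complex, 'g::real_normed_vector, 'h::real_normed_vector) quasi_bialgebra"
    and L :: "('k, 'l::real_normed_vector, 'q::real_normed_vector) dual_pair"
    and i :: "'l \<Rightarrow> 'g"
    and M :: "'g set"
begin

definition reductive_decomposition :: bool where
  "reductive_decomposition \<longleftrightarrow> is_dual_pair L \<and>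
     Vector_Spaces.linear (scal L) (scal G) i \<and> inj i \<and> module.subspace (scal G) M \<and>
     range i \<inter> M = {0} \<and> (\<forall>x. \<exists>z. \<exists>m\<in>M. x = i z + m) \<and>
     (\<forall>z w. bracket G (i z) (i w) \<in> range i) \<and>
     (\<forall>z. \<forall>m\<in>M. bracket G (i z) m \<in> M)"

definition canonically_compatible :: bool where
  "canonically_compatible \<longleftrightarrow>
     (\<forall>z \<eta>. cobracket G (i z) \<eta> = 0) \<and>
     (\<forall>x. \<forall>\<xi>\<in>annihilator G M. \<forall>\<eta>\<in>annihilator G M. pairing G \<xi> (cobracket G x \<eta>) = 0) \<and>
     associator G \<in> alt_tensors G
       (range i \<times> range i \<times> range i \<union> range i \<times> M \<times> M \<union> M \<times> M \<times> M) \<and>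
     (\<forall>\<xi>\<in>annihilator G (range i). \<forall>\<eta>\<in>annihilator G (range i). \<forall>\<zeta>\<in>annihilator G (range i).
        associator G \<xi> \<eta> \<zeta> = 0)"

definition proj_l :: "'g \<Rightarrow> 'l" where
  "proj_l x = (THE z. x - i z \<in> M)"

definition s_map :: "'q \<Rightarrow> 'h" where
  "s_map = transpose_map G L proj_l"

definition restr :: "'h \<Rightarrow> 'q" where
  \<comment> \<open>\<open>i\<^sup>*\<close>\<close>
  "restr = transpose_map L G i"

definition sub_quasi_bialgebra :: "('k, 'l, 'q) quasi_bialgebra" where
  "sub_quasi_bialgebra = \<lparr> scal = scal L, coscal = coscal L, pairing = pairing L,
     bracket = (\<lambda>z w. inv i (bracket G (i z) (i w))),
     cobracket = (\<lambda>_ _. 0),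
     associator = (\<lambda>\<alpha> \<beta> \<gamma>. associator G (s_map \<alpha>) (s_map \<beta>) (s_map \<gamma>)) \<rparr>"

definition ad_sub :: "'q \<Rightarrow> 'l \<times> 'q \<Rightarrow> 'l \<times> 'q" where
  \<comment> \<open>\<open>ad\<^sub>p\<close> in the double \<open>\<ll> \<oplus> \<ll>\<^sup>*\<close>\<close>
  "ad_sub p = double_bracket sub_quasi_bialgebra (0, p)"

definition ad_s :: "'q \<Rightarrow> 'g \<times> 'h \<Rightarrow> 'g \<times> 'h" where
  \<comment> \<open>\<open>ad\<^sub>s\<^sub>p\<close> in the double \<open>\<dd> = \<gg> \<oplus> \<gg>\<^sup>*\<close>\<close>
  "ad_s p = double_bracket G (0, s_map p)"

definition Ad_ms :: "'q \<Rightarrow> 'g \<times> 'h \<Rightarrow> 'g \<times> 'h" where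
  \<comment> \<open>\<open>Ad\<close> of \<open>e\<^sup>-\<^sup>s\<^sup>p\<close> on \<open>\<dd>\<close>\<close>
  "Ad_ms p = Ad_exp G (0, - s_map p)"

definition U_dom :: "'q set" where
  "U_dom = {p.
     spectrum_of (pair_scale (scal L) (coscal L)) (ad_sub p)
       \<inter> {\<i> * of_real pi * of_int k | k. k \<noteq> 0} = {} \<and>
     bij (\<lambda>x. fst (Ad_ms p (x, 0)))}"

text \<open>
  Here \<open>\<alpha> = i\<^sup>*\<eta>\<close> and \<open>\<xi> = \<eta> - s\<alpha>\<close> are the components of \<open>\<eta> = s\<alpha> + \<xi>\<close> in \<open>\<gg>\<^sup>* = s\<ll>\<^sup>* \<oplus> \<ll>\<^sup>\<bottom>\<close>.
  The operator \<open>ad\<^sub>p\<close> exchanges \<open>\<ll>\<close> and \<open>\<ll>\<^sup>*\<close> and \<open>F\<close> is odd, so that \<open>F(ad\<^sub>p)\<alpha>\<close> lies in \<open>\<ll>\<close>.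
\<close>

definition l_can :: "'q \<Rightarrow> 'h \<Rightarrow> 'g" where
  "l_can p \<eta> = (let \<alpha> = restr \<eta>; \<xi> = \<eta> - s_map \<alpha> in
     i (fst (coth_minus_inverse_op (ad_sub p) (0, \<alpha>)))
     - inv (\<lambda>x. fst (Ad_ms p (x, 0))) (fst (Ad_ms p (0, \<xi>))))"

definition gstar :: "'q \<Rightarrow> ('g \<times> 'h) set" where
  "gstar p = {(i z, \<xi>) | z \<xi>. restr \<xi> = coad sub_quasi_bialgebra z p}"

definition phi :: "'q \<Rightarrow> 'g \<times> 'h \<Rightarrow> 'g \<times> 'h" where
  "phi p X = Ad_ms p (tau (l_can p) X)"

text \<open>Elements of the fibre \<open>\<ll> \<times> \<gg>\<^sup>*\<close> of \<open>N(U)\<close> have type \<open>'l \<times> 'h\<close>.\<close>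

definition anchor :: "'q \<Rightarrow> 'l \<times> 'h \<Rightarrow> 'q" where
  "anchor p = (\<lambda>(z, \<xi>). restr \<xi> - coad sub_quasi_bialgebra z p)"

text \<open>
  \<open>D A v\<close> is the derivative of the section \<open>A\<close> at \<open>p\<close> along \<open>v\<close>, both components at once.
  The term \<open>\<langle>\<xi>, d\<^sub>pl(\<cdot>)\<xi>'\<rangle>\<close> is a functional on \<open>\<ll>\<^sup>*\<close>, that is, an element of \<open>\<ll>\<close>.
\<close>

definition N_bracket :: "('q \<Rightarrow> 'l \<times> 'h) \<Rightarrow> ('q \<Rightarrow> 'l \<times> 'h) \<Rightarrow> 'q \<Rightarrow> 'l \<times> 'h" where
  "N_bracket A B p =
     (let D = (\<lambda>A v. frechet_derivative A (at p) v);
          (z, \<xi>) = A p; (z', \<xi>') = B p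
      in D B (anchor p (z, \<xi>)) - D A (anchor p (z', \<xi>')) +
         (- bracket sub_quasi_bialgebra z z'
            + vector_of L (\<lambda>\<gamma>. pairing G \<xi> (frechet_derivative (\<lambda>q. l_can q \<xi>') (at p) \<gamma>)),
          coad G (i z) \<xi>' - coad G (i z') \<xi> + covector_cobracket G \<xi> \<xi>'
            + coad G (l_can p \<xi>) \<xi>' - coad G (l_can p \<xi>') \<xi>))"

text \<open>
  A bundle map \<open>U \<times> \<ll>\<^sup>* \<rightarrow> N(U)\<close> is linear on fibres and smooth in the base point. The bracket of
  vector fields on the open set \<open>U\<close> of \<open>\<ll>\<^sup>*\<close> is \<open>[\<alpha>, \<beta>] = d\<beta>(\<alpha>) - d\<alpha>(\<beta>)\<close>.
\<close>

definition flat_connection :: "('q \<Rightarrow> 'q \<Rightarrow> 'l \<times> 'h) \<Rightarrow> bool" where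
  "flat_connection \<theta> \<longleftrightarrow>
     (\<forall>p\<in>U_dom. Vector_Spaces.linear (coscal L) (pair_scale (scal L) (coscal G)) (\<theta> p)) \<and>
     (\<forall>\<alpha>. smooth_on U_dom (\<lambda>p. \<theta> p \<alpha>)) \<and>
     (\<forall>p\<in>U_dom. \<forall>\<alpha>. anchor p (\<theta> p \<alpha>) = \<alpha>) \<and>
     (\<forall>\<alpha> \<beta>. smooth_on U_dom \<alpha> \<longrightarrow> smooth_on U_dom \<beta> \<longrightarrow>
        (\<forall>p\<in>U_dom. N_bracket (\<lambda>q. \<theta> q (\<alpha> q)) (\<lambda>q. \<theta> q (\<beta> q)) p =
           \<theta> p (frechet_derivative \<beta> (at p) (\<alpha> p) - frechet_derivative \<alpha> (at p) (\<beta> p))))"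

text \<open>The two components of \<open>\<theta>\<close> as elements of \<open>\<dd>\<close>; they lie in \<open>\<ll>\<close> and in \<open>\<gg>\<^sup>*\<close> respectively.\<close>

definition theta_l :: "'q \<Rightarrow> 'q \<Rightarrow> 'g \<times> 'h" where
  "theta_l p \<alpha> = fps_op ((sinh_fps - fps_X) / fps_X ^ 2) (ad_s p) (0, s_map \<alpha>)"

definition theta_g :: "'q \<Rightarrow> 'q \<Rightarrow> 'g \<times> 'h" where
  "theta_g p \<alpha> = fps_op (sinh_fps / fps_X) (ad_s p) (0, s_map \<alpha>)"

definition theta :: "'q \<Rightarrow> 'q \<Rightarrow> 'l \<times> 'h" where
  "theta p \<alpha> = (inv i (fst (theta_l p \<alpha>)), snd (theta_g p \<alpha>))"

definition psi :: "'q \<Rightarrow> 'g \<times> 'h \<Rightarrow> 'l \<times> 'h" where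
  "psi p X = (let Y = inv_into (gstar p) (phi p) X in - (inv i (fst Y), snd Y))"

end

end

theory Submission
  imports Defs "HOL-Computational_Algebra.Fundamental_Theorem_Algebra"
begin

text \<open>
  Write \<open>A\<close> for \<open>ad\<close> of \<open>sp\<close>. The subspace \<open>\<ll> \<oplus> s\<ll>\<^sup>*\<close> of \<open>\<dd>\<close> is a copy of the double of \<open>\<ll>\<close>, on which \<open>A\<close>
  exchanges the two summands, and \<open>\<mm> \<oplus> \<ll>\<^sup>\<bottom>\<close> is stable under \<open>A\<close>. Hence the components of \<open>\<theta>\<alpha>\<close> are the
  parts in \<open>\<ll>\<close> and \<open>\<ll>\<^sup>*\<close> of \<open>T s\<alpha>\<close> and \<open>W s\<alpha>\<close>, where \<open>W = (exp A - 1) / A\<close> and \<open>T = (exp A - 1 - A) / A\<^sup>2\<close>,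
  and \<open>l\<^sup>can\<close> of the second component plus the first one is the part of \<open>W s\<alpha>\<close> in \<open>\<ll>\<close>. The form \<open>\<alpha> \<mapsto> W s\<alpha>\<close> is the right Maurer-Cartan form
  of \<open>p \<mapsto> exp (sp)\<close>; the \<open>\<gg>\<^sup>*\<close>-component of flatness is the \<open>\<ll>\<^sup>*\<close>-component of the Maurer-Cartan equation.
  In the \<open>\<ll>\<close>-component, multiplying out the denominator of \<open>F(A)\<close> leaves an identity between derivatives of
  \<open>W\<close> and \<open>T\<close>, paired by the invariant form of the double. It is proved for \<open>tA\<close> in place of \<open>A\<close>
  by differentiation in \<open>t\<close>.

  For \<open>w \<in> \<ll>\<close> and \<open>\<eta> \<in> \<ll>\<^sup>\<bottom>\<close> the inverse of \<open>\<phi>\<^sub>p\<close> sends \<open>w + \<eta>\<close> to the pair of \<open>(sinh A / A) w\<close> and the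
  \<open>\<gg>\<^sup>*\<close>-part of \<open>exp A (w + \<eta>)\<close>. The derivative of \<open>exp A\<close> along \<open>\<alpha>\<close> is \<open>ad (W s\<alpha>) exp A\<close>, and this gives the
  second formula, whose \<open>\<ll>\<close>-component is reduced to that of flatness by the equivariance of \<open>T\<close>
  under inner derivations. The set \<open>U\<close> is open because its spectral condition means that \<open>sinh A / A\<close> is invertible.
\<close>

section \<open>Finite-dimensional normed spaces\<close>

text \<open>The bracket of \<open>N(U)\<close> differentiates the \<open>\<ell>\<close>-matrix,
  hence the inverse of \<open>sinh A / A\<close>, whose derivative is awkward because
  \<open>A\<close> and its variation do not commute. Two facts remove it. The covector paired with
  the derivative of \<open>l\<close> always comes from \<open>\<theta>\<close>, so it lies in
  \<open>s\<ll>\<^sup>*\<close>, which annihilates \<open>\<mm>\<close>: only the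
  \<open>\<ll>\<close>-part of \<open>l\<close> contributes. And this part is skew, so the
  differentiated inverse can be moved to the other argument, which is itself
  \<open>sinh A / A\<close> applied to an explicit covector. Both formulas then rest on one
  identity. For \<open>w \<in> \<ll>\<close> the element \<open>A w\<close> is a covector, so up to
  \<open>\<ll>\<^sup>\<bottom>\<close> the covector of \<open>\<psi> X\<close> is
  \<open>sinh A / A\<close> applied to \<open>- A w\<close>; the second formula is the flatness
  identity with \<open>- A w\<close> in place of the second section. On the analytic side finite
  dimension is a hypothesis on bare normed types. Completeness, equivalence of norms and continuity
  of linear maps are therefore obtained through coordinates.\<close>

definition fin_dim :: "'d::real_normed_vector itself \<Rightarrow> bool" where
  "fin_dim _ \<longleftrightarrow> (\<exists>(n::nat) c e. (\<forall>i<n. bounded_linear (c i :: 'd \<Rightarrow> real)) \<and>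
     (\<forall>x::'d. x = (\<Sum>i<n. c i x *\<^sub>R e i)))"

lemma fin_dimE:
  assumes "fin_dim TYPE('d::real_normed_vector)"
  obtains n c and e :: "nat \<Rightarrow> 'd::real_normed_vector" where "\<And>i. i < n \<Longrightarrow> bounded_linear (c i)"
    "\<And>x. x = (\<Sum>i<n. c i x *\<^sub>R e i)"
  using assms unfolding fin_dim_def by blast

lemma linear_expand:
  assumes "linear f" "x = (\<Sum>i<(n::nat). c i x *\<^sub>R e i)"
  shows "f x = (\<Sum>i<n. c i x *\<^sub>R f (e i))"
proof -
  have "f x = f (\<Sum>i<n. c i x *\<^sub>R e i)" using assms(2) by simp
  also have "\<dots> = (\<Sum>i<n. c i x *\<^sub>R f (e i))"
    by (simp add: linear_sum[OF assms(1)] linear_cmul[OF assms(1)])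
  finally show ?thesis .
qed

lemma fin_dim_bounded_linear:
  fixes f :: "'d::real_normed_vector \<Rightarrow> 'e::real_normed_vector"
  assumes "fin_dim TYPE('d)" "linear f"
  shows "bounded_linear f"
proof -
  obtain n c and e :: "nat \<Rightarrow> 'd" where c: "\<And>i. i < n \<Longrightarrow> bounded_linear (c i)"
    and e: "\<And>x. x = (\<Sum>i<n. c i x *\<^sub>R e i)" using that by (rule fin_dimE[OF assms(1)])
  have "f = (\<lambda>x. \<Sum>i<n. c i x *\<^sub>R f (e i))"
    by (rule ext) (rule linear_expand[OF assms(2) e])
  moreover have "bounded_linear (\<lambda>x. \<Sum>i<n. c i x *\<^sub>R f (e i))"
    using c by (intro bounded_linear_sum bounded_linear_scaleR_const) auto
  ultimately show ?thesis by simp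
qed

lemma fin_dim_bounded_bilinear:
  fixes f :: "'c::real_normed_vector \<Rightarrow> 'd::real_normed_vector \<Rightarrow> 'e::real_normed_vector"
  assumes C: "fin_dim TYPE('c)" and D: "fin_dim TYPE('d)"
    and l: "\<And>x. linear (f x)" and r: "\<And>y. linear (\<lambda>x. f x y)"
  shows "bounded_bilinear f"
proof -
  obtain n c and e :: "nat \<Rightarrow> 'c" where c: "\<And>i. i < n \<Longrightarrow> bounded_linear (c i)"
    and e: "\<And>x. x = (\<Sum>i<n. c i x *\<^sub>R e i)" using that by (rule fin_dimE[OF C])
  have bl: "bounded_linear (f x)" for x using fin_dim_bounded_linear[OF D l] .
  have ex: "f x y = (\<Sum>i<n. c i x *\<^sub>R f (e i) y)" for x y
    using linear_expand[OF r e] .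
  define K where "K = (\<Sum>i<n. onorm (c i) * onorm (f (e i)))"
  have "norm (f x y) \<le> norm x * norm y * K" for x y
  proof -
    have "norm (f x y) \<le> (\<Sum>i<n. norm (c i x *\<^sub>R f (e i) y))"
      unfolding ex[of x y] by (rule norm_sum)
    also have "\<dots> \<le> (\<Sum>i<n. (onorm (c i) * norm x) * (onorm (f (e i)) * norm y))"
    proof (rule sum_mono)
      fix i assume "i \<in> {..<n}"
      then have "norm (c i x) \<le> onorm (c i) * norm x" using onorm[OF c] by auto
      moreover have "norm (f (e i) y) \<le> onorm (f (e i)) * norm y" using onorm[OF bl] .
      ultimately show "norm (c i x *\<^sub>R f (e i) y) \<le> (onorm (c i) * norm x) * (onorm (f (e i)) * norm y)"
        unfolding norm_scaleR real_norm_def by (intro mult_mono) (auto intro: order_trans[OF abs_ge_zero])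
    qed
    also have "\<dots> = norm x * norm y * K"
      unfolding K_def sum_distrib_left by (intro sum.cong) auto
    finally show ?thesis .
  qed
  then show ?thesis
    by (intro bounded_bilinear.intro exI[of _ K] allI)
      (auto simp: linear_add[OF l] linear_add[OF r] linear_cmul[OF l] linear_cmul[OF r])
qed

text \<open>Stands in for completeness: absolute convergence passes to each real coordinate, where
  it implies convergence, and the finitely many coordinates are reassembled.\<close>

lemma fin_dim_summable:
  fixes f :: "nat \<Rightarrow> 'd::real_normed_vector"
  assumes "fin_dim TYPE('d)" "summable (\<lambda>n. norm (f n))"
  shows "summable f"
proof -
  obtain n c and e :: "nat \<Rightarrow> 'd" where c: "\<And>i. i < n \<Longrightarrow> bounded_linear (c i)"
    and e: "\<And>x. x = (\<Sum>i<n. c i x *\<^sub>R e i)" using that by (rule fin_dimE[OF assms(1)])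
  have "summable (\<lambda>k. c i (f k))" if "i < n" for i
  proof (rule summable_norm_cancel, rule summable_comparison_test'[where N=0])
    show "summable (\<lambda>k. onorm (c i) * norm (f k))" using assms(2) by (rule summable_mult)
    show "norm (norm (c i (f k))) \<le> onorm (c i) * norm (f k)" for k
      using onorm[OF c[OF that]] by simp
  qed
  then have "summable (\<lambda>k. \<Sum>i<n. c i (f k) *\<^sub>R e i)"
    by (intro summable_sum summable_scaleR_left) auto
  then show ?thesis unfolding e[symmetric] .
qed

lemma fin_dim_inj_imp_bij:
  fixes f :: "'d::real_normed_vector \<Rightarrow> 'd"
  assumes "fin_dim TYPE('d)" "linear f" "inj f"
  shows "bij f"
proof -
  obtain n c and e :: "nat \<Rightarrow> 'd" where c: "\<And>i. i < n \<Longrightarrow> bounded_linear (c i)"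
    and e: "\<And>x. x = (\<Sum>i<n. c i x *\<^sub>R e i)" using that by (rule fin_dimE[OF assms(1)])
  have sp: "span (e ` {..<n}) = UNIV"
  proof -
    have "(\<Sum>i<n. c i x *\<^sub>R e i) \<in> span (e ` {..<n})" for x
      by (intro span_sum span_scale span_base) auto
    then have "x \<in> span (e ` {..<n})" for x unfolding e[symmetric] .
    then show ?thesis by auto
  qed
  \<comment> \<open>An independent subfamily of the spanning family gives access to linear algebra
    over a finite basis, where injective endomorphisms are onto.\<close>
  obtain B where B: "B \<subseteq> e ` {..<n}" "independent B" "span B = span (e ` {..<n})"
    using maximal_independent_subset[of "e ` {..<n}"]
    by (metis span_mono span_span subset_antisym)
  have "finite B" using B(1) finite_subset by auto
  interpret fd: finite_dimensional_vector_space "scaleR :: real \<Rightarrow> 'd \<Rightarrow> 'd" B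
  proof unfold_locales
    show "finite B" by fact
    show "\<not> module.dependent (*\<^sub>R) B" using B(2) by (simp add: dependent_raw_def)
    show "module.span (*\<^sub>R) B = UNIV" using B(3) sp by (simp add: span_raw_def)
  qed
  have "surj f"
    using fd.linear_inj_imp_surj assms(2,3) by (simp add: linear_def)
  then show ?thesis using assms(3) by (simp add: bij_def)
qed

lemma fin_dim_prod:
  assumes "fin_dim TYPE('c::real_normed_vector)" "fin_dim TYPE('d::real_normed_vector)"
  shows "fin_dim TYPE('c \<times> 'd)"
proof -
  obtain n c and e :: "nat \<Rightarrow> 'c" where c: "\<And>i. i < n \<Longrightarrow> bounded_linear (c i)"
    and e: "\<And>x. x = (\<Sum>i<n. c i x *\<^sub>R e i)" using that by (rule fin_dimE[OF assms(1)])
  obtain m c' and e' :: "nat \<Rightarrow> 'd" where c': "\<And>i. i < m \<Longrightarrow> bounded_linear (c' i)"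
    and e': "\<And>x. x = (\<Sum>i<m. c' i x *\<^sub>R e' i)" using that by (rule fin_dimE[OF assms(2)])
  define C where "C i x = (if i < n then c i (fst x) else c' (i - n) (snd x))" for i and x :: "'c \<times> 'd"
  define F where "F i = (if i < n then (e i, 0) else (0, e' (i - n)))" for i
  have "bounded_linear (C i)" if "i < n + m" for i
    unfolding C_def using that c c'
    by (cases "i < n")
      (auto intro!: bounded_linear_compose[OF _ bounded_linear_fst] bounded_linear_compose[OF _ bounded_linear_snd])
  moreover have "x = (\<Sum>i<n+m. C i x *\<^sub>R F i)" for x
  proof -
    have s: "(\<Sum>i<n+m. g i) = (\<Sum>i<n. g i) + (\<Sum>i<m. g (n + i))" for g :: "nat \<Rightarrow> 'c \<times> 'd"
    proof -
      have "{..<n+m} = {..<n} \<union> {n..<n+m}" by auto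
      then have "(\<Sum>i<n+m. g i) = sum g {..<n} + sum g {n..<n+m}"
        by (simp add: sum.union_disjoint[of "{..<n}" "{n..<n+m}"] ivl_disj_int(2))
      also have "sum g {n..<n+m} = (\<Sum>i<m. g (n + i))"
        using sum.shift_bounds_nat_ivl[of g 0 n m] by (simp add: atLeast0LessThan add.commute)
      finally show ?thesis .
    qed
    have "(\<Sum>i<n+m. C i x *\<^sub>R F i) = (\<Sum>i<n. (c i (fst x) *\<^sub>R e i, 0)) + (\<Sum>i<m. (0, c' i (snd x) *\<^sub>R e' i))"
      unfolding s C_def F_def by (intro arg_cong2[where f="(+)"] sum.cong) auto
    also have "\<dots> = (\<Sum>i<n. c i (fst x) *\<^sub>R e i, \<Sum>i<m. c' i (snd x) *\<^sub>R e' i)"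
      by (rule prod_eqI) (simp_all add: fst_sum snd_sum)
    also have "\<dots> = x" using e[of "fst x"] e'[of "snd x"] by simp
    finally show ?thesis by simp
  qed
  ultimately show ?thesis unfolding fin_dim_def by blast
qed

lemma has_derivative_coords:
  fixes f :: "'a::real_normed_vector \<Rightarrow> 'd::real_normed_vector"
  assumes e: "\<And>x. x = (\<Sum>i<(n::nat). c i x *\<^sub>R e i)"
    and d: "\<And>i. i < n \<Longrightarrow> ((\<lambda>x. c i (f x)) has_derivative (\<lambda>v. c i (f' v))) F"
  shows "(f has_derivative f') F"
proof -
  have "((\<lambda>x. \<Sum>i<n. c i (f x) *\<^sub>R e i) has_derivative (\<lambda>v. \<Sum>i<n. c i (f' v) *\<^sub>R e i)) F"
    using d by (intro has_derivative_sum has_derivative_scaleR_left) auto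
  then show ?thesis unfolding e[symmetric] .
qed

text \<open>Differentiability of \<open>F\<close> is assumed at each fixed vector only. Expanding
  the argument in finitely many coordinates makes this sufficient, so no norm on operators
  enters.\<close>

lemma has_derivative_apply:
  fixes f :: "'a::real_normed_vector \<Rightarrow> 'x::real_normed_vector"
    and F :: "'a \<Rightarrow> 'x \<Rightarrow> 'y::real_normed_vector"
  assumes fd: "fin_dim TYPE('x)" and lin: "\<And>q. linear (F q)" and lin': "\<And>v. linear (F' v)"
    and F: "\<And>x. ((\<lambda>q. F q x) has_derivative (\<lambda>v. F' v x)) (at p)"
    and f: "(f has_derivative f') (at p)"
  shows "((\<lambda>q. F q (f q)) has_derivative (\<lambda>v. F' v (f p) + F p (f' v))) (at p)"
proof -
  obtain n c and e :: "nat \<Rightarrow> 'x" where c: "\<And>i. i < n \<Longrightarrow> bounded_linear (c i)"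
    and e: "\<And>x. x = (\<Sum>i<n. c i x *\<^sub>R e i)" using that by (rule fin_dimE[OF fd])
  have "((\<lambda>q. \<Sum>i<n. c i (f q) *\<^sub>R F q (e i)) has_derivative
      (\<lambda>v. \<Sum>i<n. c i (f p) *\<^sub>R F' v (e i) + c i (f' v) *\<^sub>R F p (e i))) (at p)"
    by (intro has_derivative_sum has_derivative_scaleR F bounded_linear.has_derivative[OF c f]) auto
  then show ?thesis
    unfolding linear_expand[OF lin e, of _ "f _", symmetric] sum.distrib
      linear_expand[OF lin' e, of _ "f p", symmetric] linear_expand[OF lin e, of _ "f' _", symmetric] .
qed

section \<open>Invertible operators depending on a parameter\<close>

lemma linear_inv_bij:
  assumes "linear f" "bij f"
  shows "linear (inv f)"
proof (rule linearI)
  have f: "f (inv f y) = y" for y using assms(2) by (simp add: bij_is_surj surj_f_inv_f)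
  have g: "inv f (f x) = x" for x using assms(2) by (simp add: bij_is_inj)
  show "inv f (x + y) = inv f x + inv f y" for x y
    using g[of "inv f x + inv f y"] by (simp add: linear_add[OF assms(1)] f)
  show "inv f (r *\<^sub>R x) = r *\<^sub>R inv f x" for r x
    using g[of "r *\<^sub>R inv f x"] by (simp add: linear_cmul[OF assms(1)] f)
qed

lemma fin_dim_inj_bounded_below:
  fixes f :: "'d::real_normed_vector \<Rightarrow> 'd"
  assumes "fin_dim TYPE('d)" "linear f" "inj f"
  obtains c where "c > 0" "\<And>x. norm (f x) \<ge> c * norm x"
proof -
  have b: "bij f" using fin_dim_inj_imp_bij[OF assms] .
  have "linear (inv f)"
    using assms(2) b by (rule linear_inv_bij)
  then have "bounded_linear (inv f)" by (rule fin_dim_bounded_linear[OF assms(1)])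
  then obtain K where K: "K > 0" "\<And>y. norm (inv f y) \<le> norm y * K"
    using bounded_linear.pos_bounded by blast
  have "norm (f x) \<ge> (1/K) * norm x" for x
    using K(2)[of "f x"] K(1) assms(3) by (simp add: field_simps inv_f_f)
  then show ?thesis using that[of "1/K"] K(1) by simp
qed

text \<open>The deviation at any vector is controlled by the deviations at the finitely many
  spanning vectors \<open>e i\<close>.\<close>

lemma fin_dim_pointwise_uniform:
  fixes T :: "'a::topological_space \<Rightarrow> 'd::real_normed_vector \<Rightarrow> 'e::real_normed_vector"
  assumes fd: "fin_dim TYPE('d)" and lin: "\<And>q. linear (T q)"
    and cont: "\<And>x. ((\<lambda>q. T q x) \<longlongrightarrow> T p x) (at p)" and "\<epsilon> > 0"
  shows "\<forall>\<^sub>F q in at p. \<forall>x. norm (T q x - T p x) \<le> \<epsilon> * norm x"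
proof -
  obtain n c and e :: "nat \<Rightarrow> 'd" where c: "\<And>i. i < n \<Longrightarrow> bounded_linear (c i)"
    and e: "\<And>x. x = (\<Sum>i<n. c i x *\<^sub>R e i)" using that by (rule fin_dimE[OF fd])
  have "((\<lambda>q. \<Sum>i<n. onorm (c i) * norm (T q (e i) - T p (e i))) \<longlongrightarrow>
      (\<Sum>i<n. onorm (c i) * norm (T p (e i) - T p (e i)))) (at p)"
    by (intro tendsto_sum tendsto_mult tendsto_const tendsto_norm tendsto_diff cont)
  then have "\<forall>\<^sub>F q in at p. (\<Sum>i<n. onorm (c i) * norm (T q (e i) - T p (e i))) < \<epsilon>"
    using \<open>\<epsilon> > 0\<close> by (auto intro: order_tendstoD)
  then show ?thesis
  proof (rule eventually_mono, intro allI)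
    fix q x assume small: "(\<Sum>i<n. onorm (c i) * norm (T q (e i) - T p (e i))) < \<epsilon>"
    have "T r x = (\<Sum>i<n. c i x *\<^sub>R T r (e i))" for r
      by (rule linear_expand[OF lin e])
    from this[of q] this[of p] have "T q x - T p x = (\<Sum>i<n. c i x *\<^sub>R (T q (e i) - T p (e i)))"
      by (simp only: sum_subtractf scaleR_diff_right)
    also have "norm \<dots> \<le> (\<Sum>i<n. norm (c i x *\<^sub>R (T q (e i) - T p (e i))))" by (rule norm_sum)
    also have "\<dots> \<le> (\<Sum>i<n. onorm (c i) * norm (T q (e i) - T p (e i)) * norm x)"
    proof (rule sum_mono)
      fix i assume "i \<in> {..<n}"
      then have "norm (c i x) \<le> onorm (c i) * norm x" using onorm[OF c] by auto
      then have "norm (c i x) * norm (T q (e i) - T p (e i)) \<le> onorm (c i) * norm x * norm (T q (e i) - T p (e i))"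
        by (rule mult_right_mono) simp
      then show "norm (c i x *\<^sub>R (T q (e i) - T p (e i))) \<le> onorm (c i) * norm (T q (e i) - T p (e i)) * norm x"
        by (simp only: norm_scaleR real_norm_def mult_ac)
    qed
    also have "\<dots> \<le> \<epsilon> * norm x" unfolding sum_distrib_right[symmetric]
      using small by (intro mult_right_mono) auto
    finally show "norm (T q x - T p x) \<le> \<epsilon> * norm x" .
  qed
qed

text \<open>A perturbation of at most half the lower bound of \<open>T p\<close> leaves half of that
  bound. The bound is kept in the conclusion because it is uniform in \<open>q\<close>, which
  differentiating the inverse requires.\<close>

lemma eventually_bij:
  fixes T :: "'a::topological_space \<Rightarrow> 'd::real_normed_vector \<Rightarrow> 'd"
  assumes fd: "fin_dim TYPE('d)" and lin: "\<And>q. linear (T q)"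
    and cont: "\<And>x. ((\<lambda>q. T q x) \<longlongrightarrow> T p x) (at p)" and "inj (T p)"
  obtains c where "c > 0" "\<forall>\<^sub>F q in nhds p. bij (T q) \<and> (\<forall>x. norm (T q x) \<ge> c * norm x)"
proof -
  obtain c where c: "c > 0" "\<And>x. norm (T p x) \<ge> c * norm x"
    using that by (rule fin_dim_inj_bounded_below[OF fd lin \<open>inj (T p)\<close>])
  have "\<forall>\<^sub>F q in at p. \<forall>x. norm (T q x - T p x) \<le> c/2 * norm x"
    using fin_dim_pointwise_uniform[OF fd lin cont, of "c/2"] c(1) by auto
  then have "\<forall>\<^sub>F q in nhds p. \<forall>x. norm (T q x - T p x) \<le> c/2 * norm x"
    using c(1) by (subst eventually_nhds_conv_at) auto
  then have "\<forall>\<^sub>F q in nhds p. bij (T q) \<and> (\<forall>x. norm (T q x) \<ge> c/2 * norm x)"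
  proof (rule eventually_mono)
    fix q assume q: "\<forall>x. norm (T q x - T p x) \<le> c/2 * norm x"
    have b: "norm (T q x) \<ge> c/2 * norm x" for x
    proof -
      have "norm (T p x) \<le> norm (T q x) + norm (T q x - T p x)"
        by (metis norm_minus_commute norm_triangle_sub)
      then show ?thesis using q[rule_format, of x] c(2)[of x] by simp
    qed
    have "x = 0" if "T q x = 0" for x
      using b[of x] that c(1) by (simp add: mult_le_0_iff)
    then have "inj (T q)" using linear_injective_0[OF lin] by blast
    then show "bij (T q) \<and> (\<forall>x. norm (T q x) \<ge> c/2 * norm x)"
      using fin_dim_inj_imp_bij[OF fd lin] b by blast
  qed
  then show ?thesis using that[of "c/2"] c(1) by auto
qed

text \<open>Differentiating \<open>T q (x q) = y q\<close> implicitly dictates the candidate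
  \<open>x'\<close>. The first-order guess built from it solves the equation up to a residual
  \<open>r\<close> of order less than \<open>norm (q - p)\<close>, and the uniform lower bound for
  \<open>T q\<close> transfers this to the error of the guess.\<close>

lemma has_derivative_inv_apply:
  fixes T :: "'a::real_normed_vector \<Rightarrow> 'd::real_normed_vector \<Rightarrow> 'd"
  assumes fd: "fin_dim TYPE('d)" and lin: "\<And>q. linear (T q)" and lin': "\<And>v. linear (T' v)"
    and T: "\<And>x. ((\<lambda>q. T q x) has_derivative (\<lambda>v. T' v x)) (at p)"
    and y: "(y has_derivative y') (at p)" and "bij (T p)"
  shows "((\<lambda>q. inv (T q) (y q)) has_derivative
     (\<lambda>v. inv (T p) (y' v - T' v (inv (T p) (y p))))) (at p)"
proof -
  define x where "x q = inv (T q) (y q)" for q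
  define x' where "x' v = inv (T p) (y' v - T' v (x p))" for v
  have cont: "((\<lambda>q. T q x) \<longlongrightarrow> T p x) (at p)" for x
    using has_derivative_continuous[OF T] by (simp add: continuous_within)
  obtain c where c: "c > 0"
    and ev: "\<forall>\<^sub>F q in nhds p. bij (T q) \<and> (\<forall>x. norm (T q x) \<ge> c * norm x)"
    using that by (rule eventually_bij[OF fd lin cont bij_is_inj[OF \<open>bij (T p)\<close>]])
  have linv: "linear (inv (T p))"
    using lin \<open>bij (T p)\<close> by (rule linear_inv_bij)
  have T'bl: "bounded_linear (\<lambda>v. T' v z)" for z using has_derivative_bounded_linear[OF T] .
  have y'bl: "bounded_linear y'" using has_derivative_bounded_linear[OF y] .
  have x'bl: "bounded_linear x'"
    unfolding x'_def
    by (intro bounded_linear_compose[OF fin_dim_bounded_linear[OF fd linv]] bounded_linear_sub T'bl y'bl)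
  have Tx': "T p (x' v) = y' v - T' v (x p)" for v
    unfolding x'_def using \<open>bij (T p)\<close> by (simp add: bij_is_surj surj_f_inv_f)
  define r where "r q = T q (x p + x' (q - p)) - y q" for q
  have D: "((\<lambda>q. T q (x p + x' (q - p)) - y q) has_derivative
      (\<lambda>v. (T' v (x p + x' (p - p)) + T p (0 + x' (v - 0))) - y' v)) (at p)"
    by (intro has_derivative_diff has_derivative_apply[OF fd lin lin' T] has_derivative_add
        has_derivative_const bounded_linear.has_derivative[OF x'bl] has_derivative_ident y)
  have x0: "x' 0 = 0" using x'bl by (simp add: linear_0 bounded_linear.linear)
  have "(r has_derivative (\<lambda>v. 0)) (at p)"
    using D unfolding r_def by (simp add: x0 Tx')
  moreover have rp: "r p = 0" unfolding r_def x_def using \<open>bij (T p)\<close>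
    by (simp add: x0 bij_is_surj surj_f_inv_f)
  ultimately have lim: "((\<lambda>q. norm (r q) / norm (q - p)) \<longlongrightarrow> 0) (at p)"
    by (simp add: has_derivative_at_within tendsto_norm_zero_iff[symmetric, of "\<lambda>y. r y /\<^sub>R norm (y - p)"] divide_inverse mult.commute)
  have lim2: "((\<lambda>q. norm (x q - x p - x' (q - p)) / norm (q - p)) \<longlongrightarrow> 0) (at p)"
  proof (rule tendsto_sandwich[OF _ _ tendsto_const])
    show "\<forall>\<^sub>F q in at p. 0 \<le> norm (x q - x p - x' (q - p)) / norm (q - p)" by simp
    show "((\<lambda>q. (1/c) * (norm (r q) / norm (q - p))) \<longlongrightarrow> 0) (at p)"
      using tendsto_mult[OF tendsto_const lim, of "1/c"] by simp
    have "\<forall>\<^sub>F q in at p. bij (T q) \<and> (\<forall>x. norm (T q x) \<ge> c * norm x)"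
      using ev by (simp add: eventually_nhds_conv_at)
    then show "\<forall>\<^sub>F q in at p. norm (x q - x p - x' (q - p)) / norm (q - p) \<le> (1/c) * (norm (r q) / norm (q - p))"
    proof (rule eventually_mono)
      fix q assume q: "bij (T q) \<and> (\<forall>x. norm (T q x) \<ge> c * norm x)"
      have "T q (x q - x p - x' (q - p)) = - r q"
        unfolding r_def using q
        by (simp add: linear_diff[OF lin] linear_add[OF lin] x_def bij_is_surj surj_f_inv_f)
      then have "c * norm (x q - x p - x' (q - p)) \<le> norm (r q)" using q by (metis norm_minus_cancel)
      then have "norm (x q - x p - x' (q - p)) \<le> (1/c) * norm (r q)" using c by (simp add: field_simps)
      then show "norm (x q - x p - x' (q - p)) / norm (q - p) \<le> (1/c) * (norm (r q) / norm (q - p))"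
        using divide_right_mono[of _ _ "norm (q - p)"] by fastforce
    qed
  qed
  have "(x has_derivative x') (at p)"
    unfolding has_derivative_iff_norm using x'bl lim2 by blast
  then show ?thesis unfolding x_def x'_def .
qed

text \<open>Picard's contraction estimate on intervals of length \<open>1/(2K)\<close>.\<close>

lemma linear_ode_unique_nonneg:
  fixes y :: "real \<Rightarrow> 'd::real_normed_vector"
  assumes A: "bounded_linear A" and y: "\<And>t. (y has_vector_derivative A (y t)) (at t)" and "y 0 = 0" "t \<ge> 0"
  shows "y t = 0"
proof -
  obtain K where K: "K > 0" "\<And>x. norm (A x) \<le> norm x * K" using bounded_linear.pos_bounded[OF A] by blast
  define h where "h = 1 / (2 * K)"
  have h: "h > 0" using K by (simp add: h_def)
  have step: "\<forall>s\<in>{a..a+h}. y s = 0" if "y a = 0" for a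
  proof -
    have cont: "continuous_on {a..a+h} (\<lambda>t. norm (y t))"
      by (intro continuous_on_norm continuous_at_imp_continuous_on ballI)
        (metis y has_vector_derivative_continuous)
    obtain m where m: "m \<in> {a..a+h}" "\<And>s. s \<in> {a..a+h} \<Longrightarrow> norm (y s) \<le> norm (y m)"
      using continuous_attains_sup[OF compact_Icc _ cont] h by auto
    have "norm (y m - y a) \<le> (norm (y m) * K) * norm (m - a)"
    proof (rule differentiable_bound[of "{a..a+h}" y "\<lambda>t v. v *\<^sub>R A (y t)"])
      show "convex {a..a+h}" by simp
      fix s assume s: "s \<in> {a..a+h}"
      show "(y has_derivative (\<lambda>v. v *\<^sub>R A (y s))) (at s within {a..a+h})"
        using y[of s] unfolding has_vector_derivative_def by (rule has_derivative_at_withinI)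
      have "onorm (\<lambda>v. v *\<^sub>R A (y s)) \<le> norm (A (y s))"
        by (rule onorm_le) (simp add: mult.commute)
      also have "\<dots> \<le> norm (y m) * K"
        using K(2)[of "y s"] m(2)[OF s] K(1) by (smt (verit) mult_right_mono)
      finally show "onorm (\<lambda>v. v *\<^sub>R A (y s)) \<le> norm (y m) * K" .
    qed (use m h in auto)
    also have "\<dots> \<le> (norm (y m) * K) * h" using m(1) K(1) by (intro mult_left_mono) auto
    also have "\<dots> = norm (y m) / 2" using K(1) by (simp add: h_def)
    finally have "norm (y m) = 0" using that by simp
    then show ?thesis using m(2) by (metis norm_le_zero_iff)
  qed
  have "\<forall>s\<in>{0..n*h}. y s = 0" for n :: nat
  proof (induction n)
    case 0 then show ?case using assms by auto
  next
    case (Suc n)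
    have "y (n*h) = 0" using Suc h by auto
    from step[OF this] Suc show ?case by (auto simp: algebra_simps)
  qed
  moreover obtain n :: nat where "t / h \<le> n" using real_arch_simple by blast
  ultimately show ?thesis using \<open>t \<ge> 0\<close> h by (auto simp: field_simps)
qed

lemma linear_ode_unique:
  fixes y :: "real \<Rightarrow> 'd::real_normed_vector"
  assumes A: "bounded_linear A" and y: "\<And>t. (y has_vector_derivative A (y t)) (at t)" and "y 0 = 0"
  shows "y t = 0"
proof (cases "t \<ge> 0")
  case True then show ?thesis using linear_ode_unique_nonneg[OF assms] by blast
next
  case False
  have "((\<lambda>t. y (- t)) has_vector_derivative (- A (y (- t)))) (at t)" for t
  proof -
    have "(uminus has_vector_derivative (-1 :: real)) (at t)"
      using has_vector_derivative_minus[OF has_vector_derivative_id] by simp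
    from vector_diff_chain_at[OF this y] show ?thesis by (simp add: o_def)
  qed
  then have "y (- (- t)) = 0"
    using linear_ode_unique_nonneg[of "\<lambda>x. - A x" "\<lambda>t. y (- t)" "- t"] False assms(3)
    by (simp add: bounded_linear_minus[OF A])
  then show ?thesis by simp
qed

lemma vector_derivative_eq_imp_eq:
  fixes x y :: "real \<Rightarrow> 'd::real_normed_vector"
  assumes "\<And>t. (x has_vector_derivative d t) (at t)" "\<And>t. (y has_vector_derivative d t) (at t)" "x 0 = y 0"
  shows "x t = y t"
proof -
  have "((\<lambda>t. x t - y t) has_vector_derivative (0 :: 'd)) (at t)" for t
    using has_vector_derivative_diff[OF assms(1,2)] by simp
  then have "x t - y t = x 0 - y 0"
    using linear_ode_unique[of "\<lambda>_. 0" "\<lambda>t. x t - y t"] assms(3) by simp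
  then show ?thesis using assms(3) by simp
qed

section \<open>Series of homogeneous polynomials\<close>

lemma times_differentiable_on_subset:
  "times_differentiable_on k V f \<Longrightarrow> U \<subseteq> V \<Longrightarrow> times_differentiable_on k U f"
  by (induction k arbitrary: f) (auto intro: continuous_on_subset)

lemma times_differentiable_on_bounded_linear:
  assumes "bounded_linear T" "times_differentiable_on k UNIV f"
  shows "times_differentiable_on k UNIV (\<lambda>x. T (f x))"
  using assms(2)
proof (induction k arbitrary: f)
  case 0
  then show ?case by (simp add: bounded_linear.continuous_on[OF assms(1)])
next
  case (Suc k)
  have d: "((\<lambda>x. T (f x)) has_derivative (\<lambda>v. T (frechet_derivative f (at x) v))) (at x)" for x
    using Suc.prems by (intro bounded_linear.has_derivative[OF assms(1)])
      (auto simp: frechet_derivative_works[symmetric])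
  then have "(\<lambda>x. T (f x)) differentiable at x" for x unfolding differentiable_def by blast
  moreover have "frechet_derivative (\<lambda>x. T (f x)) (at x) = (\<lambda>v. T (frechet_derivative f (at x) v))" for x
    using frechet_derivative_at[OF d] by simp
  ultimately show ?case using Suc by simp
qed

lemma times_differentiable_on_add:
  assumes "times_differentiable_on k UNIV f" "times_differentiable_on k UNIV g"
  shows "times_differentiable_on k UNIV (\<lambda>x. f x + g x)"
  using assms
proof (induction k arbitrary: f g)
  case 0
  then show ?case by (simp add: continuous_on_add)
next
  case (Suc k)
  have d: "((\<lambda>x. f x + g x) has_derivative (\<lambda>v. frechet_derivative f (at x) v + frechet_derivative g (at x) v)) (at x)" for x
    using Suc.prems by (intro has_derivative_add) (auto simp: frechet_derivative_works[symmetric])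
  then have "(\<lambda>x. f x + g x) differentiable at x" for x unfolding differentiable_def by blast
  moreover have "frechet_derivative (\<lambda>x. f x + g x) (at x) = (\<lambda>v. frechet_derivative f (at x) v + frechet_derivative g (at x) v)" for x
    using frechet_derivative_at[OF d] by simp
  ultimately show ?case using Suc by simp
qed

text \<open>A class of functions closed under directional derivatives replaces explicit formulas for
  the higher ones.\<close>

lemma smooth_on_coinduct:
  assumes "P f"
    and step: "\<And>f. P f \<Longrightarrow> \<exists>f'. \<forall>x. (f has_derivative f' x) (at x) \<and> (\<forall>v. P (\<lambda>x. f' x v))"
  shows "smooth_on UNIV f"
proof -
  have "times_differentiable_on k UNIV f" if "P f" for k f
    using that
  proof (induction k arbitrary: f)
    case 0
    obtain f' where "\<And>x. (f has_derivative f' x) (at x)" using step[OF 0] by blast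
    then have "continuous_on UNIV f"
      by (intro continuous_at_imp_continuous_on ballI has_derivative_continuous)
    then show ?case by simp
  next
    case (Suc k)
    obtain f' where f': "\<And>x. (f has_derivative f' x) (at x)" "\<And>v. P (\<lambda>x. f' x v)"
      using step[OF Suc.prems] by blast
    then have "frechet_derivative f (at x) = f' x" for x using frechet_derivative_at[OF f'(1)] by simp
    then show ?case using f' Suc.IH by (auto simp: differentiable_def)
  qed
  then show ?thesis using assms(1) by (simp add: smooth_on_def)
qed

text \<open>
  Homogeneous polynomial maps of degree \<open>n\<close> with a bound that a directional derivative multiplies by
  \<open>n\<close> only, so that the class of everywhere convergent series of such maps is closed under
  directional derivatives.
\<close>

primrec hom_poly :: "nat \<Rightarrow> real \<Rightarrow> ('a::real_normed_vector \<Rightarrow> 'b::real_normed_vector) \<Rightarrow> bool" where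
  "hom_poly 0 C f \<longleftrightarrow> (\<exists>c. f = (\<lambda>_. c) \<and> norm c \<le> C)"
| "hom_poly (Suc n) C f \<longleftrightarrow> (\<forall>p. norm (f p) \<le> C * norm p ^ Suc n) \<and>
     (\<exists>f'. (\<forall>p. (f has_derivative f' p) (at p)) \<and>
       (\<forall>v. hom_poly n (real (Suc n) * C * norm v) (\<lambda>p. f' p v)))"

lemma hom_poly_SucI:
  assumes "\<And>v. hom_poly n (real (Suc n) * C * norm v) (\<lambda>p. f' p v)"
    "\<And>p. (f has_derivative f' p) (at p)" "\<And>p. norm (f p) \<le> C * norm p ^ Suc n"
  shows "hom_poly (Suc n) C f"
  unfolding hom_poly.simps using assms by blast

lemma hom_poly_bound: "hom_poly n C f \<Longrightarrow> norm (f p) \<le> C * norm p ^ n"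
  by (cases n) auto

lemma hom_poly_add:
  "hom_poly n C f \<Longrightarrow> hom_poly n D g \<Longrightarrow> hom_poly n (C + D) (\<lambda>p. f p + g p)"
proof (induction n arbitrary: C D f g)
  case 0
  then obtain c d where "f = (\<lambda>_. c)" "norm c \<le> C" "g = (\<lambda>_. d)" "norm d \<le> D" by auto
  then show ?case by (auto intro!: exI[of _ "c + d"] norm_triangle_mono)
next
  case (Suc n)
  obtain f' where f': "\<And>p. (f has_derivative f' p) (at p)"
    "\<And>v. hom_poly n (real (Suc n) * C * norm v) (\<lambda>p. f' p v)" using Suc.prems(1) by auto
  obtain g' where g': "\<And>p. (g has_derivative g' p) (at p)"
    "\<And>v. hom_poly n (real (Suc n) * D * norm v) (\<lambda>p. g' p v)" using Suc.prems(2) by auto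
  have "hom_poly n (real (Suc n) * (C + D) * norm v) (\<lambda>p. f' p v + g' p v)" for v
    using Suc.IH[OF f'(2) g'(2), of v v] by (simp add: algebra_simps)
  moreover have "((\<lambda>p. f p + g p) has_derivative (\<lambda>v. f' p v + g' p v)) (at p)" for p
    by (intro has_derivative_add f' g')
  moreover have "norm (f p + g p) \<le> (C + D) * norm p ^ Suc n" for p
    using norm_triangle_mono[OF hom_poly_bound[OF Suc.prems(1)] hom_poly_bound[OF Suc.prems(2)]]
    by (simp add: algebra_simps)
  ultimately show ?case by (rule hom_poly_SucI)
qed

lemma hom_poly_linear:
  assumes T: "bounded_linear T" "\<And>x. norm (T x) \<le> K * norm x" "K \<ge> 0"
  shows "hom_poly n C f \<Longrightarrow> hom_poly n (K * C) (\<lambda>p. T (f p))"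
proof (induction n arbitrary: C f)
  case 0
  then obtain c where "f = (\<lambda>_. c)" "norm c \<le> C" by auto
  then show ?case using T by (auto intro!: exI[of _ "T c"] order_trans[OF T(2)] mult_left_mono)
next
  case (Suc n)
  obtain f' where f': "\<And>p. (f has_derivative f' p) (at p)"
    "\<And>v. hom_poly n (real (Suc n) * C * norm v) (\<lambda>p. f' p v)" using Suc.prems by auto
  have "hom_poly n (real (Suc n) * (K * C) * norm v) (\<lambda>p. T (f' p v))" for v
    using Suc.IH[OF f'(2), of v] by (simp add: algebra_simps)
  moreover have "((\<lambda>p. T (f p)) has_derivative (\<lambda>v. T (f' p v))) (at p)" for p
    by (rule bounded_linear.has_derivative[OF T(1) f'(1)])
  moreover have "norm (T (f p)) \<le> (K * C) * norm p ^ Suc n" for p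
    using order_trans[OF T(2) mult_left_mono[OF hom_poly_bound[OF Suc.prems] T(3)], of p]
    by (simp only: mult.assoc)
  ultimately show ?case by (rule hom_poly_SucI)
qed

text \<open>For \<open>f\<close> of degree \<open>Suc n\<close>, Leibniz gives a part
  \<open>b v (f p)\<close> with constant \<open>K * C * norm v\<close> and a part with
  \<open>Suc n\<close> times that constant. The sum is exactly the factor \<open>Suc (Suc n)\<close>
  demanded by the degree of the product.\<close>

lemma hom_poly_bilinear:
  fixes b :: "'a::real_normed_vector \<Rightarrow> 'd::real_normed_vector \<Rightarrow> 'e::real_normed_vector"
  assumes b: "bounded_bilinear b" and K: "\<And>q x. norm (b q x) \<le> K * norm q * norm x" "K \<ge> 0"
  shows "hom_poly n C f \<Longrightarrow> hom_poly (Suc n) (K * C) (\<lambda>p. b p (f p))"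
proof (induction n arbitrary: C f)
  case 0
  then obtain c where c: "f = (\<lambda>_. c)" "norm c \<le> C" by auto
  have bd: "norm (b p c) \<le> K * C * norm p" for p
    using order_trans[OF K(1)[of p c] mult_left_mono[OF c(2), of "K * norm p"]] K(2)
    by (simp add: algebra_simps)
  have "((\<lambda>p. b p c) has_derivative (\<lambda>v. b v c)) (at p)" for p
    by (intro bounded_linear_imp_has_derivative bounded_bilinear.bounded_linear_left[OF b])
  then show ?case using bd by (auto simp: c intro!: exI[of _ "\<lambda>p v. b v c"])
next
  case (Suc n)
  obtain f' where f': "\<And>p. (f has_derivative f' p) (at p)"
    "\<And>v. hom_poly n (real (Suc n) * C * norm v) (\<lambda>p. f' p v)" using Suc.prems by auto
  have "hom_poly (Suc n) (real (Suc (Suc n)) * (K * C) * norm v) (\<lambda>p. b v (f p) + b p (f' p v))" for v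
  proof -
    have "hom_poly (Suc n) (K * norm v * C) (\<lambda>p. b v (f p))"
      by (rule hom_poly_linear[OF bounded_bilinear.bounded_linear_right[OF b] _ _ Suc.prems])
        (use K in auto)
    from hom_poly_add[OF this Suc.IH[OF f'(2), of v]] show ?thesis by (simp add: algebra_simps)
  qed
  moreover have "((\<lambda>p. b p (f p)) has_derivative (\<lambda>v. b v (f p) + b p (f' p v))) (at p)" for p
    using bounded_bilinear.FDERIV[OF b has_derivative_ident f'(1)] by (simp add: add.commute)
  moreover have "norm (b p (f p)) \<le> (K * C) * norm p ^ Suc (Suc n)" for p
    using order_trans[OF K(1)[of p "f p"] mult_left_mono[OF hom_poly_bound[OF Suc.prems, of p], of "K * norm p"]] K(2)
    by (simp add: algebra_simps)
  ultimately show ?case by (rule hom_poly_SucI)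
qed

lemma hom_poly_derivative_bound:
  assumes "hom_poly n C f" "(f has_derivative f') (at p)"
  shows "norm (f' v) \<le> real n * C * norm p ^ (n - 1) * norm v"
proof (cases n)
  case 0
  then obtain c where "f = (\<lambda>_. c)" using assms(1) by auto
  then have "f' = (\<lambda>_. 0)" using assms(2) has_derivative_unique[OF _ has_derivative_const] by blast
  then show ?thesis using 0 by simp
next
  case (Suc m)
  then obtain g' where g': "\<And>p. (f has_derivative g' p) (at p)"
    "\<And>v. hom_poly m (real (Suc m) * C * norm v) (\<lambda>p. g' p v)" using assms(1) by auto
  have "f' = g' p" using has_derivative_unique[OF assms(2) g'(1)] .
  then show ?thesis using hom_poly_bound[OF g'(2), of p v] Suc by (simp add: algebra_simps)
qed

text \<open>On the ball of radius \<open>norm p + 1\<close> the derivatives of the terms are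
  dominated by \<open>M n\<close>, summable as the derived series of an entire one. Completeness of
  the target enters here; \<open>hom_poly_series_derivative\<close> applies this to real
  coordinates.\<close>

lemma hom_poly_series_derivative_banach:
  fixes f :: "nat \<Rightarrow> 'a::real_normed_vector \<Rightarrow> 'b::banach"
  assumes f: "\<And>n. hom_poly n (C n) (f n)" and C: "\<And>n. C n \<ge> 0" "\<And>r. summable (\<lambda>n. C n * r ^ n)"
    and f': "\<And>n p. (f n has_derivative f' n p) (at p)"
  shows "((\<lambda>p. \<Sum>n. f n p) has_derivative (\<lambda>v. \<Sum>n. f' n p v)) (at p)"
proof -
  define R where "R = norm p + 1"
  have R: "R \<ge> 0" "p \<in> ball 0 R" by (auto simp: R_def add_nonneg_pos)
  define M where "M n = real n * C n * R ^ (n - 1)" for n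
  have M0: "M n \<ge> 0" for n using C R by (simp add: M_def)
  have "summable (\<lambda>n. diffs C n * R ^ n)" by (rule termdiff_converges_all) (rule C(2))
  then have "summable (\<lambda>n. M (Suc n))" by (simp add: diffs_def M_def)
  then have M: "summable M" by (simp add: summable_Suc_iff)
  have bd: "norm (f' n x v) \<le> M n * norm v" if "x \<in> ball 0 R" for n x v
  proof -
    have "norm (f' n x v) \<le> real n * C n * norm x ^ (n - 1) * norm v"
      by (rule hom_poly_derivative_bound[OF f f'])
    also have "\<dots> \<le> M n * norm v" unfolding M_def
      using that C by (intro mult_right_mono mult_left_mono power_mono) auto
    finally show ?thesis .
  qed
  have sm: "summable (\<lambda>n. norm (f' n x v))" if "x \<in> ball 0 R" for x v
    by (rule summable_comparison_test'[OF summable_mult2[OF M, of "norm v"], of 0]) (simp add: bd[OF that])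
  have "\<exists>g. \<forall>x\<in>ball 0 R. (\<lambda>n. f n x) sums g x \<and>
      (g has_derivative (\<lambda>v. \<Sum>n. f' n x v)) (at x within ball 0 R)"
  proof (rule has_derivative_series[where x=p and l="\<Sum>n. f n p" and f'=f'])
    show "convex (ball (0::'a) R)" by simp
    show "(f n has_derivative f' n x) (at x within ball 0 R)" for n x
      using f' by (rule has_derivative_at_withinI)
    show "p \<in> ball 0 R" by fact
    have "summable (\<lambda>n. norm (f n p))"
      by (rule summable_comparison_test'[OF C(2)[of "norm p"], of 0]) (simp add: hom_poly_bound[OF f])
    then show "(\<lambda>n. f n p) sums (\<Sum>n. f n p)" by (rule summable_sums[OF summable_norm_cancel])
    fix e :: real assume "e > 0"
    have "(\<lambda>n. \<Sum>k. M (k + n)) \<longlonglongrightarrow> 0" by (rule suminf_exist_split2[OF M])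
    then have "\<forall>\<^sub>F n in sequentially. (\<Sum>k. M (k + n)) < e" using \<open>e > 0\<close> by (rule order_tendstoD)
    then show "\<forall>\<^sub>F n in sequentially. \<forall>x\<in>ball 0 R. \<forall>h. norm ((\<Sum>i<n. f' i x h) - (\<Sum>n. f' n x h)) \<le> e * norm h"
    proof (rule eventually_mono, intro ballI allI)
      fix n x h assume n: "(\<Sum>k. M (k + n)) < e" and x: "x \<in> ball (0::'a) R"
      have s: "summable (\<lambda>n. f' n x h)" by (rule summable_norm_cancel[OF sm[OF x]])
      have "norm ((\<Sum>i<n. f' i x h) - (\<Sum>n. f' n x h)) = norm (\<Sum>k. f' (k + n) x h)"
        by (simp add: suminf_minus_initial_segment[OF s] norm_minus_commute)
      also have "\<dots> \<le> (\<Sum>k. norm (f' (k + n) x h))"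
        by (rule summable_norm[OF summable_ignore_initial_segment[OF sm[OF x]]])
      also have "\<dots> \<le> (\<Sum>k. M (k + n) * norm h)"
        by (rule suminf_le[OF bd[OF x] summable_ignore_initial_segment[OF sm[OF x]]
              summable_mult2[OF summable_ignore_initial_segment[OF M]]])
      also have "\<dots> = (\<Sum>k. M (k + n)) * norm h"
        by (rule suminf_mult2[OF summable_ignore_initial_segment[OF M], symmetric])
      also have "\<dots> \<le> e * norm h" using n by (intro mult_right_mono) auto
      finally show "norm ((\<Sum>i<n. f' i x h) - (\<Sum>n. f' n x h)) \<le> e * norm h" .
    qed
  qed
  then obtain g where g: "\<And>x. x \<in> ball 0 R \<Longrightarrow> (\<lambda>n. f n x) sums g x"
    "(g has_derivative (\<lambda>v. \<Sum>n. f' n p v)) (at p within ball 0 R)" using R(2) by blast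
  then have "(g has_derivative (\<lambda>v. \<Sum>n. f' n p v)) (at p)"
    using R(2) by (simp add: at_within_open[of p "ball 0 R"])
  then show ?thesis
    by (rule has_derivative_transform_within_open[of _ _ _ _ "ball 0 R"])
      (use R g(1) in \<open>auto simp: sums_iff\<close>)
qed

lemma hom_poly_series_summable:
  fixes f :: "nat \<Rightarrow> 'a::real_normed_vector \<Rightarrow> 'b::real_normed_vector"
  assumes "fin_dim TYPE('b)" and f: "\<And>n. hom_poly n (C n) (f n)" and C: "\<And>r. summable (\<lambda>n. C n * r ^ n)"
  shows "summable (\<lambda>n. f n p)"
  by (rule fin_dim_summable[OF assms(1)], rule summable_comparison_test'[OF C[of "norm p"], of 0])
    (simp add: hom_poly_bound[OF f])

lemma hom_poly_series_derivative:
  fixes f :: "nat \<Rightarrow> 'a::real_normed_vector \<Rightarrow> 'b::real_normed_vector"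
  assumes fd: "fin_dim TYPE('b)"
    and f: "\<And>n. hom_poly n (C n) (f n)" and C: "\<And>n. C n \<ge> 0" "\<And>r. summable (\<lambda>n. C n * r ^ n)"
    and f': "\<And>n p. (f n has_derivative f' n p) (at p)"
  shows "((\<lambda>p. \<Sum>n. f n p) has_derivative (\<lambda>v. \<Sum>n. f' n p v)) (at p)"
proof -
  obtain n c and e :: "nat \<Rightarrow> 'b::real_normed_vector" where c: "\<And>i. i < n \<Longrightarrow> bounded_linear (c i)"
    and e: "\<And>x. x = (\<Sum>i<n. c i x *\<^sub>R e i)" using that by (rule fin_dimE[OF fd])
  have sm: "summable (\<lambda>n. f n p)" for p by (rule hom_poly_series_summable[OF fd f C(2)])
  have sm': "summable (\<lambda>n. f' n p v)" for v
  proof (rule fin_dim_summable[OF fd])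
    have "summable (\<lambda>n. diffs C n * norm p ^ n)" by (rule termdiff_converges_all) (rule C(2))
    then have "summable (\<lambda>n. (\<lambda>n. real n * C n * norm p ^ (n - 1)) (Suc n))" by (simp add: diffs_def)
    then have "summable (\<lambda>n. real n * C n * norm p ^ (n - 1))"
      by (rule summable_Suc_iff[THEN iffD1])
    from summable_mult2[OF this, of "norm v"]
    show "summable (\<lambda>n. norm (f' n p v))"
      by (rule summable_comparison_test'[of _ 0]) (use hom_poly_derivative_bound[OF f f'] in simp)
  qed
  show ?thesis
  proof (rule has_derivative_coords[OF e])
    fix i assume i: "i < n"
    interpret ci: bounded_linear "c i" by (rule c[OF i])
    have "((\<lambda>p. \<Sum>n. c i (f n p)) has_derivative (\<lambda>v. \<Sum>n. c i (f' n p v))) (at p)"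
    proof (rule hom_poly_series_derivative_banach)
      show "hom_poly m (onorm (c i) * C m) (\<lambda>p. c i (f m p))" for m
        by (rule hom_poly_linear[OF c[OF i] onorm[OF c[OF i]] onorm_pos_le[OF c[OF i]] f])
      show "0 \<le> onorm (c i) * C m" for m using C(1) onorm_pos_le[OF c[OF i]] by simp
      show "summable (\<lambda>m. onorm (c i) * C m * r ^ m)" for r
        using summable_mult[OF C(2)] by (simp add: mult.assoc)
      show "((\<lambda>p. c i (f m p)) has_derivative (\<lambda>v. c i (f' m p v))) (at p)" for m p
        by (rule ci.has_derivative[OF f'])
    qed
    then show "((\<lambda>p. c i (\<Sum>n. f n p)) has_derivative (\<lambda>v. c i (\<Sum>n. f' n p v))) (at p)"
      using ci.suminf[OF sm] ci.suminf[OF sm'] by simp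
  qed
qed

definition entire_map :: "('a::real_normed_vector \<Rightarrow> 'b::real_normed_vector) \<Rightarrow> bool" where
  "entire_map g \<longleftrightarrow> (\<exists>f C. (\<forall>n. hom_poly n (C n) (f n) \<and> C n \<ge> 0) \<and>
     (\<forall>r::real. summable (\<lambda>n. C n * r ^ n)) \<and> g = (\<lambda>p. \<Sum>n. f n p))"

lemma entire_map_derivative:
  fixes g :: "'a::real_normed_vector \<Rightarrow> 'b::real_normed_vector"
  assumes fd: "fin_dim TYPE('b)" and "entire_map g"
  shows "\<exists>g'. \<forall>p. (g has_derivative g' p) (at p) \<and> (\<forall>v. entire_map (\<lambda>p. g' p v))"
proof -
  obtain f C where f: "\<And>n. hom_poly n (C n) (f n)" and C: "\<And>n. C n \<ge> 0"
    "\<And>r::real. summable (\<lambda>n. C n * r ^ n)" and g: "g = (\<lambda>p. \<Sum>n. f n p)"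
    using assms(2) unfolding entire_map_def by blast
  have "\<exists>f'. \<forall>p. (f (Suc n) has_derivative f' p) (at p) \<and>
       (\<forall>v. hom_poly n (real (Suc n) * C (Suc n) * norm v) (\<lambda>p. f' p v))" for n
    using f[of "Suc n"] by auto
  then obtain f' where f': "\<And>n p. (f (Suc n) has_derivative f' n p) (at p)"
    "\<And>n v. hom_poly n (real (Suc n) * C (Suc n) * norm v) (\<lambda>p. f' n p v)" by metis
  \<comment> \<open>The derivative lowers the degree by one. A zero term at index \<open>0\<close>
    keeps the indexing of \<open>f\<close>; it is dropped again when the derivative is recognised as
    a series of the same kind.\<close>
  define h where "h n = (case n of 0 \<Rightarrow> (\<lambda>p v. 0) | Suc m \<Rightarrow> f' m)" for n
  have h: "(f n has_derivative h n p) (at p)" for n p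
  proof (cases n)
    case 0
    then show ?thesis using f[of 0] by (auto simp: h_def)
  next
    case (Suc m) then show ?thesis using f' by (simp add: h_def)
  qed
  define g' where "g' p v = (\<Sum>n. h n p v)" for p v
  have "(g has_derivative g' p) (at p)" for p
    unfolding g g'_def by (rule hom_poly_series_derivative[OF fd f C h])
  moreover have "entire_map (\<lambda>p. g' p v)" for v
    unfolding entire_map_def
  proof (intro exI conjI allI)
    show "hom_poly n (diffs C n * norm v) (\<lambda>p. f' n p v)" for n
      using f'(2) by (simp add: diffs_def)
    show "0 \<le> diffs C n * norm v" for n using C(1) by (simp add: diffs_def)
    have dC: "summable (\<lambda>n. diffs C n * r ^ n)" for r by (rule termdiff_converges_all) (rule C(2))
    from summable_mult[OF dC, of "norm v"]
    show sr: "summable (\<lambda>n. diffs C n * norm v * r ^ n)" for r by (simp add: ac_simps)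
    show "(\<lambda>p. g' p v) = (\<lambda>p. \<Sum>n. f' n p v)"
    proof
      fix p
      have "(\<lambda>n. f' n p v) sums (\<Sum>n. f' n p v)"
        by (intro summable_sums hom_poly_series_summable[OF fd, where C="\<lambda>n. diffs C n * norm v"] sr)
          (use f'(2) in \<open>simp add: diffs_def\<close>)
      then have "(\<lambda>n. h (Suc n) p v) sums (\<Sum>n. f' n p v)" by (simp add: h_def)
      then have "(\<lambda>n. h n p v) sums ((\<Sum>n. f' n p v) + h 0 p v)" by (rule sums_Suc)
      then show "g' p v = (\<Sum>n. f' n p v)" by (simp add: g'_def sums_iff h_def)
    qed
  qed
  ultimately show ?thesis by blast
qed

lemma entire_map_smooth:
  fixes g :: "'a::real_normed_vector \<Rightarrow> 'b::real_normed_vector"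
  assumes "fin_dim TYPE('b)" "entire_map g"
  shows "smooth_on UNIV g"
  using assms(2) entire_map_derivative[OF assms(1)] by (rule smooth_on_coinduct)

section \<open>Exponential series of operators\<close>

text \<open>The derivative of \<open>A\<^sup>n\<close> along \<open>B\<close>.\<close>

primrec dpow :: "('d::real_vector \<Rightarrow> 'd) \<Rightarrow> ('d \<Rightarrow> 'd) \<Rightarrow> nat \<Rightarrow> 'd \<Rightarrow> 'd" where
  "dpow A B 0 x = 0"
| "dpow A B (Suc n) x = B ((A ^^ n) x) + A (dpow A B n x)"

definition exp_bounded :: "(nat \<Rightarrow> 'd::real_normed_vector) \<Rightarrow> bool" where
  "exp_bounded y \<longleftrightarrow> (\<exists>C R. R \<ge> 0 \<and> (\<forall>n. norm (y n) \<le> C * R ^ n))"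

text \<open>With \<open>y n = (A ^^ n) x\<close> this is the \<open>j\<close>-fold primitive of
  \<open>exp (t A) x\<close> vanishing at \<open>t = 0\<close>, so quotients by powers of
  \<open>A\<close> are available although \<open>A\<close> is not invertible.\<close>

definition eseries :: "nat \<Rightarrow> (nat \<Rightarrow> 'd::real_normed_vector) \<Rightarrow> real \<Rightarrow> 'd" where
  "eseries j y t = (\<Sum>n. (t ^ (n + j) / fact (n + j)) *\<^sub>R y n)"

lemma exp_series_bound_summable:
  fixes R :: real assumes "R \<ge> 0"
  shows "summable (\<lambda>n. \<bar>t ^ (n + j) / fact (n + j)\<bar> * (C * R ^ n))"
proof -
  have "summable (\<lambda>n. C * \<bar>t\<bar> ^ j * ((\<bar>t\<bar> * R) ^ n /\<^sub>R fact n))"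
    by (intro summable_mult summable_exp_generic)
  then have "summable (\<lambda>n. \<bar>C\<bar> * \<bar>t\<bar> ^ j * ((\<bar>t\<bar> * R) ^ n /\<^sub>R fact n))"
    by (intro summable_mult summable_exp_generic)
  then show ?thesis
  proof (rule summable_comparison_test'[of _ 0])
    fix n :: nat
    have "1 / fact (n + j) \<le> (1 / fact n :: real)"
      by (intro divide_left_mono fact_mono) auto
    then have "(1 / fact (n + j)) * (\<bar>t\<bar> ^ (n + j) * (\<bar>C\<bar> * R ^ n)) \<le> (1 / fact n) * (\<bar>t\<bar> ^ (n + j) * (\<bar>C\<bar> * R ^ n))"
      using assms by (intro mult_right_mono) auto
    then show "norm (\<bar>t ^ (n + j) / fact (n + j)\<bar> * (C * R ^ n)) \<le> \<bar>C\<bar> * \<bar>t\<bar> ^ j * ((\<bar>t\<bar> * R) ^ n /\<^sub>R fact n)"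
      using assms by (simp add: abs_mult power_abs power_add power_mult_distrib field_simps)
  qed
qed

lemma eseries_summable:
  fixes y :: "nat \<Rightarrow> 'd::real_normed_vector"
  assumes "fin_dim TYPE('d)" "exp_bounded y"
  shows "summable (\<lambda>n. (t ^ (n + j) / fact (n + j)) *\<^sub>R y n)"
proof -
  obtain C R where R: "R \<ge> 0" "\<And>n. norm (y n) \<le> C * R ^ n" using assms(2) unfolding exp_bounded_def by blast
  show ?thesis
  proof (rule fin_dim_summable[OF assms(1)], rule summable_comparison_test'[OF exp_series_bound_summable[OF R(1)], of 0])
    show "norm (norm ((t ^ (n + j) / fact (n + j)) *\<^sub>R y n)) \<le> \<bar>t ^ (n + j) / fact (n + j)\<bar> * (C * R ^ n)" for n
      using mult_left_mono[OF R(2)[of n], of "\<bar>t ^ (n + j) / fact (n + j)\<bar>"] by simp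
  qed
qed

lemma eseries_linear_image:
  fixes y :: "nat \<Rightarrow> 'd::real_normed_vector"
  assumes "fin_dim TYPE('d)" "exp_bounded y" "bounded_linear T"
  shows "T (eseries j y t) = eseries j (\<lambda>n. T (y n)) t"
proof -
  interpret bounded_linear T by fact
  show ?thesis unfolding eseries_def using suminf[OF eseries_summable[OF assms(1,2)]] by (simp add: scaleR)
qed

lemma eseries_add:
  fixes y z :: "nat \<Rightarrow> 'd::real_normed_vector"
  assumes "fin_dim TYPE('d)" "exp_bounded y" "exp_bounded z"
  shows "eseries j (\<lambda>n. y n + z n) t = eseries j y t + eseries j z t"
  unfolding eseries_def
  using suminf_add[OF eseries_summable[OF assms(1,2)] eseries_summable[OF assms(1,3)]]
  by (simp add: scaleR_add_right)

lemma eseries_zero: "eseries (Suc j) y 0 = 0" "eseries 0 y 0 = y 0"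
proof -
  show "eseries (Suc j) y 0 = 0" by (simp add: eseries_def)
  have "eseries 0 y 0 = (\<Sum>n. if n = 0 then y 0 else 0)" unfolding eseries_def by (intro suminf_cong) auto
  also have "\<dots> = y 0" using suminf_finite[of "{0}" "\<lambda>n. if n = 0 then y 0 else 0"] by simp
  finally show "eseries 0 y 0 = y 0" .
qed

lemma exp_bounded_Suc: assumes "exp_bounded y" shows "exp_bounded (\<lambda>n. y (Suc n))"
proof -
  obtain C R where R: "R \<ge> 0" "\<And>n. norm (y n) \<le> C * R ^ n" using assms unfolding exp_bounded_def by blast
  have "norm (y (Suc n)) \<le> (C * R) * R ^ n" for n using R(2)[of "Suc n"] by (simp add: ac_simps)
  then show ?thesis using R(1) unfolding exp_bounded_def by blast
qed

lemma exp_bounded_linear: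
  assumes "exp_bounded y" "bounded_linear T" shows "exp_bounded (\<lambda>n. T (y n))"
proof -
  obtain C R where R: "R \<ge> 0" "\<And>n. norm (y n) \<le> C * R ^ n" using assms(1) unfolding exp_bounded_def by blast
  have "norm (T (y n)) \<le> (onorm T * C) * R ^ n" for n
    using order_trans[OF onorm[OF assms(2)] mult_left_mono[OF R(2) onorm_pos_le[OF assms(2)]]] by (simp add: ac_simps)
  then show ?thesis using R(1) unfolding exp_bounded_def by blast
qed

lemma norm_power_le:
  fixes A :: "'d::real_normed_vector \<Rightarrow> 'd"
  assumes "bounded_linear A" shows "norm ((A ^^ n) x) \<le> norm x * onorm A ^ n"
proof (induction n)
  case (Suc n)
  have "norm ((A ^^ Suc n) x) \<le> onorm A * norm ((A ^^ n) x)" using onorm[OF assms, of "(A ^^ n) x"] by simp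
  also have "\<dots> \<le> onorm A * (norm x * onorm A ^ n)" by (rule mult_left_mono[OF Suc onorm_pos_le[OF assms]])
  finally show ?case by (simp add: ac_simps)
qed simp

lemma exp_bounded_power:
  fixes A :: "'d::real_normed_vector \<Rightarrow> 'd"
  assumes "bounded_linear A" shows "exp_bounded (\<lambda>n. (A ^^ n) x)"
  unfolding exp_bounded_def using norm_power_le[OF assms] onorm_pos_le[OF assms] by blast

text \<open>The Leibniz sum has \<open>n\<close> terms with one factor \<open>B\<close> each; the
  rate \<open>onorm A + onorm B\<close> absorbs this count.\<close>

lemma exp_bounded_dpow:
  assumes A: "bounded_linear A" and B: "bounded_linear B" shows "exp_bounded (\<lambda>n. dpow A B n x)"
proof -
  define a b where "a = onorm A" and "b = onorm B"
  have ab: "a \<ge> 0" "b \<ge> 0" by (simp_all add: a_def b_def onorm_pos_le A B)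
  have p: "norm ((A ^^ n) x) \<le> norm x * a ^ n" for n unfolding a_def by (rule norm_power_le[OF A])
  have "norm (dpow A B n x) \<le> norm x * (a + b) ^ n" for n
  proof (induction n)
    case (Suc n)
    have "norm (dpow A B (Suc n) x) \<le> norm (B ((A ^^ n) x)) + norm (A (dpow A B n x))"
      by (simp add: norm_triangle_ineq)
    also have "\<dots> \<le> b * norm ((A ^^ n) x) + a * norm (dpow A B n x)"
      using onorm[OF A] onorm[OF B] by (intro add_mono) (simp_all add: a_def b_def)
    also have "\<dots> \<le> b * (norm x * a ^ n) + a * (norm x * (a + b) ^ n)"
      by (intro add_mono mult_left_mono p Suc ab)
    also have "\<dots> \<le> b * (norm x * (a + b) ^ n) + a * (norm x * (a + b) ^ n)"
      using ab by (intro add_right_mono mult_left_mono power_mono) auto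
    finally show ?case by (simp add: algebra_simps)
  qed simp
  then show ?thesis unfolding exp_bounded_def using ab by (metis add_nonneg_nonneg)
qed

text \<open>Padding with \<open>j\<close> zero coefficients makes this an ordinary power series in
  \<open>t\<close>, whose termwise derivative only shifts coefficients.\<close>

lemma eseries_sums_power:
  fixes y :: "nat \<Rightarrow> real"
  assumes "exp_bounded y"
  shows "(\<lambda>m. (if m < j then 0 else y (m - j) / fact m) * t ^ m) sums eseries j y t"
proof -
  have fd: "fin_dim TYPE(real)" unfolding fin_dim_def
    by (intro exI[of _ 1] exI[of _ "\<lambda>_ x. x"] exI[of _ "\<lambda>_. 1"]) simp
  let ?f = "\<lambda>m. (if m < j then 0 else y (m - j) / fact m) * t ^ m"
  have "(\<lambda>n. (t ^ (n + j) / fact (n + j)) *\<^sub>R y n) sums eseries j y t"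
    unfolding eseries_def by (rule summable_sums[OF eseries_summable[OF fd assms]])
  moreover have "(\<lambda>n. (t ^ (n + j) / fact (n + j)) *\<^sub>R y n) = (\<lambda>n. ?f (n + j))" by auto
  ultimately have "(\<lambda>n. ?f (n + j)) sums eseries j y t" by simp
  moreover have "?f i = 0" if "i < j" for i using that by simp
  ultimately show ?thesis by (subst (asm) sums_zero_iff_shift) auto
qed

lemma eseries_has_derivative_real:
  fixes y :: "nat \<Rightarrow> real"
  assumes "exp_bounded y"
  shows "(eseries (Suc j) y has_real_derivative eseries j y t) (at t)"
    "(eseries 0 y has_real_derivative eseries 0 (\<lambda>n. y (Suc n)) t) (at t)"
proof -
  define a where "a j m = (if m < j then 0 else y (m - j) / fact m)" for j m :: nat
  have s: "(\<lambda>m. a j m * t ^ m) sums eseries j y t" for j t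
    unfolding a_def by (rule eseries_sums_power[OF assms])
  have D: "((\<lambda>t. \<Sum>m. a j m * t ^ m) has_real_derivative (\<Sum>m. diffs (a j) m * t ^ m)) (at t)" for j
    by (rule termdiffs_strong_converges_everywhere) (use s sums_summable in blast)
  have e: "(\<lambda>t. \<Sum>m. a j m * t ^ m) = eseries j y" for j using s by (auto simp: sums_iff)
  have "diffs (a (Suc j)) m = a j m" for m by (simp add: diffs_def a_def)
  then show "(eseries (Suc j) y has_real_derivative eseries j y t) (at t)"
    using D[of "Suc j"] unfolding e[of "Suc j"] by (simp add: fun_cong[OF e[of j]])
  have "diffs (a 0) m * t ^ m = (if m < 0 then 0 else y (Suc (m - 0)) / fact m) * t ^ m" for m
    by (simp add: diffs_def a_def)
  then have "(\<Sum>m. diffs (a 0) m * t ^ m) = eseries 0 (\<lambda>n. y (Suc n)) t"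
    using eseries_sums_power[OF exp_bounded_Suc[OF assms], of 0 t] by (simp add: sums_iff)
  then show "(eseries 0 y has_real_derivative eseries 0 (\<lambda>n. y (Suc n)) t) (at t)"
    using D[of 0] unfolding e[of 0] by simp
qed

lemma has_vector_derivative_coords:
  fixes f :: "real \<Rightarrow> 'd::real_normed_vector"
  assumes fd: "fin_dim TYPE('d)"
    and D: "\<And>c. bounded_linear c \<Longrightarrow> ((\<lambda>t. c (f t)) has_real_derivative c d) (at t)"
  shows "(f has_vector_derivative d) (at t)"
proof -
  obtain n c and e :: "nat \<Rightarrow> 'd::real_normed_vector" where c: "\<And>i. i < n \<Longrightarrow> bounded_linear (c i)"
    and e: "\<And>x. x = (\<Sum>i<n. c i x *\<^sub>R e i)" using that by (rule fin_dimE[OF fd])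
  show ?thesis unfolding has_vector_derivative_def
  proof (rule has_derivative_coords[OF e])
    fix i assume i: "i < n"
    interpret ci: bounded_linear "c i" by (rule c[OF i])
    show "((\<lambda>x. c i (f x)) has_derivative (\<lambda>v. c i (v *\<^sub>R d))) (at t)"
      using D[OF c[OF i]] unfolding has_field_derivative_def
      by (rule has_derivative_eq_rhs) (auto simp: ci.scaleR)
  qed
qed

lemma eseries_has_derivative:
  fixes y :: "nat \<Rightarrow> 'd::real_normed_vector"
  assumes fd: "fin_dim TYPE('d)" and y: "exp_bounded y"
  shows "(eseries (Suc j) y has_vector_derivative eseries j y t) (at t)"
    "(eseries 0 y has_vector_derivative eseries 0 (\<lambda>n. y (Suc n)) t) (at t)"
proof -
  have eq: "(\<lambda>t. c (eseries j y t)) = eseries j (\<lambda>n. c (y n))" if "bounded_linear c" for j and c :: "'d \<Rightarrow> real"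
    using eseries_linear_image[OF fd y that] by auto
  show "(eseries (Suc j) y has_vector_derivative eseries j y t) (at t)"
  proof (rule has_vector_derivative_coords[OF fd])
    fix c :: "'d \<Rightarrow> real" assume c: "bounded_linear c"
    show "((\<lambda>t. c (eseries (Suc j) y t)) has_real_derivative c (eseries j y t)) (at t)"
      unfolding eq[OF c] eseries_linear_image[OF fd y c]
      by (rule eseries_has_derivative_real[OF exp_bounded_linear[OF y c]])
  qed
  show "(eseries 0 y has_vector_derivative eseries 0 (\<lambda>n. y (Suc n)) t) (at t)"
  proof (rule has_vector_derivative_coords[OF fd])
    fix c :: "'d \<Rightarrow> real" assume c: "bounded_linear c"
    show "((\<lambda>t. c (eseries 0 y t)) has_real_derivative c (eseries 0 (\<lambda>n. y (Suc n)) t)) (at t)"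
      unfolding eq[OF c] eseries_linear_image[OF fd exp_bounded_Suc[OF y] c]
      by (rule eseries_has_derivative_real[OF exp_bounded_linear[OF y c]])
  qed
qed

lemma power_has_derivative:
  assumes b: "bounded_bilinear b"
  shows "((\<lambda>p. (b p ^^ n) x) has_derivative (\<lambda>v. dpow (b p) (b v) n x)) (at p)"
proof (induction n)
  case (Suc n)
  show ?case using bounded_bilinear.FDERIV[OF b has_derivative_ident Suc] by (simp add: add.commute)
qed simp

lemma hom_poly_power:
  fixes b :: "'a::real_normed_vector \<Rightarrow> 'd::real_normed_vector \<Rightarrow> 'd"
  assumes b: "bounded_bilinear b" and K: "\<And>q x. norm (b q x) \<le> K * norm q * norm x" "K \<ge> 0"
  shows "hom_poly n (K ^ n * norm x) (\<lambda>p. (b p ^^ n) x)"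
proof (induction n)
  case (Suc n)
  show ?case using hom_poly_bilinear[OF b K Suc] by (simp add: ac_simps)
qed auto

text \<open>The term \<open>(b p ^^ n) x\<close> is homogeneous of degree \<open>n\<close> in
  \<open>p\<close> with constant \<open>K ^ n * norm x\<close>, and the factorials make these
  constants summable against every \<open>r ^ n\<close>. Hence the parameter derivative is taken
  termwise, and to all orders.\<close>

lemma
  fixes b :: "'a::real_normed_vector \<Rightarrow> 'd::real_normed_vector \<Rightarrow> 'd"
  assumes fd: "fin_dim TYPE('d)" and b: "bounded_bilinear b"
  shows eseries_operator_has_derivative: "((\<lambda>p. eseries j (\<lambda>n. (b p ^^ n) x) t) has_derivative
      (\<lambda>v. eseries j (\<lambda>n. dpow (b p) (b v) n x) t)) (at p)"
    and eseries_operator_smooth: "smooth_on UNIV (\<lambda>p. eseries j (\<lambda>n. (b p ^^ n) x) t)"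
proof -
  obtain K where K: "K \<ge> 0" "\<And>q x. norm (b q x) \<le> norm q * norm x * K"
    using bounded_bilinear.nonneg_bounded[OF b] by blast
  have K': "norm (b q x) \<le> K * norm q * norm x" for q x using K(2)[of q x] by (simp add: ac_simps)
  define F where "F n = (t ^ (n + j) / fact (n + j) :: real)" for n
  define C where "C n = \<bar>F n\<bar> * (K ^ n * norm x)" for n
  have hp: "hom_poly n (C n) (\<lambda>p. F n *\<^sub>R (b p ^^ n) x)" for n
    unfolding C_def by (rule hom_poly_linear[OF bounded_linear_scaleR_right _ _ hom_poly_power[OF b K' K(1)]]) auto
  have C: "C n \<ge> 0" for n using K(1) by (simp add: C_def)
  have s: "summable (\<lambda>n. C n * r ^ n)" for r
  proof (rule summable_comparison_test'[OF exp_series_bound_summable[of "K * \<bar>r\<bar>" t j "norm x"], of 0])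
    show "0 \<le> K * \<bar>r\<bar>" using K by simp
    show "norm (C n * r ^ n) \<le> \<bar>t ^ (n + j) / fact (n + j)\<bar> * (norm x * (K * \<bar>r\<bar>) ^ n)" for n
      using K(1) by (simp add: C_def F_def abs_mult power_abs power_mult_distrib ac_simps)
  qed
  have d: "((\<lambda>p. F n *\<^sub>R (b p ^^ n) x) has_derivative (\<lambda>v. F n *\<^sub>R dpow (b p) (b v) n x)) (at p)" for n p
    by (intro has_derivative_scaleR_right power_has_derivative b)
  show "((\<lambda>p. eseries j (\<lambda>n. (b p ^^ n) x) t) has_derivative
      (\<lambda>v. eseries j (\<lambda>n. dpow (b p) (b v) n x) t)) (at p)"
    using hom_poly_series_derivative[OF fd hp C s d] unfolding eseries_def F_def .
  have "entire_map (\<lambda>p. eseries j (\<lambda>n. (b p ^^ n) x) t)"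
    unfolding entire_map_def using hp C s
    by (intro exI[of _ "\<lambda>n p. F n *\<^sub>R (b p ^^ n) x"] exI[of _ C]) (auto simp: eseries_def F_def)
  then show "smooth_on UNIV (\<lambda>p. eseries j (\<lambda>n. (b p ^^ n) x) t)" by (rule entire_map_smooth[OF fd])
qed

section \<open>The exponential of the adjoint representation and its derivatives\<close>

text \<open>Real bilinearity is the right level: derivatives in \<open>p\<close> and in
  \<open>t\<close> are taken over \<real>, also for complex scalars.\<close>

locale normed_lie =
  fixes br :: "'d::real_normed_vector \<Rightarrow> 'd \<Rightarrow> 'd"
  assumes fin: "fin_dim TYPE('d)"
    and bil: "bounded_bilinear br"
    and alt: "br x x = 0"
    and jacobi: "br x (br y z) + br y (br z x) + br z (br x y) = 0"
begin

sublocale br: bounded_bilinear br by (rule bil)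

lemma skew: "br x y = - br y x"
proof -
  have "br x y + br y x = 0"
    using alt[of "x + y"] alt[of x] alt[of y] unfolding br.add_left br.add_right by (simp add: add.commute)
  then show ?thesis by (simp add: eq_neg_iff_add_eq_0)
qed

lemma ad_derivation: "br x (br y z) = br (br x y) z + br y (br x z)"
proof -
  have "br y (br z x) = - br y (br x z)" "br z (br x y) = - br (br x y) z"
    using skew[of z x] skew[of z "br x y"] by (simp_all add: br.minus_right)
  then have "br x (br y z) - br y (br x z) - br (br x y) z = 0" using jacobi[of x y z] by simp
  then show ?thesis by (simp add: algebra_simps)
qed

text \<open>
  With \<open>A = ad P\<close>, the operators \<open>E\<close>, \<open>W\<close>, \<open>T\<close> are \<open>exp (t A)\<close>, \<open>(exp (t A) - 1) / A\<close> and
  \<open>(exp (t A) - 1 - t A) / A\<^sup>2\<close>; \<open>DE\<close>, \<open>DW\<close>, \<open>DT\<close> are their derivatives in \<open>P\<close> along \<open>g\<close>.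
  Since \<open>A\<close> need not be invertible, identities between them are proved by differentiating in \<open>t\<close>.
\<close>

definition E :: "'d \<Rightarrow> real \<Rightarrow> 'd \<Rightarrow> 'd" where "E P t x = eseries 0 (\<lambda>n. (br P ^^ n) x) t"
definition W :: "'d \<Rightarrow> real \<Rightarrow> 'd \<Rightarrow> 'd" where "W P t x = eseries 1 (\<lambda>n. (br P ^^ n) x) t"
definition T :: "'d \<Rightarrow> real \<Rightarrow> 'd \<Rightarrow> 'd" where "T P t x = eseries 2 (\<lambda>n. (br P ^^ n) x) t"
definition DE :: "'d \<Rightarrow> 'd \<Rightarrow> real \<Rightarrow> 'd \<Rightarrow> 'd" where "DE P g t x = eseries 0 (\<lambda>n. dpow (br P) (br g) n x) t"
definition DW :: "'d \<Rightarrow> 'd \<Rightarrow> real \<Rightarrow> 'd \<Rightarrow> 'd" where "DW P g t x = eseries 1 (\<lambda>n. dpow (br P) (br g) n x) t"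
definition DT :: "'d \<Rightarrow> 'd \<Rightarrow> real \<Rightarrow> 'd \<Rightarrow> 'd" where "DT P g t x = eseries 2 (\<lambda>n. dpow (br P) (br g) n x) t"

lemma pw: "exp_bounded (\<lambda>n. (br P ^^ n) x)"
  by (rule exp_bounded_power[OF br.bounded_linear_right])

lemma dpw: "exp_bounded (\<lambda>n. dpow (br P) (br g) n x)"
  by (rule exp_bounded_dpow[OF br.bounded_linear_right br.bounded_linear_right])

lemma eseries_br: "exp_bounded y \<Longrightarrow> br P (eseries j y t) = eseries j (\<lambda>n. br P (y n)) t"
  by (rule eseries_linear_image[OF fin _ br.bounded_linear_right])

lemma E_vd: "((\<lambda>t. E P t x) has_vector_derivative br P (E P t x)) (at t)"
  unfolding E_def eseries_br[OF pw] using eseries_has_derivative(2)[OF fin pw[of P x], of t] by simp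

lemma W_vd: "((\<lambda>t. W P t x) has_vector_derivative E P t x) (at t)"
  unfolding E_def W_def using eseries_has_derivative(1)[OF fin pw[of P x], of 0 t] by simp

lemma T_vd: "((\<lambda>t. T P t x) has_vector_derivative W P t x) (at t)"
  unfolding T_def W_def using eseries_has_derivative(1)[OF fin pw[of P x], of 1 t] by (simp add: numeral_2_eq_2)

lemma DE_vd: "((\<lambda>t. DE P g t x) has_vector_derivative br P (DE P g t x) + br g (E P t x)) (at t)"
proof -
  have "br P (DE P g t x) + br g (E P t x) = eseries 0 (\<lambda>n. br P (dpow (br P) (br g) n x) + br g ((br P ^^ n) x)) t"
    unfolding DE_def E_def eseries_br[OF pw] eseries_br[OF dpw]
    by (rule eseries_add[symmetric, OF fin exp_bounded_linear[OF dpw br.bounded_linear_right]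
          exp_bounded_linear[OF pw br.bounded_linear_right]])
  also have "\<dots> = eseries 0 (\<lambda>n. dpow (br P) (br g) (Suc n) x) t" by (simp add: add.commute)
  finally show ?thesis unfolding DE_def using eseries_has_derivative(2)[OF fin dpw[of P g x], of t] by simp
qed

lemma DW_vd: "((\<lambda>t. DW P g t x) has_vector_derivative DE P g t x) (at t)"
  unfolding DE_def DW_def using eseries_has_derivative(1)[OF fin dpw[of P g x], of 0 t] by simp

lemma DT_vd: "((\<lambda>t. DT P g t x) has_vector_derivative DW P g t x) (at t)"
  unfolding DT_def DW_def using eseries_has_derivative(1)[OF fin dpw[of P g x], of 1 t] by (simp add: numeral_2_eq_2)

lemma at_0 [simp]: "E P 0 x = x" "W P 0 x = 0" "T P 0 x = 0" "DE P g 0 x = 0" "DW P g 0 x = 0" "DT P g 0 x = 0"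
  by (simp_all add: E_def W_def T_def DE_def DW_def DT_def eseries_zero numeral_2_eq_2)

lemmas vd = E_vd W_vd T_vd DE_vd DW_vd DT_vd


text \<open>The constant rule comes last, so that it only catches what no other rule can treat.\<close>

lemmas vd_rules = vd has_vector_derivative_add has_vector_derivative_diff has_vector_derivative_minus
  br.has_vector_derivative bounded_linear.has_vector_derivative[OF bounded_linear_scaleR_right]
  has_vector_derivative_const

lemma ode_unique:
  assumes "\<And>t. (y has_vector_derivative br P (y t) + r t) (at t)"
    "\<And>t. (z has_vector_derivative br P (z t) + r t) (at t)" "y 0 = z 0"
  shows "y t = z t"
proof -
  have "((\<lambda>t. y t - z t) has_vector_derivative br P (y t - z t)) (at t)" for t
    using has_vector_derivative_diff[OF assms(1,2), of t] by (simp add: br.diff_right)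
  then have "y t - z t = 0"
    using linear_ode_unique[OF br.bounded_linear_right, of "\<lambda>t. y t - z t" P t] assms(3) by simp
  then show ?thesis by simp
qed

lemma E_unique:
  assumes "\<And>t. (y has_vector_derivative br P (y t)) (at t)" "y 0 = x"
  shows "y t = E P t x"
  using ode_unique[of y P "\<lambda>_. 0" "\<lambda>t. E P t x" t] assms E_vd by simp

lemma DE_unique:
  assumes "\<And>t. (y has_vector_derivative br P (y t) + br g (E P t x)) (at t)" "y 0 = 0"
  shows "y t = DE P g t x"
  using ode_unique[of y P "\<lambda>t. br g (E P t x)" "\<lambda>t. DE P g t x" t] assms DE_vd by simp

lemma W_unique:
  assumes "\<And>t. (y has_vector_derivative E P t x) (at t)" "y 0 = 0" shows "y t = W P t x"
  using vector_derivative_eq_imp_eq[OF assms(1) W_vd] assms(2) by simp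

lemma T_unique:
  assumes "\<And>t. (y has_vector_derivative W P t x) (at t)" "y 0 = 0" shows "y t = T P t x"
  using vector_derivative_eq_imp_eq[OF assms(1) T_vd] assms(2) by simp

lemma DW_unique:
  assumes "\<And>t. (y has_vector_derivative DE P g t x) (at t)" "y 0 = 0" shows "y t = DW P g t x"
  using vector_derivative_eq_imp_eq[OF assms(1) DW_vd] assms(2) by simp

lemma DT_unique:
  assumes "\<And>t. (y has_vector_derivative DW P g t x) (at t)" "y 0 = 0" shows "y t = DT P g t x"
  using vector_derivative_eq_imp_eq[OF assms(1) DT_vd] assms(2) by simp

lemma E_add: "E P t x + E P t y = E P t (x + y)"
  by (rule E_unique[of "\<lambda>t. E P t x + E P t y"])
    (rule has_vector_derivative_eq_rhs, (rule vd_rules)+, simp_all add: br.add_right)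

lemma E_scale: "r *\<^sub>R E P t x = E P t (r *\<^sub>R x)"
  by (rule E_unique[of "\<lambda>t. r *\<^sub>R E P t x"])
    (rule has_vector_derivative_eq_rhs, (rule vd_rules)+, simp_all add: br.scaleR_right)

lemma W_add: "W P t x + W P t y = W P t (x + y)"
  by (rule W_unique[of "\<lambda>t. W P t x + W P t y"])
    (rule has_vector_derivative_eq_rhs, (rule vd_rules)+, simp_all add: E_add)

lemma W_scale: "r *\<^sub>R W P t x = W P t (r *\<^sub>R x)"
  by (rule W_unique[of "\<lambda>t. r *\<^sub>R W P t x"])
    (rule has_vector_derivative_eq_rhs, (rule vd_rules)+, simp_all add: E_scale)

lemma T_add: "T P t x + T P t y = T P t (x + y)"
  by (rule T_unique[of "\<lambda>t. T P t x + T P t y"])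
    (rule has_vector_derivative_eq_rhs, (rule vd_rules)+, simp_all add: W_add)

lemma T_scale: "r *\<^sub>R T P t x = T P t (r *\<^sub>R x)"
  by (rule T_unique[of "\<lambda>t. r *\<^sub>R T P t x"])
    (rule has_vector_derivative_eq_rhs, (rule vd_rules)+, simp_all add: W_scale)

lemma linear_E: "linear (E P t)" and linear_W: "linear (W P t)" and linear_T: "linear (T P t)"
  by (auto intro!: linearI simp: E_add E_scale W_add W_scale T_add T_scale)

lemmas E_minus = linear_neg[OF linear_E] and W_minus = linear_neg[OF linear_W] and T_minus = linear_neg[OF linear_T]
lemmas E_diff = linear_diff[OF linear_E]

lemma vd_shift:
  assumes "\<And>t. (f has_vector_derivative f' t) (at t)"
  shows "((\<lambda>t. f (t + s)) has_vector_derivative f' (t + s)) (at (t::real))"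
proof -
  have "((\<lambda>t. t + s) has_vector_derivative 1) (at t)"
    by (rule has_vector_derivative_eq_rhs, rule has_vector_derivative_add, rule has_vector_derivative_id,
        rule has_vector_derivative_const) simp
  from vector_diff_chain_at[OF this assms] show ?thesis by (simp add: o_def)
qed

lemma vd_neg:
  assumes "\<And>t. (f has_vector_derivative f' t) (at t)"
  shows "((\<lambda>t. f (- t)) has_vector_derivative - f' (- t)) (at (t::real))"
proof -
  have "(uminus has_vector_derivative (-1 :: real)) (at t)"
    using has_vector_derivative_minus[OF has_vector_derivative_id] by simp
  from vector_diff_chain_at[OF this assms] show ?thesis by (simp add: o_def)
qed

lemmas vd_neg_rules = vd[THEN vd_neg]

lemma E_comm: "br P (E P t x) = E P t (br P x)"
  by (rule E_unique[of "\<lambda>t. br P (E P t x)"])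
    (rule has_vector_derivative_eq_rhs, (rule vd_rules)+, simp_all add: br.zero_left)

lemma E_E: "E P t (E P s x) = E P (t + s) x"
  by (rule E_unique[symmetric, of "\<lambda>t. E P (t + s) x"]) (rule vd_shift, rule vd, simp)

lemma E_inverse: "E P t (E P (- t) x) = x" "E P (- t) (E P t x) = x"
  by (simp_all add: E_E)

lemma E_br: "br (E P t x) (E P t y) = E P t (br x y)"
  by (rule E_unique[of "\<lambda>t. br (E P t x) (E P t y)"])
    (rule has_vector_derivative_eq_rhs, (rule vd_rules)+, simp_all add: ad_derivation[of P] add.commute)

lemma ad_W: "br P (W P t x) = E P t x - x"
  by (rule vector_derivative_eq_imp_eq[of "\<lambda>t. br P (W P t x)" "\<lambda>t. br P (E P t x)"])
    (rule has_vector_derivative_eq_rhs, (rule vd_rules)+, simp add: br.zero_left,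
     rule has_vector_derivative_eq_rhs, (rule vd_rules)+, simp_all add: br.zero_right)

lemma W_ad: "W P t (br P x) = E P t x - x"
  by (rule W_unique[symmetric, of "\<lambda>t. E P t x - x"])
    (rule has_vector_derivative_eq_rhs, (rule vd_rules)+, simp_all add: E_comm)

lemma ad_T: "br P (T P t x) = W P t x - t *\<^sub>R x"
proof (rule vector_derivative_eq_imp_eq[of "\<lambda>t. br P (T P t x)" "\<lambda>t. br P (W P t x)"])
  show "((\<lambda>t. br P (T P t x)) has_vector_derivative br P (W P t x)) (at t)" for t
    by (rule has_vector_derivative_eq_rhs, (rule vd_rules)+, simp add: br.zero_left)
  show "((\<lambda>t. W P t x - t *\<^sub>R x) has_vector_derivative br P (W P t x)) (at t)" for t
    unfolding ad_W
    by (intro has_vector_derivative_diff vd bounded_linear.has_vector_derivative[OF bounded_linear_scaleR_left, of _ 1, simplified]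
        has_vector_derivative_id)
qed (simp add: br.zero_right)

lemma T_ad: "T P t (br P x) = W P t x - t *\<^sub>R x"
proof (rule T_unique[symmetric, of "\<lambda>t. W P t x - t *\<^sub>R x"])
  show "((\<lambda>t. W P t x - t *\<^sub>R x) has_vector_derivative W P t (br P x)) (at t)" for t
    unfolding W_ad
    by (intro has_vector_derivative_diff vd bounded_linear.has_vector_derivative[OF bounded_linear_scaleR_left, of _ 1, simplified]
        has_vector_derivative_id)
qed simp

text \<open>The cocycle rule of \<open>(exp (t A) - 1) / A\<close>. At \<open>s = - t\<close> it
  yields \<open>E_neg_W\<close>, which compares the right and left Maurer-Cartan forms.\<close>

lemma W_shift: "E P s (W P t x) + W P s x = W P (s + t) x"
proof (rule vector_derivative_eq_imp_eq[of "\<lambda>s. E P s (W P t x) + W P s x" "\<lambda>s. E P (s + t) x"])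
  show "((\<lambda>s. E P s (W P t x) + W P s x) has_vector_derivative E P (s + t) x) (at s)" for s
    by (rule has_vector_derivative_eq_rhs, (rule vd_rules)+)
      (simp add: E_E[symmetric] E_comm ad_W E_diff)
  show "((\<lambda>s. W P (s + t) x) has_vector_derivative E P (s + t) x) (at s)" for s
    by (rule vd_shift, rule vd)
qed simp

lemma E_neg_W: "E P (- t) (W P t x) = - W P (- t) x"
  using W_shift[of P "- t" t x] by (simp add: eq_neg_iff_add_eq_0)

section \<open>Derivatives with respect to the generator\<close>

text \<open>Duhamel's formula: \<open>W P t g\<close> is the right logarithmic derivative of the
  exponential along \<open>g\<close>. Both sides solve \<open>y' = [P, y] + [g, E P t x]\<close>
  with \<open>y 0 = 0\<close>; the Jacobi identity and \<open>ad_W\<close> produce the inhomogeneous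
  term.\<close>

lemma DE_eq: "br (W P t g) (E P t x) = DE P g t x"
proof (rule DE_unique[of "\<lambda>t. br (W P t g) (E P t x)"])
  show "((\<lambda>t. br (W P t g) (E P t x)) has_vector_derivative
      br P (br (W P t g) (E P t x)) + br g (E P t x)) (at t)" for t
    by (rule has_vector_derivative_eq_rhs, (rule vd_rules)+)
      (simp add: ad_derivation[of P] ad_W br.diff_left)
qed (simp add: br.zero_left)

lemma DE_add: "DE P g t x + DE P g t y = DE P g t (x + y)"
  by (simp add: DE_eq[symmetric] E_add[symmetric] br.add_right)

lemma DE_scale: "r *\<^sub>R DE P g t x = DE P g t (r *\<^sub>R x)"
  by (simp add: DE_eq[symmetric] E_scale[symmetric] br.scaleR_right)

lemma DW_add: "DW P g t x + DW P g t y = DW P g t (x + y)"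
  by (rule DW_unique[of "\<lambda>t. DW P g t x + DW P g t y"])
    (rule has_vector_derivative_eq_rhs, (rule vd_rules)+, simp_all add: DE_add)

lemma DW_scale: "r *\<^sub>R DW P g t x = DW P g t (r *\<^sub>R x)"
  by (rule DW_unique[of "\<lambda>t. r *\<^sub>R DW P g t x"])
    (rule has_vector_derivative_eq_rhs, (rule vd_rules)+, simp_all add: DE_scale)

lemma DT_add: "DT P g t x + DT P g t y = DT P g t (x + y)"
  by (rule DT_unique[of "\<lambda>t. DT P g t x + DT P g t y"])
    (rule has_vector_derivative_eq_rhs, (rule vd_rules)+, simp_all add: DW_add)

lemma DT_scale: "r *\<^sub>R DT P g t x = DT P g t (r *\<^sub>R x)"
  by (rule DT_unique[of "\<lambda>t. r *\<^sub>R DT P g t x"])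
    (rule has_vector_derivative_eq_rhs, (rule vd_rules)+, simp_all add: DW_scale)

lemma linear_DE: "linear (DE P g t)" and linear_DW: "linear (DW P g t)" and linear_DT: "linear (DT P g t)"
  by (auto intro!: linearI simp: DE_add DE_scale DW_add DW_scale DT_add DT_scale)

text \<open>The \<open>t\<close>-derivative of the bracket is
  \<open>[E u, W v] + [W u, E v]\<close>, which by \<open>DE_eq\<close> is that of the left side;
  both sides vanish at \<open>t = 0\<close>.\<close>

lemma maurer_cartan: "DW P u t v - DW P v t u = br (W P t u) (W P t v)"
proof (rule vector_derivative_eq_imp_eq[of "\<lambda>t. DW P u t v - DW P v t u" "\<lambda>t. DE P u t v - DE P v t u"])
  show "((\<lambda>t. DW P u t v - DW P v t u) has_vector_derivative DE P u t v - DE P v t u) (at t)" for t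
    by (rule vd_rules)+
  show "((\<lambda>t. br (W P t u) (W P t v)) has_vector_derivative DE P u t v - DE P v t u) (at t)" for t
    by (rule has_vector_derivative_eq_rhs, (rule vd_rules)+)
      (simp add: DE_eq[symmetric] skew[of "E P t u"])
qed (simp add: br.zero_left)

text \<open>The product rule along \<open>g\<close> for \<open>A W = exp (t A) - 1\<close>. The
  lemmas down to \<open>DT_ad\<close> treat likewise the other relations between \<open>A\<close>,
  \<open>E\<close>, \<open>W\<close> and \<open>T\<close>, with \<open>A\<close> on either
  side.\<close>

lemma ad_DW: "br P (DW P g t x) + br g (W P t x) = DE P g t x"
proof (rule vector_derivative_eq_imp_eq[of _ "\<lambda>t. br P (DE P g t x) + br g (E P t x)"])
  show "((\<lambda>t. br P (DW P g t x) + br g (W P t x)) has_vector_derivative br P (DE P g t x) + br g (E P t x)) (at t)" for t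
    by (rule has_vector_derivative_eq_rhs, (rule vd_rules)+) (simp add: br.zero_left)
qed (rule vd, simp add: br.zero_right)

lemma ad_DT: "br P (DT P g t x) + br g (T P t x) = DW P g t x"
proof (rule vector_derivative_eq_imp_eq[of _ "\<lambda>t. DE P g t x"])
  show "((\<lambda>t. br P (DT P g t x) + br g (T P t x)) has_vector_derivative DE P g t x) (at t)" for t
    by (rule has_vector_derivative_eq_rhs, (rule vd_rules)+) (simp add: br.zero_left ad_DW)
qed (rule vd, simp add: br.zero_right)

lemma DE_ad: "DE P g t (br P x) + E P t (br g x) = br P (DE P g t x) + br g (E P t x)"
proof -
  have "DE P g t (br P x) = br (W P t g) (br P (E P t x))" by (simp add: DE_eq[symmetric] E_comm)
  moreover have "br P (DE P g t x) = br (E P t g) (E P t x) - br g (E P t x) + br (W P t g) (br P (E P t x))"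
    by (simp add: DE_eq[symmetric] ad_derivation[of P] ad_W br.diff_left)
  ultimately show ?thesis by (simp add: E_br)
qed

lemma DW_ad: "DW P g t (br P x) + W P t (br g x) = DE P g t x"
proof (rule vector_derivative_eq_imp_eq[of _ "\<lambda>t. br P (DE P g t x) + br g (E P t x)"])
  show "((\<lambda>t. DW P g t (br P x) + W P t (br g x)) has_vector_derivative br P (DE P g t x) + br g (E P t x)) (at t)" for t
    unfolding DE_ad[symmetric] by (rule vd_rules)+
qed (rule vd, simp add: br.zero_right)

lemma DT_ad: "DT P g t (br P x) + T P t (br g x) = DW P g t x"
proof (rule vector_derivative_eq_imp_eq[of _ "\<lambda>t. DE P g t x"])
  show "((\<lambda>t. DT P g t (br P x) + T P t (br g x)) has_vector_derivative DE P g t x) (at t)" for t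
    unfolding DW_ad[symmetric] by (rule vd_rules)+
qed (rule vd, simp)

text \<open>Infinitesimal naturality: \<open>ad w\<close> generates automorphisms of the Lie
  algebra, and moving \<open>P\<close> by them, with velocity \<open>br w P\<close>, conjugates
  every series in \<open>ad P\<close>.\<close>

lemma DE_equivariant: "br w (E P t x) - E P t (br w x) = DE P (br w P) t x"
proof (rule DE_unique[of "\<lambda>t. br w (E P t x) - E P t (br w x)"])
  show "((\<lambda>t. br w (E P t x) - E P t (br w x)) has_vector_derivative
      br P (br w (E P t x) - E P t (br w x)) + br (br w P) (E P t x)) (at t)" for t
    by (rule has_vector_derivative_eq_rhs, (rule vd_rules)+)
      (simp add: br.diff_right br.zero_left ad_derivation[of w P])
qed simp

lemma DW_equivariant: "br w (W P t x) - W P t (br w x) = DW P (br w P) t x"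
proof (rule DW_unique[of "\<lambda>t. br w (W P t x) - W P t (br w x)"])
  show "((\<lambda>t. br w (W P t x) - W P t (br w x)) has_vector_derivative DE P (br w P) t x) (at t)" for t
    by (rule has_vector_derivative_eq_rhs, (rule vd_rules)+) (simp add: DE_equivariant[symmetric] br.zero_left)
qed (simp add: br.zero_right)

lemma DT_equivariant: "br w (T P t x) - T P t (br w x) = DT P (br w P) t x"
proof (rule DT_unique[of "\<lambda>t. br w (T P t x) - T P t (br w x)"])
  show "((\<lambda>t. br w (T P t x) - T P t (br w x)) has_vector_derivative DW P (br w P) t x) (at t)" for t
    by (rule has_vector_derivative_eq_rhs, (rule vd_rules)+) (simp add: DW_equivariant[symmetric] br.zero_left)
qed (simp add: br.zero_right)

end

locale normed_quadratic_lie = normed_lie br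
  for br :: "'d::real_normed_vector \<Rightarrow> 'd \<Rightarrow> 'd" +
  fixes B :: "'d \<Rightarrow> 'd \<Rightarrow> 'k::real_normed_vector"
  assumes B_bil: "bounded_bilinear B"
    and B_sym: "B x y = B y x"
    and B_inv: "B (br x y) z = B x (br y z)"
begin

sublocale B: bounded_bilinear B by (rule B_bil)

lemma ad_skew: "B (br P x) y = - B x (br P y)"
  using B_inv[of x P y] skew[of P x] by (simp add: B.minus_left)

lemmas B_rules = vd_rules(1-9) vd_neg_rules B.has_vector_derivative vd_rules(10-)

lemma E_isometry: "B (E P t x) (E P t y) = B x y"
  by (rule vector_derivative_eq_imp_eq[of "\<lambda>t. B (E P t x) (E P t y)" "\<lambda>t. 0"])
    (rule has_vector_derivative_eq_rhs, (rule B_rules)+, simp_all add: ad_skew)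

lemma E_transpose: "B (E P (- t) x) y = B x (E P t y)"
  using E_isometry[of P t "E P (- t) x" y] by (simp add: E_inverse)

lemma W_transpose: "B (W P (- t) x) y = - B x (W P t y)"
proof (rule vector_derivative_eq_imp_eq[of _ "\<lambda>t. - B x (E P t y)"])
  show "((\<lambda>t. B (W P (- t) x) y) has_vector_derivative - B x (E P t y)) (at t)" for t
    by (rule has_vector_derivative_eq_rhs, (rule B_rules)+)
      (simp add: B.minus_left E_transpose B.zero_right)
  show "((\<lambda>t. - B x (W P t y)) has_vector_derivative - B x (E P t y)) (at t)" for t
    by (rule has_vector_derivative_eq_rhs, (rule B_rules)+) (simp add: B.zero_left)
qed (simp add: B.zero_left B.zero_right)

lemma DE_transpose: "B (DE P g (- t) x) y = B x (DE P g t y)"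
proof -
  have "B x (DE P g t y) = B (DE P g t y) x" by (rule B_sym)
  also have "\<dots> = - B (E P t y) (br (W P t g) x)" by (simp add: DE_eq[symmetric] ad_skew)
  also have "\<dots> = - B (E P (- t) (E P t y)) (E P (- t) (br (W P t g) x))" by (simp only: E_isometry)
  also have "\<dots> = B y (br (W P (- t) g) (E P (- t) x))"
    by (simp add: E_inverse E_br[symmetric] E_neg_W br.minus_left B.minus_right)
  finally show ?thesis by (simp add: DE_eq B_sym)
qed

lemma DW_transpose: "B (DW P g (- t) x) y = - B x (DW P g t y)"
proof (rule vector_derivative_eq_imp_eq[of _ "\<lambda>t. - B x (DE P g t y)"])
  show "((\<lambda>t. B (DW P g (- t) x) y) has_vector_derivative - B x (DE P g t y)) (at t)" for t
    by (rule has_vector_derivative_eq_rhs, (rule B_rules)+)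
      (simp add: B.minus_left DE_transpose B.zero_right)
  show "((\<lambda>t. - B x (DW P g t y)) has_vector_derivative - B x (DE P g t y)) (at t)" for t
    by (rule has_vector_derivative_eq_rhs, (rule B_rules)+) (simp add: B.zero_left)
qed (simp add: B.zero_left B.zero_right)

text \<open>Conceptually, differentiating \<open>W P t = - E P t (W P (- t))\<close> along
  \<open>v\<close> gives \<open>DW P v t g - [W v, W g] = - E P t (DW P v (- t) g)\<close>; the
  isometry \<open>E\<close> and \<open>DW_transpose\<close> then give the right side, and
  \<open>maurer_cartan\<close> exchanges the directions \<open>g\<close> and \<open>v\<close>. The
  proof checks the first part by differentiation in \<open>t\<close>.\<close>

lemma E_DW: "B (E P t u) (DW P g t v) = B (DW P v t u) g"
proof -
  have "B (E P t u) (DW P v t g - br (W P t v) (W P t g)) = B (DW P v t u) g"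
  proof (rule vector_derivative_eq_imp_eq[of _ "\<lambda>t. B (DE P v t u) g"])
    fix t
    define y where "y = DW P v t g - br (W P t v) (W P t g)"
    have "br P y = br (W P t v) g - br (E P t v) (W P t g)"
      unfolding y_def br.diff_right
      by (simp add: ad_derivation[of P] ad_W br.diff_left br.diff_right DE_eq ad_DW[of P v t g, symmetric])
    then have "B (E P t u) (br (W P t v) g) = B (E P t u) (br P y + br (E P t v) (W P t g))" by simp
    moreover have "B (DE P v t u) g = - B (E P t u) (br (W P t v) g)"
      by (simp add: DE_eq[symmetric] ad_skew)
    ultimately have "- B (E P t u) (br P y) - B (E P t u) (br (E P t v) (W P t g)) = B (DE P v t u) g"
      by (simp add: B.add_right)
    then show "((\<lambda>t. B (E P t u) (DW P v t g - br (W P t v) (W P t g))) has_vector_derivative B (DE P v t u) g) (at t)"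
      by (intro has_vector_derivative_eq_rhs[OF B.has_vector_derivative[OF vd(1) has_vector_derivative_diff[OF vd(5)
            br.has_vector_derivative[OF vd(2) vd(2)]]]])
        (simp add: y_def ad_skew DE_eq[symmetric] B.diff_right B.add_right B.minus_right br.diff_right algebra_simps)
  next
    show "((\<lambda>t. B (DW P v t u) g) has_vector_derivative B (DE P v t u) g) (at t)" for t
      by (rule has_vector_derivative_eq_rhs, (rule B_rules)+) (simp add: B.zero_right)
  qed (simp add: B.zero_left B.zero_right br.zero_left)
  then show ?thesis using maurer_cartan[of P v t g] by (simp add: algebra_simps)
qed

text \<open>Duhamel's formula leaves a bracket of two values of \<open>W\<close> against
  \<open>E P t v\<close>. The isometry moves \<open>E\<close> across and turns \<open>t\<close> into
  \<open>- t\<close>; there \<open>maurer_cartan\<close> resolves the bracket and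
  \<open>DW_transpose\<close> returns to \<open>t\<close>.\<close>

lemma W_DE: "B (W P t u) (DE P g t v) = B u (DW P g t v) - B g (DW P u t v)"
proof -
  have "B (W P t u) (DE P g t v) = - B (br (W P t g) (W P t u)) (E P t v)"
    by (simp add: DE_eq[symmetric] ad_skew)
  also have "\<dots> = - B (E P (- t) (br (W P t g) (W P t u))) v"
    by (simp add: E_transpose)
  also have "\<dots> = - B (br (W P (- t) g) (W P (- t) u)) v"
    by (simp add: E_br[symmetric] E_neg_W br.minus_left br.minus_right)
  finally show ?thesis
    by (simp add: maurer_cartan[symmetric] B.diff_left DW_transpose)
qed

text \<open>Differentiation in \<open>t\<close> lowers each \<open>DT\<close> to \<open>DW\<close>,
  and \<open>E_DW\<close> and \<open>W_DE\<close> treat the two terms of the product rule;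
  everything cancels except \<open>B u (DW P g t v)\<close>.\<close>

lemma curvature_form:
  "B (DT P u t v - DT P v t u) g + B (W P t u) (DW P g t v) = B (DT P g t v) u"
proof (rule vector_derivative_eq_imp_eq[of _ "\<lambda>t. B (DW P g t v) u"])
  show "((\<lambda>t. B (DT P u t v - DT P v t u) g + B (W P t u) (DW P g t v)) has_vector_derivative B (DW P g t v) u) (at t)" for t
    by (rule has_vector_derivative_eq_rhs, (rule B_rules)+)
      (simp add: E_DW W_DE B.zero_right B.diff_left B_sym[of u] B_sym[of g])
  show "((\<lambda>t. B (DT P g t v) u) has_vector_derivative B (DW P g t v) u) (at t)" for t
    by (rule has_vector_derivative_eq_rhs, (rule B_rules)+) (simp add: B.zero_right)
qed (simp_all add: B.zero_left B.zero_right)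

end

section \<open>Spaces in duality\<close>

lemma fin_dimI:
  assumes "finite I" "\<And>i. i \<in> I \<Longrightarrow> bounded_linear (c i :: 'd::real_normed_vector \<Rightarrow> real)"
    "\<And>x. x = (\<Sum>i\<in>I. c i x *\<^sub>R e i)"
  shows "fin_dim TYPE('d)"
proof -
  obtain h where h: "bij_betw h {..<card I} I"
    using ex_bij_betw_nat_finite[OF assms(1)] by (auto simp: atLeast0LessThan)
  have "(\<Sum>i\<in>I. c i x *\<^sub>R e i) = (\<Sum>i<card I. c (h i) x *\<^sub>R e (h i))" for x
    by (rule sum.reindex_bij_betw[OF h, symmetric])
  then have "\<forall>x. x = (\<Sum>i<card I. c (h i) x *\<^sub>R e (h i))" using assms(3) by (metis (no_types))
  moreover have "\<forall>i<card I. bounded_linear (c (h i))" using assms(2) h by (auto simp: bij_betw_def)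
  ultimately show ?thesis unfolding fin_dim_def
    by (intro exI[of _ "card I"] exI[of _ "\<lambda>i. c (h i)"] exI[of _ "\<lambda>i. e (h i)"]) blast
qed

lemma bounded_linear_to_complex: "bounded_linear (to_complex :: 'k::real_or_complex \<Rightarrow> complex)"
  by (rule bounded_linear_intro[of _ 1]) (simp_all add: to_complex_add to_complex_scaleR norm_to_complex)

lemma to_complex_of_real: "to_complex (of_real r :: 'k::real_or_complex) = of_real r"
  by (simp only: of_real_def to_complex_scaleR to_complex_one)

lemma inj_to_complex: "inj (to_complex :: 'k::real_or_complex \<Rightarrow> complex)"
proof -
  interpret bounded_linear "to_complex :: 'k \<Rightarrow> complex" by (rule bounded_linear_to_complex)
  show ?thesis
  proof (rule injI)
    fix x y :: 'k assume "to_complex x = to_complex y"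
    then have "to_complex (x - y) = 0" by (simp add: diff)
    then have "norm (x - y) = 0" using norm_to_complex[of "x - y"] by simp
    then show "x = y" by simp
  qed
qed

text \<open>Together with \<open>1\<close>, a value off the real axis would span the plane over
  \<real> and make the embedding onto.\<close>

lemma to_complex_real:
  assumes "\<not> surj (to_complex :: 'k::real_or_complex \<Rightarrow> complex)"
  shows "Im (to_complex (x :: 'k)) = 0"
proof (rule ccontr)
  interpret bounded_linear "to_complex :: 'k \<Rightarrow> complex" by (rule bounded_linear_to_complex)
  assume im: "Im (to_complex x) \<noteq> 0"
  have "z \<in> range (to_complex :: 'k \<Rightarrow> complex)" for z
  proof -
    define s where "s = Im z / Im (to_complex x)"
    have "z = to_complex (s *\<^sub>R x + (Re z - s * Re (to_complex x)) *\<^sub>R 1)"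
      using im by (simp add: add scaleR to_complex_one complex_eq_iff s_def)
    then show ?thesis by blast
  qed
  then show False using assms by blast
qed

lemma fin_dim_scalars: "fin_dim TYPE('k::real_or_complex)"
proof -
  interpret bounded_linear "to_complex :: 'k \<Rightarrow> complex" by (rule bounded_linear_to_complex)
  \<comment> \<open>In the real case the default \<open>0\<close> is harmless: its coefficient is an
    imaginary part, which vanishes by \<open>to_complex_real\<close>.\<close>
  define j :: 'k where "j = (if surj (to_complex :: 'k \<Rightarrow> complex) then inv to_complex \<i> else 0)"
  define c :: "bool \<Rightarrow> 'k \<Rightarrow> real" where "c b x = (if b then Re (to_complex x) else Im (to_complex x))" for b x
  show ?thesis
  proof (rule fin_dimI)
    show "finite (UNIV :: bool set)" by simp
    show "bounded_linear (c b)" for b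
      unfolding c_def
      by (cases b) (auto intro!: bounded_linear_compose[OF bounded_linear_Re] bounded_linear_compose[OF bounded_linear_Im]
          bounded_linear_to_complex)
    show "x = (\<Sum>b\<in>UNIV. c b x *\<^sub>R (if b then 1 else j))" for x :: 'k
    proof (rule injD[OF inj_to_complex])
      show "to_complex x = to_complex (\<Sum>b\<in>UNIV. c b x *\<^sub>R (if b then 1 else j))"
      proof (cases "surj (to_complex :: 'k \<Rightarrow> complex)")
        case True
        then have "to_complex j = \<i>" by (simp add: j_def surj_f_inv_f)
        then show ?thesis by (simp add: UNIV_bool c_def add scaleR to_complex_one complex_eq_iff)
      next
        case False
        then show ?thesis using to_complex_real[OF False]
          by (simp add: UNIV_bool c_def add scaleR zero j_def to_complex_one complex_eq_iff)
      qed
    qed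
  qed
qed

locale duality =
  fixes P :: "('k::real_or_complex, 'v::real_normed_vector, 'w::real_normed_vector, 'm) dual_pair_scheme"
  assumes dual: "is_dual_pair P"
begin

sublocale V: fd_space "scal P" using dual by (simp add: is_dual_pair_def)
sublocale V': fd_space "coscal P" using dual by (simp add: is_dual_pair_def)
sublocale pair: bounded_bilinear "pairing P" using dual by (simp add: is_dual_pair_def)

lemma pairing_coscal: "pairing P (coscal P c \<omega>) v = c * pairing P \<omega> v"
  and pairing_scal: "pairing P \<omega> (scal P c v) = c * pairing P \<omega> v"
  using dual by (simp_all add: is_dual_pair_def)

lemma vectors_separated: "(\<And>\<omega>. pairing P \<omega> v = 0) \<Longrightarrow> v = 0"
  using dual unfolding is_dual_pair_def by blast

lemma covector_eqI: "(\<And>v. pairing P \<omega> v = pairing P \<omega>' v) \<Longrightarrow> \<omega> = \<omega>'"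
  using dual unfolding is_dual_pair_def by (metis pair.diff_left eq_iff_diff_eq_0)

lemma vector_eqI: "(\<And>\<omega>. pairing P \<omega> v = pairing P \<omega> v') \<Longrightarrow> v = v'"
  using dual unfolding is_dual_pair_def by (metis pair.diff_right eq_iff_diff_eq_0)

text \<open>Gram-Schmidt in duality: \<open>u\<close> is what the dual family of \<open>S\<close>
  misses of the new vector \<open>v\<close>. A functional nonzero on \<open>u\<close> is corrected
  to vanish on \<open>S\<close> and normalised at \<open>v\<close>; the old functionals are then
  corrected to vanish on \<open>v\<close>.\<close>

lemma dual_family:
  assumes "finite S" "V.independent S"
  shows "\<exists>w. \<forall>b\<in>S. \<forall>b'\<in>S. pairing P (w b) b' = (if b = b' then 1 else 0)"
  using assms
proof (induction S rule: finite_induct)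
  case empty
  then show ?case by simp
next
  case (insert v S)
  have "V.independent S" "v \<notin> V.span S"
    using insert.prems insert.hyps V.independent_insert by auto
  then obtain w where w: "\<And>b b'. b \<in> S \<Longrightarrow> b' \<in> S \<Longrightarrow> pairing P (w b) b' = (if b = b' then 1 else 0)"
    using insert.IH by blast
  define u where "u = v - (\<Sum>b\<in>S. scal P (pairing P (w b) v) b)"
  have "u \<noteq> 0"
  proof
    assume "u = 0"
    then have eq: "(\<Sum>b\<in>S. scal P (pairing P (w b) v) b) = v" by (simp add: u_def)
    have "(\<Sum>b\<in>S. scal P (pairing P (w b) v) b) \<in> V.span S"
      by (intro V.span_sum V.span_scale V.span_base)
    then show False using \<open>v \<notin> V.span S\<close> unfolding eq by blast
  qed
  then have "\<exists>\<omega>. pairing P \<omega> u \<noteq> 0" using vectors_separated[of u] by blast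
  then obtain \<omega> where \<omega>: "pairing P \<omega> u \<noteq> 0" ..
  define \<omega>0 where "\<omega>0 = \<omega> - (\<Sum>b\<in>S. coscal P (pairing P \<omega> b) (w b))"
  have \<omega>0S: "pairing P \<omega>0 b = 0" if "b \<in> S" for b
    using that insert.hyps(1) w
    by (simp add: \<omega>0_def pair.diff_left pair.sum_left pairing_coscal if_distrib[of "\<lambda>x. _ * x"] cong: if_cong)
  have "pairing P \<omega>0 v = pairing P \<omega> u"
    by (simp add: \<omega>0_def u_def pair.diff_left pair.diff_right pair.sum_left pair.sum_right pairing_coscal pairing_scal
        mult.commute)
  then have \<omega>0v: "pairing P \<omega>0 v \<noteq> 0" using \<omega> by simp
  define \<omega>1 where "\<omega>1 = coscal P (inverse (pairing P \<omega>0 v)) \<omega>0"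
  have \<omega>1: "pairing P \<omega>1 v = 1" "b \<in> S \<Longrightarrow> pairing P \<omega>1 b = 0" for b
    using \<omega>0v \<omega>0S by (simp_all add: \<omega>1_def pairing_coscal)
  define w' where "w' b = (if b = v then \<omega>1 else w b - coscal P (pairing P (w b) v) \<omega>1)" for b
  have "pairing P (w' b) b' = (if b = b' then 1 else 0)" if "b \<in> insert v S" "b' \<in> insert v S" for b b'
    using that insert.hyps(2) \<omega>1 w
    by (auto simp: w'_def pair.diff_left pairing_coscal)
  then show ?case by blast
qed

lemma dual_basis:
  obtains S w where "finite S" "\<And>x. x = (\<Sum>b\<in>S. scal P (pairing P (w b) x) b)"
proof -
  obtain S0 where S0: "finite S0" "V.span S0 = UNIV" using V.finite_dim by blast
  obtain S where S: "S \<subseteq> S0" "V.independent S" "S0 \<subseteq> V.span S"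
    using V.maximal_independent_subset[of S0] by blast
  have sp: "V.span S = UNIV" using S0(2) S(3) by (metis V.span_mono V.span_span top.extremum_uniqueI)
  have fin: "finite S" using S(1) S0(1) finite_subset by blast
  obtain w where w: "\<And>b b'. b \<in> S \<Longrightarrow> b' \<in> S \<Longrightarrow> pairing P (w b) b' = (if b = b' then 1 else 0)"
    using dual_family[OF fin S(2)] by blast
  have "x = (\<Sum>b\<in>S. scal P (pairing P (w b) x) b)" for x
  proof -
    have "x \<in> range (\<lambda>u. \<Sum>v\<in>S. scal P (u v) v)" using sp V.span_finite[OF fin] by auto
    then obtain u where u: "x = (\<Sum>v\<in>S. scal P (u v) v)" by blast
    have "pairing P (w b) x = u b" if "b \<in> S" for b
      unfolding u using that fin w
      by (simp add: pair.sum_right pairing_scal if_distrib[of "\<lambda>x. _ * x"] cong: if_cong)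
    then show ?thesis using u by simp
  qed
  then show ?thesis using that fin by blast
qed

lemma covector_of:
  assumes add: "\<And>x y. f (x + y) = f x + f y" and scal: "\<And>c x. f (scal P c x) = c * f x"
  shows "pairing P (covector_of P f) v = f v"
proof -
  obtain S w where S: "finite S" and ex: "\<And>x. x = (\<Sum>b\<in>S. scal P (pairing P (w b) x) b)"
    using dual_basis by blast
  define \<omega> where "\<omega> = (\<Sum>b\<in>S. coscal P (f b) (w b))"
  have f0: "f 0 = 0" using add[of 0 0] by simp
  have fs: "f (\<Sum>b\<in>S. g b) = (\<Sum>b\<in>S. f (g b))" for g
    using S by (induction S rule: finite_induct) (simp_all add: f0 add)
  have "f (\<Sum>b\<in>S. scal P (pairing P (w b) x) b) = (\<Sum>b\<in>S. pairing P (w b) x * f b)" for x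
    unfolding fs by (simp only: scal)
  then have fx: "f x = (\<Sum>b\<in>S. pairing P (w b) x * f b)" for x unfolding ex[symmetric] .
  have w: "pairing P \<omega> x = f x" for x
    by (subst fx) (simp add: \<omega>_def pair.sum_left pairing_coscal mult.commute)
  then have "\<forall>x. pairing P \<omega> x = f x" by blast
  then have "\<forall>v. pairing P (covector_of P f) v = f v"
    unfolding covector_of_def by (rule theI) (auto intro!: covector_eqI simp: w)
  then show ?thesis by blast
qed

lemma linear_of_additive:
  assumes "\<And>x y. f (x + y) = f x + f y" "\<And>c x. f (scal P c x) = s c (f x)"
    "\<And>r y. s (of_real r) y = r *\<^sub>R y"
  shows "linear f"
proof (rule linearI)
  fix r :: real and x
  have "f (r *\<^sub>R x) = f (scal P (of_real r) x)" by (simp only: V.scale_of_real)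
  then show "f (r *\<^sub>R x) = r *\<^sub>R f x" by (simp only: assms)
qed (rule assms)

text \<open>The real coordinates are those of the scalars \<open>pairing P (w b) x\<close>, taken in
  a real spanning family of the scalar field.\<close>

lemma fin_dim_V: "fin_dim TYPE('v)"
proof -
  obtain S w where S: "finite S" and ex: "\<And>x. x = (\<Sum>b\<in>S. scal P (pairing P (w b) x) b)"
    using dual_basis by blast
  obtain n c and e :: "nat \<Rightarrow> 'k::real_or_complex" where c: "\<And>i. i < n \<Longrightarrow> bounded_linear (c i)"
    and e: "\<And>x. x = (\<Sum>i<n. c i x *\<^sub>R e i)" using that by (rule fin_dimE[OF fin_dim_scalars])
  define C where "C = (\<lambda>(b, i) x. c i (pairing P (w b) x))"
  have sc: "scal P (r *\<^sub>R a) b = r *\<^sub>R scal P a b" for r a b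
    by (simp only: scaleR_conv_of_real[where 'a='k] V.scale_scale[symmetric] V.scale_of_real)
  have exs: "scal P a b = (\<Sum>i<n. c i a *\<^sub>R scal P (e i) b)" for a b
  proof -
    have "scal P (\<Sum>i<n. c i a *\<^sub>R e i) b = (\<Sum>i<n. c i a *\<^sub>R scal P (e i) b)"
      by (simp add: V.scale_sum_left sc)
    then show ?thesis unfolding e[symmetric] .
  qed
  have "(\<Sum>b\<in>S. scal P (pairing P (w b) x) b) = (\<Sum>b\<in>S. \<Sum>i<n. c i (pairing P (w b) x) *\<^sub>R scal P (e i) b)" for x
    by (intro sum.cong refl exs)
  also have "\<dots> x = (\<Sum>q\<in>S \<times> {..<n}. C q x *\<^sub>R scal P (e (snd q)) (fst q))" for x
    by (simp add: sum.cartesian_product C_def case_prod_unfold)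
  finally have "x = (\<Sum>q\<in>S \<times> {..<n}. C q x *\<^sub>R scal P (e (snd q)) (fst q))" for x
    unfolding ex[symmetric] .
  moreover have "bounded_linear (C q)" if "q \<in> S \<times> {..<n}" for q
    using that unfolding C_def
    by (auto intro!: bounded_linear_compose[OF c] pair.bounded_linear_right)
  ultimately show ?thesis using S by (intro fin_dimI[of "S \<times> {..<n}" C]) auto
qed

end

definition flip_dual :: "('k, 'v, 'w, 'm) dual_pair_scheme \<Rightarrow> ('k, 'w, 'v) dual_pair" where
  "flip_dual P = \<lparr>scal = coscal P, coscal = scal P, pairing = (\<lambda>v \<omega>. pairing P \<omega> v)\<rparr>"

context duality begin

lemma duality_flip: "duality (flip_dual P)"
proof
  show "is_dual_pair (flip_dual P)"
    using dual bounded_bilinear.flip[of "pairing P"] unfolding is_dual_pair_def flip_dual_def by simp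
qed

lemma fin_dim_V': "fin_dim TYPE('w)" by (rule duality.fin_dim_V[OF duality_flip])

lemma vector_of_eqI:
  assumes "\<And>\<omega>. pairing P \<omega> v = f \<omega>" shows "vector_of P f = v"
  unfolding vector_of_def by (rule the_equality) (auto intro!: vector_eqI simp: assms)

lemma vector_of:
  assumes "\<And>x y. f (x + y) = f x + f y" "\<And>c x. f (coscal P c x) = c * f x"
  shows "pairing P \<omega> (vector_of P f) = f \<omega>"
  using duality.covector_of[OF duality_flip, of f \<omega>] assms by (simp add: flip_dual_def vector_of_def covector_of_def)

end

lemma transpose_map:
  assumes "duality P" "duality Q"
    and "\<And>x y. f (x + y) = f x + f y" "\<And>c x. f (scal P c x) = scal Q c (f x)"
  shows "pairing P (transpose_map P Q f \<omega>) v = pairing Q \<omega> (f v)"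
proof -
  interpret P: duality P by fact
  interpret Q: duality Q by fact
  show ?thesis unfolding transpose_map_def
    by (rule P.covector_of) (simp_all add: assms Q.pair.add_right Q.pairing_scal)
qed

section \<open>The zeros of the hyperbolic sine and the spectrum\<close>

lemma in_span_image_lessThan:
  fixes f :: "nat \<Rightarrow> 'd::real_vector"
  shows "y \<in> span (f ` {..<n}) \<Longrightarrow> \<exists>a. y = (\<Sum>k<n. a k *\<^sub>R f k)"
proof (induction n arbitrary: y)
  case (Suc n)
  have "f ` {..<Suc n} = insert (f n) (f ` {..<n})" by (auto simp: lessThan_Suc)
  then obtain c where "y - c *\<^sub>R f n \<in> span (f ` {..<n})" using Suc.prems by (auto simp: span_insert)
  then obtain a where "y - c *\<^sub>R f n = (\<Sum>k<n. a k *\<^sub>R f k)" using Suc.IH by blast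
  then have "y = (\<Sum>k<Suc n. (a(n := c)) k *\<^sub>R f k)" by (simp add: algebra_simps)
  then show ?case by blast
qed simp

text \<open>The eigenvector of the complexification is \<open>v + \<i> w\<close>. For the monic
  \<open>p\<close> of least degree with \<open>p(A) x = 0\<close> and a root \<open>\<mu>\<close>,
  it is \<open>r(A) x\<close> where \<open>p = (X - \<mu>) r\<close>. It stays in the cyclic
  subspace of \<open>x\<close>, so eigenvectors are found inside an invariant subspace such as a
  kernel.\<close>

lemma complex_eigenvector:
  fixes A :: "'d::real_normed_vector \<Rightarrow> 'd"
  assumes fd: "fin_dim TYPE('d)" and A: "linear A" and "x \<noteq> 0"
  obtains \<mu> :: complex and v w where "v \<in> span (range (\<lambda>k. (A ^^ k) x))" "w \<in> span (range (\<lambda>k. (A ^^ k) x))"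
    "v \<noteq> 0" "A v = Re \<mu> *\<^sub>R v - Im \<mu> *\<^sub>R w" "A w = Im \<mu> *\<^sub>R v + Re \<mu> *\<^sub>R w"
proof -
  define f where "f k = (A ^^ k) x" for k
  obtain m c and e :: "nat \<Rightarrow> 'd::real_normed_vector" where c: "\<And>i. i < m \<Longrightarrow> bounded_linear (c i)"
    and e: "\<And>x. x = (\<Sum>i<m. c i x *\<^sub>R e i)" using that by (rule fin_dimE[OF fd])
  have "(\<Sum>i<m. c i x *\<^sub>R e i) \<in> span (e ` {..<m})" for x
    by (intro span_sum span_scale span_base) auto
  then have sp: "x \<in> span (e ` {..<m})" for x unfolding e[symmetric] .
  have "\<exists>n. f n \<in> span (f ` {..<n})"
  proof (rule ccontr)
    assume "\<nexists>n. f n \<in> span (f ` {..<n})"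
    then have no: "f n \<notin> span (f ` {..<n})" for n by blast
    have ind: "independent (f ` {..<n}) \<and> card (f ` {..<n}) = n" for n
    proof (induction n)
      case 0 then show ?case by (simp add: independent_empty)
    next
      case (Suc n)
      have "f ` {..<Suc n} = insert (f n) (f ` {..<n})" by (auto simp: lessThan_Suc)
      moreover have "f n \<notin> f ` {..<n}"
      proof
        assume "f n \<in> f ` {..<n}"
        then have "f n \<in> span (f ` {..<n})" by (rule span_base)
        then show False using no[of n] by simp
      qed
      ultimately show ?case using Suc no[of n] by (simp add: independent_insert)
    qed
    have "card (f ` {..<Suc m}) \<le> card (e ` {..<m})"
      using independent_span_bound[of "e ` {..<m}" "f ` {..<Suc m}"] ind[of "Suc m"] sp by blast
    also have "\<dots> \<le> m" using card_image_le[of "{..<m}" e] by simp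
    finally show False using ind[of "Suc m"] by simp
  qed
  then have ex: "\<exists>n. f n \<in> span (f ` {..<n})" .
  define n where "n = (LEAST n. f n \<in> span (f ` {..<n}))"
  have n: "f n \<in> span (f ` {..<n})" unfolding n_def by (rule LeastI_ex[OF ex])
  have least: "f k \<notin> span (f ` {..<k})" if "k < n" for k
    using that not_less_Least unfolding n_def by blast
  obtain a where a: "f n = (\<Sum>k<n. a k *\<^sub>R f k)" using in_span_image_lessThan[OF n] by blast
  have "n \<noteq> 0" using n \<open>x \<noteq> 0\<close> by (cases n) (auto simp: f_def)
  then obtain n' where n': "n = Suc n'" using not0_implies_Suc by blast
  define p :: "complex poly" where "p = monom 1 n - (\<Sum>k<n. monom (of_real (a k)) k)"
  have cp: "coeff p k = (if k = n then 1 else if k < n then - of_real (a k) else 0)" for k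
    by (auto simp: p_def coeff_sum)
  have dp: "degree p = n"
    by (intro antisym degree_le le_degree) (auto simp: cp)
  have "\<not> constant (poly p)" using dp \<open>n \<noteq> 0\<close> by (simp add: constant_degree)
  from fundamental_theorem_of_algebra[OF this] obtain \<mu> where "poly p \<mu> = 0" ..
  then obtain r where r: "p = [:- \<mu>, 1:] * r" by (auto simp: poly_eq_0_iff_dvd)
  have "r \<noteq> 0" using r dp \<open>n \<noteq> 0\<close> by auto
  then have "degree p = 1 + degree r" unfolding r by (subst degree_mult_eq) auto
  then have dr: "degree r = n'" using dp n' by simp
  have cr: "coeff r k = 0" if "k \<ge> n" for k using that dr n' by (intro coeff_eq_0) simp
  have pr: "coeff p (Suc k) = coeff r k - \<mu> * coeff r (Suc k)" "coeff p 0 = - \<mu> * coeff r 0" for k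
    unfolding r by simp_all
  have lead: "coeff r n' = 1" using pr(1)[of n'] cr[of n] cp[of n] n' by simp
  define R where "R = coeff r"
  define v w where "v = (\<Sum>k<n. Re (R k) *\<^sub>R f k)" and "w = (\<Sum>k<n. Im (R k) *\<^sub>R f k)"
  have Af: "A (f k) = f (Suc k)" for k by (simp add: f_def)
  \<comment> \<open>Comparison of coefficients in \<open>p = (X - \<mu>) r\<close>, with
    \<open>\<phi>\<close> the real or the imaginary part. The two terms with \<open>\<phi> 1\<close>
    alone cancel by the relation \<open>a\<close>.\<close>
  have key: "(\<Sum>k<n. \<phi> (R k) *\<^sub>R f (Suc k)) = \<phi> 1 *\<^sub>R f n - (\<Sum>k<n. \<phi> 1 *\<^sub>R a k *\<^sub>R f k) + (\<Sum>k<n. \<phi> (\<mu> * R k) *\<^sub>R f k)"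
    if \<phi>: "linear \<phi>" for \<phi> :: "complex \<Rightarrow> real"
  proof -
    have "(\<Sum>k<n. \<phi> (R k) *\<^sub>R f (Suc k)) = (\<Sum>k<n. \<phi> (coeff p (Suc k) + \<mu> * R (Suc k)) *\<^sub>R f (Suc k))"
      by (simp add: pr(1) R_def)
    also have "\<dots> = (\<Sum>k<Suc n. \<phi> (coeff p k + \<mu> * R k) *\<^sub>R f k)"
      using pr(2) linear_0[OF \<phi>] by (subst sum.lessThan_Suc_shift) (simp add: R_def)
    also have "\<dots> = (\<Sum>k<n. \<phi> (- of_real (a k) + \<mu> * R k) *\<^sub>R f k) + \<phi> 1 *\<^sub>R f n"
      using cr[of n] by (simp add: cp R_def)
    also have "\<dots> = (\<Sum>k<n. (\<phi> (\<mu> * R k) - \<phi> 1 * a k) *\<^sub>R f k) + \<phi> 1 *\<^sub>R f n"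
    proof -
      have "\<phi> (of_real (a k)) = \<phi> 1 * a k" for k
        using linear_cmul[OF \<phi>, of "a k" 1] by (simp add: scaleR_conv_of_real)
      then have "\<phi> (- of_real (a k) + \<mu> * R k) = \<phi> (\<mu> * R k) - \<phi> 1 * a k" for k
        using linear_diff[OF \<phi>, of "\<mu> * R k" "of_real (a k)"] by simp
      then show ?thesis by simp
    qed
    finally show ?thesis by (simp add: scaleR_diff_left sum_subtractf)
  qed
  have "A v = (\<Sum>k<n. Re (R k) *\<^sub>R f (Suc k))"
    unfolding v_def by (simp add: linear_sum[OF A] linear_cmul[OF A] Af)
  also have "\<dots> = (\<Sum>k<n. Re (\<mu> * R k) *\<^sub>R f k)"
    using key[of Re] a by (simp add: bounded_linear.linear bounded_linear_Re)
  also have "\<dots> = Re \<mu> *\<^sub>R v - Im \<mu> *\<^sub>R w"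
    by (simp add: v_def w_def scaleR_sum_right sum_subtractf scaleR_diff_left)
  finally have Av: "A v = Re \<mu> *\<^sub>R v - Im \<mu> *\<^sub>R w" .
  have "A w = (\<Sum>k<n. Im (R k) *\<^sub>R f (Suc k))"
    unfolding w_def by (simp add: linear_sum[OF A] linear_cmul[OF A] Af)
  also have "\<dots> = (\<Sum>k<n. Im (\<mu> * R k) *\<^sub>R f k)"
    using key[of Im] a by (simp add: bounded_linear.linear bounded_linear_Im)
  also have "\<dots> = Im \<mu> *\<^sub>R v + Re \<mu> *\<^sub>R w"
    by (simp add: v_def w_def scaleR_sum_right sum.distrib scaleR_add_left add.commute)
  finally have Aw: "A w = Im \<mu> *\<^sub>R v + Re \<mu> *\<^sub>R w" .
  \<comment> \<open>As \<open>r\<close> is monic of degree \<open>n'\<close>, the equation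
    \<open>v = 0\<close> would express \<open>f n'\<close> by lower powers, against the minimality
    of \<open>n\<close>.\<close>
  have "v \<noteq> 0"
  proof
    assume "v = 0"
    then have "f n' = - (\<Sum>k<n'. Re (R k) *\<^sub>R f k)"
      using lead by (simp add: v_def n' R_def eq_neg_iff_add_eq_0 add.commute)
    moreover have "- (\<Sum>k<n'. Re (R k) *\<^sub>R f k) \<in> span (f ` {..<n'})"
      by (intro span_neg span_sum span_scale span_base) auto
    ultimately show False using least[of n'] n' by simp
  qed
  moreover have "v \<in> span (range f)" "w \<in> span (range f)"
    unfolding v_def w_def by (intro span_sum span_scale span_base rangeI)+
  ultimately show ?thesis using that Av Aw unfolding f_def by blast
qed

definition sinhc_op :: "('d::real_normed_vector \<Rightarrow> 'd) \<Rightarrow> 'd \<Rightarrow> 'd" where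
  "sinhc_op = fps_op (sinh_fps / fps_X)"

lemma sinhc_nth: "fps_nth (sinh_fps / fps_X) n = (if even n then 1 / fact (n + 1) else 0)"
  by (simp add: sinh_fps_def del: fact_Suc)

lemma sinhc_op_eq: "sinhc_op A v = (\<Sum>n. (if even n then 1 / fact (n + 1) else 0) *\<^sub>R (A ^^ n) v)"
  unfolding sinhc_op_def fps_op_def by (intro suminf_cong) (simp only: sinhc_nth)

lemma even_power_eigen:
  assumes "linear A" "A (A v) = Re \<mu> *\<^sub>R v - Im \<mu> *\<^sub>R w" "A (A w) = Im \<mu> *\<^sub>R v + Re \<mu> *\<^sub>R w"
  shows "(A ^^ (2 * m)) v = Re (\<mu> ^ m) *\<^sub>R v - Im (\<mu> ^ m) *\<^sub>R w \<and>
    (A ^^ (2 * m)) w = Im (\<mu> ^ m) *\<^sub>R v + Re (\<mu> ^ m) *\<^sub>R w"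
proof (induction m)
  case (Suc m)
  have step: "(A ^^ (2 * Suc m)) y = A (A ((A ^^ (2 * m)) y))" for y by simp
  have "(A ^^ (2 * Suc m)) v = Re (\<mu> ^ m) *\<^sub>R (Re \<mu> *\<^sub>R v - Im \<mu> *\<^sub>R w) - Im (\<mu> ^ m) *\<^sub>R (Im \<mu> *\<^sub>R v + Re \<mu> *\<^sub>R w)"
    unfolding step assms(2,3)[symmetric] conjunct1[OF Suc]
    by (simp only: linear_diff[OF assms(1)] linear_cmul[OF assms(1)])
  moreover have "(A ^^ (2 * Suc m)) w = Im (\<mu> ^ m) *\<^sub>R (Re \<mu> *\<^sub>R v - Im \<mu> *\<^sub>R w) + Re (\<mu> ^ m) *\<^sub>R (Im \<mu> *\<^sub>R v + Re \<mu> *\<^sub>R w)"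
    unfolding step assms(2,3)[symmetric] conjunct2[OF Suc]
    by (simp only: linear_add[OF assms(1)] linear_cmul[OF assms(1)])
  ultimately show ?case by (simp del: funpow.simps add: algebra_simps)
qed simp

text \<open>The function \<open>sinh z / z\<close> is even, so only the square of \<open>A\<close>
  matters. At its eigenvalue \<open>- \<nu>\<^sup>2\<close> the series sums to
  \<open>sin \<nu> / \<nu>\<close>; the product \<open>\<nu> * g\<close> and the separate value at
  \<open>\<nu> = 0\<close> circumvent the removable singularity.\<close>

lemma sinhc_op_eigen:
  fixes A :: "'d::real_normed_vector \<Rightarrow> 'd"
  assumes A: "linear A" and ev: "A (A v) = Re \<mu> *\<^sub>R v - Im \<mu> *\<^sub>R w" "A (A w) = Im \<mu> *\<^sub>R v + Re \<mu> *\<^sub>R w"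
    and \<nu>: "\<mu> = - \<nu>\<^sup>2"
  obtains g where "\<nu> * g = sin \<nu>" "\<nu> = 0 \<Longrightarrow> g = 1" "sinhc_op A v = Re g *\<^sub>R v - Im g *\<^sub>R w" "sinhc_op A w = Im g *\<^sub>R v + Re g *\<^sub>R w"
proof -
  define s :: "nat \<Rightarrow> complex" where "s n = of_real (sin_coeff (Suc n)) * \<nu> ^ n" for n
  have "(\<lambda>n. sin_coeff n *\<^sub>R \<nu> ^ n) sums sin \<nu>" by (rule sin_converges)
  then have "(\<lambda>n. sin_coeff (Suc n) *\<^sub>R \<nu> ^ Suc n) sums sin \<nu>"
    by (subst sums_Suc_iff) simp
  then have s\<nu>: "(\<lambda>n. \<nu> * s n) sums sin \<nu>" by (simp add: s_def scaleR_conv_of_real algebra_simps)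
  have sm: "summable s"
  proof (cases "\<nu> = 0")
    case True
    then have "s n = (if n = 0 then 1 else 0)" for n by (simp add: s_def sin_coeff_def)
    then have "s = (\<lambda>n. if n = 0 then 1 else 0)" by blast
    then show ?thesis by simp
  next
    case False
    then show ?thesis using s\<nu> by (metis summable_mult_D sums_summable)
  qed
  define g where "g = suminf s"
  have sg: "s sums g" using sm by (simp add: g_def summable_sums)
  have t: "(if even n then 1 / fact (n + 1) else 0) *\<^sub>R (A ^^ n) v = Re (s n) *\<^sub>R v - Im (s n) *\<^sub>R w \<and>
       (if even n then 1 / fact (n + 1) else 0) *\<^sub>R (A ^^ n) w = Im (s n) *\<^sub>R v + Re (s n) *\<^sub>R w" for n
  proof (cases "even n")
    case True
    then obtain m where m: "n = 2 * m" by blast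
    have "s n = (1 / fact (n + 1)) *\<^sub>R \<mu> ^ m"
      by (simp add: s_def m \<nu> sin_coeff_def scaleR_conv_of_real power_mult[symmetric] power_minus[of "\<nu>\<^sup>2"] del: fact_Suc)
    then show ?thesis using True even_power_eigen[OF A ev, of m]
      by (simp add: m scaleR_diff_right scaleR_add_right del: fact_Suc)
  next
    case False
    then show ?thesis by (simp add: s_def sin_coeff_def)
  qed
  have "(\<lambda>n. Re (s n) *\<^sub>R v - Im (s n) *\<^sub>R w) sums (Re g *\<^sub>R v - Im g *\<^sub>R w)"
    by (intro sums_diff sums_scaleR_left sums_Re sums_Im sg)
  then have 1: "sinhc_op A v = Re g *\<^sub>R v - Im g *\<^sub>R w" unfolding sinhc_op_eq using t by (simp add: sums_iff)
  have "(\<lambda>n. Im (s n) *\<^sub>R v + Re (s n) *\<^sub>R w) sums (Im g *\<^sub>R v + Re g *\<^sub>R w)"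
    by (intro sums_add sums_scaleR_left sums_Re sums_Im sg)
  then have 2: "sinhc_op A w = Im g *\<^sub>R v + Re g *\<^sub>R w" unfolding sinhc_op_eq using t by (simp add: sums_iff)
  have "(\<lambda>n. \<nu> * s n) sums (\<nu> * g)" by (rule sums_mult[OF sg])
  then have 3: "\<nu> * g = sin \<nu>" using s\<nu> sums_unique2 by blast
  have 4: "g = 1" if "\<nu> = 0"
  proof -
    have "s = (\<lambda>n. if n = 0 then 1 else 0)" using that by (auto simp: s_def sin_coeff_def)
    then show ?thesis using suminf_finite[of "{0}" s] by (simp add: g_def)
  qed
  show ?thesis using that 1 2 3 4 by blast
qed


lemma sinhc_op_commute:
  fixes A :: "'d::real_normed_vector \<Rightarrow> 'd"
  assumes fd: "fin_dim TYPE('d)" and A: "linear A"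
  shows "linear (sinhc_op A)" "sinhc_op A (A x) = A (sinhc_op A x)"
    "summable (\<lambda>n. (if even n then 1 / fact (n + 1) else 0) *\<^sub>R (A ^^ n) x)"
proof -
  have bA: "bounded_linear A" by (rule fin_dim_bounded_linear[OF fd A])
  let ?c = "\<lambda>n. (if even n then 1 / fact (n + 1) else 0 :: real)"
  have s: "summable (\<lambda>n. ?c n *\<^sub>R (A ^^ n) x)" for x
  proof -
    obtain C R where R: "R \<ge> 0" "\<And>n. norm ((A ^^ n) x) \<le> C * R ^ n"
      using exp_bounded_power[OF bA] unfolding exp_bounded_def by blast
    show ?thesis
    proof (rule fin_dim_summable[OF fd], rule summable_comparison_test'[OF exp_series_bound_summable[OF R(1), of 1 1 C], of 0])
      fix n :: nat
      have "norm (?c n *\<^sub>R (A ^^ n) x) \<le> \<bar>1 ^ (n + 1) / fact (n + 1)\<bar> * norm ((A ^^ n) x)"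
        by (auto intro!: mult_right_mono)
      also have "\<dots> \<le> \<bar>1 ^ (n + 1) / fact (n + 1)\<bar> * (C * R ^ n)" by (intro mult_left_mono R(2)) simp
      finally show "norm (norm (?c n *\<^sub>R (A ^^ n) x)) \<le> \<bar>1 ^ (n + 1) / fact (n + 1)\<bar> * (C * R ^ n)"
        by (simp only: real_norm_def abs_norm_cancel)
    qed
  qed
  have lp: "linear (A ^^ n)" for n
    by (induction n) (auto intro: linear_compose[OF _ A, unfolded o_def] linear_id simp: o_def id_def[symmetric])
  show "summable (\<lambda>n. ?c n *\<^sub>R (A ^^ n) x)" by (rule s)
  show "linear (sinhc_op A)"
  proof (rule linearI)
    show "sinhc_op A (x + y) = sinhc_op A x + sinhc_op A y" for x y
      unfolding sinhc_op_eq suminf_add[OF s s] linear_add[OF lp] scaleR_add_right ..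
    show "sinhc_op A (r *\<^sub>R x) = r *\<^sub>R sinhc_op A x" for r x
      unfolding sinhc_op_eq suminf_scaleR_right[OF s] linear_cmul[OF lp]
      by (rule suminf_cong) (rule scaleR_left_commute)
  qed
  show "sinhc_op A (A x) = A (sinhc_op A x)"
    unfolding sinhc_op_eq bounded_linear.suminf[OF bA s] linear_cmul[OF A]
    by (simp add: funpow_swap1)
qed

text \<open>The kernel is invariant under \<open>A\<close>, so if nonzero it contains an eigenvector
  of the complexified square of \<open>A\<close>, with eigenvalue \<open>- \<nu>\<^sup>2\<close>
  where \<open>sin \<nu> = 0\<close> and \<open>\<nu> \<noteq> 0\<close>. Stated through the square,
  the condition is real and the same for both scalar fields.\<close>

lemma sinhc_op_inj_iff:
  fixes A :: "'d::real_normed_vector \<Rightarrow> 'd"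
  assumes fd: "fin_dim TYPE('d)" and A: "linear A"
  shows "inj (sinhc_op A) \<longleftrightarrow> (\<forall>k::int. k \<noteq> 0 \<longrightarrow> (\<forall>u. A (A u) = - ((pi * real_of_int k)\<^sup>2) *\<^sub>R u \<longrightarrow> u = 0))"
proof
  assume inj: "inj (sinhc_op A)"
  have "u = 0" if k: "k \<noteq> 0" and u: "A (A u) = - ((pi * real_of_int k)\<^sup>2) *\<^sub>R u" for k :: int and u
  proof -
    define \<nu> :: complex where "\<nu> = of_real (pi * real_of_int k)"
    have n2: "- \<nu>\<^sup>2 = complex_of_real (- ((pi * real_of_int k)\<^sup>2))" by (simp add: \<nu>_def)
    obtain g where g: "\<nu> * g = sin \<nu>" "sinhc_op A u = Re g *\<^sub>R u - Im g *\<^sub>R 0"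
      by (rule sinhc_op_eigen[OF A, of u "- \<nu>\<^sup>2" 0 \<nu>])
        (use u in \<open>simp_all add: n2 linear_0[OF A] del: of_real_minus\<close>)
    have "\<nu> \<noteq> 0" using k by (simp add: \<nu>_def)
    moreover have "sin \<nu> = 0" unfolding sin_eq_0 \<nu>_def by (metis mult.commute)
    ultimately have "g = 0" using g(1) by simp
    then have "sinhc_op A u = sinhc_op A 0" using g(2) linear_0[OF sinhc_op_commute(1)[OF fd A]] by simp
    have "u = 0" using inj \<open>sinhc_op A u = sinhc_op A 0\<close> by (simp add: inj_eq)
    then show ?thesis .
  qed
  then show "\<forall>k::int. k \<noteq> 0 \<longrightarrow> (\<forall>u. A (A u) = - ((pi * real_of_int k)\<^sup>2) *\<^sub>R u \<longrightarrow> u = 0)"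
    by blast
next
  assume ev: "\<forall>k::int. k \<noteq> 0 \<longrightarrow> (\<forall>u. A (A u) = - ((pi * real_of_int k)\<^sup>2) *\<^sub>R u \<longrightarrow> u = 0)"
  have lin: "linear (sinhc_op A)" by (rule sinhc_op_commute(1)[OF fd A])
  have linAA: "linear (\<lambda>x. A (A x))" using linear_compose[OF A A] by (simp add: o_def)
  have "x = 0" if x: "sinhc_op A x = 0" for x
  proof (rule ccontr)
    assume "x \<noteq> 0"
    obtain \<mu> v w where vw: "v \<in> span (range (\<lambda>k. ((\<lambda>x. A (A x)) ^^ k) x))" "w \<in> span (range (\<lambda>k. ((\<lambda>x. A (A x)) ^^ k) x))"
      "v \<noteq> 0" "A (A v) = Re \<mu> *\<^sub>R v - Im \<mu> *\<^sub>R w" "A (A w) = Im \<mu> *\<^sub>R v + Re \<mu> *\<^sub>R w"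
      by (rule complex_eigenvector[OF fd linAA \<open>x \<noteq> 0\<close>])
    have "sinhc_op A (((\<lambda>x. A (A x)) ^^ k) x) = 0" for k
      by (induction k) (simp_all add: x sinhc_op_commute(2)[OF fd A] linear_0[OF A])
    then have "span (range (\<lambda>k. ((\<lambda>x. A (A x)) ^^ k) x)) \<subseteq> {y. sinhc_op A y = 0}"
      by (intro span_minimal) (auto simp: subspace_def linear_0[OF lin] linear_add[OF lin] linear_cmul[OF lin])
    then have D0: "sinhc_op A v = 0" "sinhc_op A w = 0" using vw(1,2) by auto
    define \<nu> where "\<nu> = csqrt (- \<mu>)"
    have "\<mu> = - \<nu>\<^sup>2" by (simp add: \<nu>_def)
    obtain g where g: "\<nu> * g = sin \<nu>" "\<nu> = 0 \<Longrightarrow> g = 1" "sinhc_op A v = Re g *\<^sub>R v - Im g *\<^sub>R w"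
      "sinhc_op A w = Im g *\<^sub>R v + Re g *\<^sub>R w"
      using that by (rule sinhc_op_eigen[OF A vw(4,5) \<open>\<mu> = - \<nu>\<^sup>2\<close>])
    \<comment> \<open>The operator multiplies \<open>v + \<i> w\<close> by the complex number
      \<open>g\<close>; a further multiplication by its conjugate isolates \<open>v\<close>.\<close>
    have "((Re g)\<^sup>2 + (Im g)\<^sup>2) *\<^sub>R v = Re g *\<^sub>R (Re g *\<^sub>R v - Im g *\<^sub>R w) + Im g *\<^sub>R (Im g *\<^sub>R v + Re g *\<^sub>R w)"
      by (simp add: algebra_simps power2_eq_square)
    also have "\<dots> = 0" using g(3,4) D0 by simp
    finally have "g = 0" using vw(3) by (simp add: complex_eq_iff sum_power2_eq_zero_iff)
    then have "\<nu> \<noteq> 0" "sin \<nu> = 0" using g(1,2) by auto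
    then obtain n :: int where n: "\<nu> = of_real (n * pi)" unfolding sin_eq_0 by blast
    have "n \<noteq> 0" using n \<open>\<nu> \<noteq> 0\<close> by auto
    have "\<mu> = complex_of_real (- ((pi * n)\<^sup>2))" using \<open>\<mu> = - \<nu>\<^sup>2\<close> by (simp add: n mult.commute)
    then have "A (A v) = - ((pi * n)\<^sup>2) *\<^sub>R v" using vw(4) by (simp del: of_real_minus)
    then show False using ev \<open>n \<noteq> 0\<close> vw(3) by blast
  qed
  then show "inj (sinhc_op A)" using linear_injective_0[OF lin] by blast
qed

text \<open>The forbidden set is symmetric about \<open>0\<close>, and with
  \<open>c = \<i>\<pi>k\<close> the operator \<open>A\<^sup>2 + (\<pi>k)\<^sup>2\<close> factors
  into \<open>A - c\<close> and \<open>A + c\<close>. For real scalars \<open>u\<close> and a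
  multiple of \<open>A u\<close> serve as real and imaginary part of an eigenvector.\<close>

lemma spectrum_avoids_iff:
  fixes sc :: "'k::real_or_complex \<Rightarrow> 'd::real_normed_vector \<Rightarrow> 'd"
  assumes sc: "vector_space sc" "\<And>r x. sc (of_real r) x = r *\<^sub>R x" and A: "Vector_Spaces.linear sc sc A"
  shows "spectrum_of sc A \<inter> {\<i> * of_real pi * of_int k |k. k \<noteq> 0} = {} \<longleftrightarrow>
    (\<forall>k::int. k \<noteq> 0 \<longrightarrow> (\<forall>u. A (A u) = - ((pi * real_of_int k)\<^sup>2) *\<^sub>R u \<longrightarrow> u = 0))"
proof -
  interpret vs: vector_space sc by (rule sc(1))
  interpret A: Vector_Spaces.linear sc sc A by (rule A)
  have linA: "linear A" by (rule linearI) (simp_all add: A.add A.scale sc(2)[symmetric])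
  have mu: "\<i> * of_real pi * of_int k = \<i> * complex_of_real (pi * real_of_int k)" for k :: int by simp
  show ?thesis
  proof (cases "surj (to_complex :: 'k \<Rightarrow> complex)")
    case True
    interpret tc: bounded_linear "to_complex :: 'k \<Rightarrow> complex" by (rule bounded_linear_to_complex)
    have spec: "\<mu> \<in> spectrum_of sc A \<longleftrightarrow> (\<exists>c v. \<mu> = to_complex c \<and> v \<noteq> 0 \<and> A v = sc c v)" for \<mu>
      using True unfolding spectrum_of_def by auto
    define j :: 'k where "j = inv to_complex \<i>"
    have j: "to_complex j = \<i>" using True by (simp add: j_def surj_f_inv_f)
    have cj: "to_complex (of_real (pi * real_of_int k) * j) = \<i> * of_real pi * of_int k" for k :: int
      by (simp add: to_complex_mult to_complex_of_real j del: of_real_mult) (simp add: mult.commute)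
    have jj: "j * j = of_real (- 1)"
      by (rule injD[OF inj_to_complex]) (simp only: to_complex_mult to_complex_of_real j, simp)
    have "(of_real a * j) * (of_real a * j) = of_real (- (a\<^sup>2))" for a :: real
    proof -
      have "(of_real a * j) * (of_real a * j) = of_real (a * a) * (j * j)" by (simp add: algebra_simps)
      also have "\<dots> = of_real (a * a * (- 1))" unfolding jj by (rule of_real_mult[symmetric])
      finally show ?thesis by (simp add: power2_eq_square)
    qed
    then have sq: "sc (of_real (pi * real_of_int k) * j) (sc (of_real (pi * real_of_int k) * j) u) = - ((pi * real_of_int k)\<^sup>2) *\<^sub>R u" for k :: int and u
      by (simp only: vs.scale_scale sc(2))
    show ?thesis
    proof (intro iffI allI impI)
      fix k :: int and u
      assume empty: "spectrum_of sc A \<inter> {\<i> * of_real pi * of_int k |k. k \<noteq> 0} = {}" and "k \<noteq> 0"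
        and u: "A (A u) = - ((pi * real_of_int k)\<^sup>2) *\<^sub>R u"
      define c where "c = of_real (pi * real_of_int k) * j"
      have sqc: "sc c (sc c u) = - ((pi * real_of_int k)\<^sup>2) *\<^sub>R u" unfolding c_def by (rule sq)
      have cjc: "to_complex c = \<i> * of_real pi * of_int k" unfolding c_def by (rule cj)
      have no: "v = 0" if "A v = sc d v" "to_complex d = \<i> * of_real pi * of_int k'" "k' \<noteq> 0" for v d k'
        using that empty spec by blast
      \<comment> \<open>The factor \<open>A + c\<close> sends \<open>u\<close> into the eigenspace
        of \<open>c\<close>, which is zero; so \<open>u\<close> lies in that of \<open>- c\<close>,
        which is zero as well.\<close>
      have "A (A u + sc c u) = sc c (A u + sc c u)"
        by (simp add: A.add A.scale u vs.scale_right_distrib sqc add.commute del: vs.scale_scale)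
      then have "A u + sc c u = 0" using cjc \<open>k \<noteq> 0\<close> by (rule no)
      then have "A u = sc (- c) u" by (simp add: eq_neg_iff_add_eq_0)
      then show "u = 0" by (rule no[of _ _ "- k"]) (use \<open>k \<noteq> 0\<close> in \<open>simp_all add: cjc tc.neg\<close>)
    next
      assume ev: "\<forall>k::int. k \<noteq> 0 \<longrightarrow> (\<forall>u. A (A u) = - ((pi * real_of_int k)\<^sup>2) *\<^sub>R u \<longrightarrow> u = 0)"
      have False if mem: "\<i> * of_real pi * of_int k \<in> spectrum_of sc A" and k: "k \<noteq> 0" for k :: int
      proof -
        obtain c v where c: "\<i> * of_real pi * of_int k = to_complex c" "v \<noteq> 0" "A v = sc c v" using mem spec by blast
        have "c = of_real (pi * real_of_int k) * j" using c(1) cj[of k] injD[OF inj_to_complex] by metis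
        then have "A (A v) = - ((pi * real_of_int k)\<^sup>2) *\<^sub>R v" using sq[of k v] c(3) by (simp add: A.scale del: vs.scale_scale)
        then show False using ev k c(2) by blast
      qed
      then show "spectrum_of sc A \<inter> {\<i> * of_real pi * of_int k |k. k \<noteq> 0} = {}" by blast
    qed
  next
    case False
    have spec: "\<mu> \<in> spectrum_of sc A \<longleftrightarrow> (\<exists>u v. (u, v) \<noteq> (0, 0) \<and>
                A u = Re \<mu> *\<^sub>R u - Im \<mu> *\<^sub>R v \<and> A v = Im \<mu> *\<^sub>R u + Re \<mu> *\<^sub>R v)" for \<mu>
      using False unfolding spectrum_of_def by auto
    have speck: "\<i> * of_real pi * of_int k \<in> spectrum_of sc A \<longleftrightarrow> (\<exists>u v. (u, v) \<noteq> (0, 0) \<and>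
                A u = - (pi * real_of_int k) *\<^sub>R v \<and> A v = (pi * real_of_int k) *\<^sub>R u)" for k :: int
      unfolding spec by simp
    show ?thesis
    proof (intro iffI allI impI)
      fix k :: int and u
      assume empty: "spectrum_of sc A \<inter> {\<i> * of_real pi * of_int k |k. k \<noteq> 0} = {}" and k: "k \<noteq> 0"
        and u: "A (A u) = - ((pi * real_of_int k)\<^sup>2) *\<^sub>R u"
      define v where "v = - (1 / (pi * real_of_int k)) *\<^sub>R A u"
      have "A u = - (pi * real_of_int k) *\<^sub>R v" using k by (simp add: v_def)
      moreover have "A v = (pi * real_of_int k) *\<^sub>R u" using k
        by (simp add: v_def linear_cmul[OF linA] linear_neg[OF linA] u power2_eq_square)
      ultimately show "u = 0" using empty k speck[of k] by blast
    next
      assume ev: "\<forall>k::int. k \<noteq> 0 \<longrightarrow> (\<forall>u. A (A u) = - ((pi * real_of_int k)\<^sup>2) *\<^sub>R u \<longrightarrow> u = 0)"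
      have False if mem: "\<i> * of_real pi * of_int k \<in> spectrum_of sc A" and k: "k \<noteq> 0" for k :: int
      proof -
        obtain u v where uv: "(u, v) \<noteq> (0, 0)" "A u = - (pi * real_of_int k) *\<^sub>R v" "A v = (pi * real_of_int k) *\<^sub>R u"
          using mem speck by blast
        have "A (A u) = - ((pi * real_of_int k)\<^sup>2) *\<^sub>R u" "A (A v) = - ((pi * real_of_int k)\<^sup>2) *\<^sub>R v"
          using uv(2,3) by (simp_all add: linear_cmul[OF linA] linear_neg[OF linA] power2_eq_square)
        then have "u = 0" "v = 0" using ev k by blast+
        then show False using uv(1) by simp
      qed
      then show "spectrum_of sc A \<inter> {\<i> * of_real pi * of_int k |k. k \<noteq> 0} = {}" by blast
    qed
  qed
qed

section \<open>The doubles of a compatible reductive decomposition\<close>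

lemma alternation_cyclic: "alternation T \<eta> \<zeta> \<xi> = alternation T \<xi> \<eta> \<zeta>"
  by (simp add: alternation_def algebra_simps)

lemma vector_space_pair_scale:
  assumes "vector_space s" "vector_space t" shows "vector_space (pair_scale s t)"
proof -
  interpret s: vector_space s by fact
  interpret t: vector_space t by fact
  show ?thesis
    by unfold_locales (auto simp: pair_scale_def s.scale_right_distrib t.scale_right_distrib
        s.scale_left_distrib t.scale_left_distrib)
qed

lemma Vector_Spaces_linearI:
  assumes "vector_space s" "vector_space t" "\<And>x y. f (x + y) = f x + f y" "\<And>c x. f (s c x) = t c (f x)"
  shows "Vector_Spaces.linear s t f"
proof -
  interpret s: vector_space s by fact
  interpret t: vector_space t by fact
  show ?thesis by unfold_locales (rule assms(3,4))+
qed

lemma Vector_Spaces_linearD: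
  assumes "Vector_Spaces.linear s t f"
  shows "f (x + y) = f x + f y" "f (s c x) = t c (f x)"
proof -
  interpret Vector_Spaces.linear s t f by fact
  show "f (x + y) = f x + f y" "f (s c x) = t c (f x)" by (rule add, rule scale)
qed

locale compatible_decomposition =
  fixes G :: "('k::real_or_complex, 'g::real_normed_vector, 'h::real_normed_vector) quasi_bialgebra"
    and L :: "('k, 'l::real_normed_vector, 'q::real_normed_vector) dual_pair"
    and i :: "'l \<Rightarrow> 'g"
    and M :: "'g set"
  assumes qb: "lie_quasi_bialgebra G"
    and red: "reductive_decomposition G L i M"
    and comp: "canonically_compatible G i M"
begin

abbreviation "pr \<equiv> proj_l i M"
abbreviation "s \<equiv> s_map G L i M"
abbreviation "rs \<equiv> restr G L i"
abbreviation "G' \<equiv> sub_quasi_bialgebra G L i M"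
abbreviation "db \<equiv> double_bracket G"
abbreviation "db' \<equiv> double_bracket G'"
abbreviation "\<phi> \<equiv> associator G"
abbreviation "pG \<equiv> pairing G"
abbreviation "pL \<equiv> pairing L"
abbreviation "lcan \<equiv> l_can G L i M"
abbreviation "gst \<equiv> gstar G L i M"
abbreviation "\<Phi> \<equiv> phi G L i M"
abbreviation "anc \<equiv> anchor G L i M"
abbreviation "Nbr \<equiv> N_bracket G L i M"
abbreviation "\<theta> \<equiv> theta G L i M"
abbreviation "\<psi> \<equiv> psi G L i M"

sublocale dG: duality G using qb by unfold_locales (simp add: lie_quasi_bialgebra_def)
sublocale dL: duality L using red by unfold_locales (simp add: reductive_decomposition_def)

lemma G'_sel [simp]: "scal G' = scal L" "coscal G' = coscal L" "pairing G' = pL"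
  "bracket G' z w = inv i (bracket G (i z) (i w))" "cobracket G' z \<alpha> = 0"
  "associator G' \<alpha> \<beta> \<gamma> = \<phi> (s \<alpha>) (s \<beta>) (s \<gamma>)"
  by (simp_all add: sub_quasi_bialgebra_def)

lemma duality_sub: "duality G'"
proof
  show "is_dual_pair G'" using dL.dual by (simp add: is_dual_pair_def)
qed

lemma i_linear: "i (x + y) = i x + i y" "i (scal L c x) = scal G c (i x)"
  using red Vector_Spaces_linearD[of "scal L" "scal G" i] by (auto simp: reductive_decomposition_def)

lemma real_linear_i: "linear i"
  by (rule dL.linear_of_additive[where s="scal G"]) (simp_all add: i_linear dG.V.scale_of_real)

lemma i_inj: "inj i" using red by (simp add: reductive_decomposition_def)

lemma i_eq [simp]: "i x = i y \<longleftrightarrow> x = y" using i_inj by (simp add: inj_eq)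

lemma inv_i [simp]: "inv i (i z) = z" using i_inj by (simp add: inv_f_f)

lemma i_0 [simp]: "i 0 = 0" by (rule linear_0[OF real_linear_i])

lemma M_sub: "0 \<in> M" "x \<in> M \<Longrightarrow> y \<in> M \<Longrightarrow> x + y \<in> M" "x \<in> M \<Longrightarrow> scal G c x \<in> M" "x \<in> M \<Longrightarrow> - x \<in> M"
  "x \<in> M \<Longrightarrow> y \<in> M \<Longrightarrow> x - y \<in> M"
proof -
  have sub: "module.subspace (scal G) M" using red by (simp add: reductive_decomposition_def)
  show "0 \<in> M" "x \<in> M \<Longrightarrow> y \<in> M \<Longrightarrow> x + y \<in> M" "x \<in> M \<Longrightarrow> scal G c x \<in> M" "x \<in> M \<Longrightarrow> - x \<in> M"
    "x \<in> M \<Longrightarrow> y \<in> M \<Longrightarrow> x - y \<in> M"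
    using dG.V.subspace_0[OF sub] dG.V.subspace_add[OF sub] dG.V.subspace_scale[OF sub]
      dG.V.subspace_neg[OF sub] dG.V.subspace_diff[OF sub] by blast+
qed

lemma i_in_M: "i z \<in> M \<Longrightarrow> z = 0"
proof -
  assume "i z \<in> M"
  then have "i z \<in> range i \<inter> M" by blast
  moreover have "range i \<inter> M = {0}" using red unfolding reductive_decomposition_def by blast
  ultimately have "i z = i 0" by simp
  then show "z = 0" by (simp only: i_eq)
qed

lemma pr_unique: assumes "x - i z \<in> M" shows "pr x = z"
proof -
  have "z' = z" if "x - i z' \<in> M" for z'
  proof -
    have "i (z - z') \<in> M" using M_sub(5)[OF that assms] by (simp add: linear_diff[OF real_linear_i])
    then show ?thesis using i_in_M by force
  qed
  then show ?thesis unfolding proj_l_def using assms by blast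
qed

lemma pr_spec: "x - i (pr x) \<in> M"
proof -
  obtain z m where "m \<in> M" "x = i z + m" using red unfolding reductive_decomposition_def by blast
  then have "x - i z \<in> M" by simp
  then show ?thesis using pr_unique[of x z] by simp
qed

lemma pr_i [simp]: "pr (i z) = z" by (rule pr_unique) (simp add: M_sub)

lemma pr_eq_0: "pr x = 0 \<longleftrightarrow> x \<in> M"
  using pr_spec[of x] pr_unique[of x 0] by auto

lemma pr_linear: "pr (x + y) = pr x + pr y" "pr (scal G c x) = scal L c (pr x)"
proof -
  show "pr (x + y) = pr x + pr y"
    using M_sub(2)[OF pr_spec[of x] pr_spec[of y]] by (intro pr_unique) (simp add: i_linear algebra_simps)
  show "pr (scal G c x) = scal L c (pr x)"
    using M_sub(3)[OF pr_spec[of x], of c] by (intro pr_unique) (simp add: i_linear dG.V.scale_right_diff_distrib)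
qed

lemma real_linear_pr: "linear pr"
  by (rule dG.linear_of_additive[where s="scal L"]) (simp_all add: pr_linear dL.V.scale_of_real)

lemma bracket_linear: "bracket G (x + y) z = bracket G x z + bracket G y z"
  "bracket G x (y + z) = bracket G x y + bracket G x z"
  "bracket G (scal G c x) y = scal G c (bracket G x y)" "bracket G x (scal G c y) = scal G c (bracket G x y)"
proof -
  have lb: "lie_bracket (scal G) (bracket G)" using qb by (simp add: lie_quasi_bialgebra_def)
  have l: "Vector_Spaces.linear (scal G) (scal G) (bracket G x)" for x
    using lb by (simp add: lie_bracket_def)
  have r: "Vector_Spaces.linear (scal G) (scal G) (\<lambda>x. bracket G x y)" for y
    using lb by (simp add: lie_bracket_def)
  show "bracket G (x + y) z = bracket G x z + bracket G y z" "bracket G x (y + z) = bracket G x y + bracket G x z"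
    "bracket G (scal G c x) y = scal G c (bracket G x y)" "bracket G x (scal G c y) = scal G c (bracket G x y)"
    using Vector_Spaces_linearD[OF l] Vector_Spaces_linearD[OF r] by blast+
qed

lemma i_bracket: "i (bracket G' z w) = bracket G (i z) (i w)"
  using red by (auto simp: reductive_decomposition_def intro!: f_inv_into_f)

lemma bracket_i_M: "m \<in> M \<Longrightarrow> bracket G (i z) m \<in> M"
  using red by (simp add: reductive_decomposition_def)

lemma bracket_skew: "bracket G x y = - bracket G y x"
proof -
  have z: "bracket G x x = 0" for x using qb by (simp add: lie_quasi_bialgebra_def lie_bracket_def)
  have "bracket G x y + bracket G y x = 0"
    using z[of "x + y"] z[of x] z[of y] unfolding bracket_linear by (simp add: add.commute)
  then show ?thesis by (simp add: eq_neg_iff_add_eq_0)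
qed

lemma s_pair: "pG (s \<alpha>) x = pL \<alpha> (pr x)"
  unfolding s_map_def by (rule transpose_map[OF dG.duality_axioms dL.duality_axioms]) (simp_all add: pr_linear)

lemma rs_pair: "pL (rs \<xi>) z = pG \<xi> (i z)"
  unfolding restr_def by (rule transpose_map[OF dL.duality_axioms dG.duality_axioms]) (simp_all add: i_linear)

lemma rs_s [simp]: "rs (s \<alpha>) = \<alpha>"
  by (rule dL.covector_eqI) (simp add: rs_pair s_pair)

lemma s_linear: "s (\<alpha> + \<beta>) = s \<alpha> + s \<beta>" "s (coscal L c \<alpha>) = coscal G c (s \<alpha>)"
  by (rule dG.covector_eqI, simp add: s_pair dG.pair.add_left dL.pair.add_left dG.pairing_coscal dL.pairing_coscal)+

lemma rs_linear: "rs (\<xi> + \<eta>) = rs \<xi> + rs \<eta>" "rs (coscal G c \<xi>) = coscal L c (rs \<xi>)"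
  by (rule dL.covector_eqI, simp add: rs_pair dG.pair.add_left dL.pair.add_left dG.pairing_coscal dL.pairing_coscal)+

lemma linear_covectors: "linear s" "linear rs"
proof -
  show "linear s"
    by (rule linearI) (rule s_linear, metis s_linear(2) dL.V'.scale_of_real dG.V'.scale_of_real)
  show "linear rs"
    by (rule linearI) (rule rs_linear, metis rs_linear(2) dL.V'.scale_of_real dG.V'.scale_of_real)
qed

lemma s_0 [simp]: "s 0 = 0" and rs_0 [simp]: "rs 0 = 0"
  by (rule linear_0[OF linear_covectors(1)], rule linear_0[OF linear_covectors(2)])

lemma s_eq [simp]: "s \<alpha> = s \<beta> \<longleftrightarrow> \<alpha> = \<beta>"
  by (metis rs_s)

lemma s_annihilates: "m \<in> M \<Longrightarrow> pG (s \<alpha>) m = 0"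
  by (simp add: s_pair pr_eq_0[symmetric] dL.pair.zero_right)

lemma in_M_iff: "x \<in> M \<longleftrightarrow> (\<forall>\<alpha>. pG (s \<alpha>) x = 0)"
  using dL.vectors_separated[of "pr x"] by (auto simp: s_annihilates s_pair pr_eq_0[symmetric] dL.pair.zero_right)

lemma rs_eq_0: "rs \<xi> = 0 \<longleftrightarrow> (\<forall>z. pG \<xi> (i z) = 0)"
  by (metis rs_pair dL.covector_eqI dL.pair.zero_left)

lemma associator_form:
  obtains N :: nat and a b c where
    "\<phi> = alternation (\<lambda>\<xi> \<eta> \<zeta>. \<Sum>j<N. pG \<xi> (a j) * pG \<eta> (b j) * pG \<zeta> (c j))"
    "\<And>j. j < N \<Longrightarrow> (a j, b j, c j) \<in> range i \<times> range i \<times> range i \<union> range i \<times> M \<times> M \<union> M \<times> M \<times> M"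
  using comp unfolding canonically_compatible_def alt_tensors_def by blast

lemma \<phi>_linear: "\<phi> \<xi> \<eta> (\<zeta> + \<zeta>') = \<phi> \<xi> \<eta> \<zeta> + \<phi> \<xi> \<eta> \<zeta>'" "\<phi> \<xi> \<eta> (coscal G c \<zeta>) = c * \<phi> \<xi> \<eta> \<zeta>"
proof -
  obtain N :: nat and a b c' where
    f: "\<phi> = alternation (\<lambda>\<xi> \<eta> \<zeta>. \<Sum>j<N. pG \<xi> (a j) * pG \<eta> (b j) * pG \<zeta> (c' j))"
    by (rule associator_form) (rule that)
  show "\<phi> \<xi> \<eta> (\<zeta> + \<zeta>') = \<phi> \<xi> \<eta> \<zeta> + \<phi> \<xi> \<eta> \<zeta>'"
    unfolding f alternation_def dG.pair.add_left by (simp add: algebra_simps sum.distrib)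
  show "\<phi> \<xi> \<eta> (coscal G c \<zeta>) = c * \<phi> \<xi> \<eta> \<zeta>"
    unfolding f alternation_def dG.pairing_coscal by (simp add: algebra_simps sum_distrib_left)
qed

lemma \<phi>_cyclic: "\<phi> \<eta> \<zeta> \<xi> = \<phi> \<xi> \<eta> \<zeta>"
proof -
  obtain N :: nat and a b c' where
    f: "\<phi> = alternation (\<lambda>\<xi> \<eta> \<zeta>. \<Sum>j<N. pG \<xi> (a j) * pG \<eta> (b j) * pG \<zeta> (c' j))"
    by (rule associator_form) (rule that)
  show ?thesis unfolding f by (rule alternation_cyclic)
qed

text \<open>Each elementary tensor has either no factor or at least two factors in
  \<open>\<mm>\<close>. In the first case \<open>\<xi>\<close> meets a factor in
  \<open>\<ll>\<close>; in the second one of the two \<open>s\<close> covectors meets a factor in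
  \<open>\<mm>\<close>.\<close>

lemma \<phi>_vanish: assumes "rs \<xi> = 0" shows "\<phi> (s \<alpha>) (s \<beta>) \<xi> = 0"
proof -
  obtain N :: nat and a b c where
    f: "\<phi> = alternation (\<lambda>\<xi> \<eta> \<zeta>. \<Sum>j<N. pG \<xi> (a j) * pG \<eta> (b j) * pG \<zeta> (c j))"
    and abc: "\<And>j. j < N \<Longrightarrow> (a j, b j, c j) \<in> range i \<times> range i \<times> range i \<union> range i \<times> M \<times> M \<union> M \<times> M \<times> M"
    using that by (rule associator_form)
  have z: "pG \<xi> (i z) = 0" for z using assms rs_eq_0 by blast
  have m: "pG (s \<gamma>) x = 0" if "x \<in> M" for \<gamma> x using that by (rule s_annihilates)
  have z1: "pG \<xi>1 (a j) * pG \<xi>2 (b j) * pG \<xi>3 (c j) = 0"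
    if "j < N" "(\<xi>1, \<xi>2, \<xi>3) \<in> {(\<xi>, s \<alpha>, s \<beta>), (\<xi>, s \<beta>, s \<alpha>), (s \<alpha>, \<xi>, s \<beta>), (s \<beta>, \<xi>, s \<alpha>), (s \<alpha>, s \<beta>, \<xi>), (s \<beta>, s \<alpha>, \<xi>)}"
    for j \<xi>1 \<xi>2 \<xi>3
    using abc[OF that(1)] that(2) by (auto simp: z m)
  have "(\<Sum>j<N. pG \<xi>1 (a j) * pG \<xi>2 (b j) * pG \<xi>3 (c j)) = 0"
    if "(\<xi>1, \<xi>2, \<xi>3) \<in> {(\<xi>, s \<alpha>, s \<beta>), (\<xi>, s \<beta>, s \<alpha>), (s \<alpha>, \<xi>, s \<beta>), (s \<beta>, \<xi>, s \<alpha>), (s \<alpha>, s \<beta>, \<xi>), (s \<beta>, s \<alpha>, \<xi>)}"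
    for \<xi>1 \<xi>2 \<xi>3
    by (rule sum.neutral, rule ballI, rule z1[OF _ that]) simp
  then show ?thesis unfolding f alternation_def by simp
qed

lemma \<phi>_vanish': assumes "rs \<xi> = 0" shows "\<phi> (s \<alpha>) \<xi> (s \<beta>) = 0"
  using \<phi>_vanish[OF assms, of \<beta> \<alpha>] \<phi>_cyclic[of "s \<beta>" "s \<alpha>" \<xi>] \<phi>_cyclic by metis

lemma \<phi>_restrict: "\<phi> (s \<alpha>) (s \<beta>) \<xi> = \<phi> (s \<alpha>) (s \<beta>) (s (rs \<xi>))"
proof -
  have "rs (\<xi> - s (rs \<xi>)) = 0" by (simp add: linear_diff[OF linear_covectors(2)])
  from \<phi>_vanish[OF this, of \<alpha> \<beta>] \<phi>_linear(1)[of "s \<alpha>" "s \<beta>" "\<xi> - s (rs \<xi>)" "s (rs \<xi>)"]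
  show ?thesis by simp
qed

lemma coad_pair: "pG (coad G x \<xi>) y = pG \<xi> (bracket G x y)"
  unfolding coad_def by (rule transpose_map[OF dG.duality_axioms dG.duality_axioms]) (simp_all add: bracket_linear)

lemma bracket'_linear: "bracket G' (x + y) z = bracket G' x z + bracket G' y z"
  "bracket G' x (y + z) = bracket G' x y + bracket G' x z"
  "bracket G' (scal L c x) y = scal L c (bracket G' x y)" "bracket G' x (scal L c y) = scal L c (bracket G' x y)"
  by (rule i_inj[THEN injD], simp add: i_bracket i_linear bracket_linear del: G'_sel(4) i_eq)+

lemma bracket'_skew: "bracket G' x y = - bracket G' y x"
  by (rule i_inj[THEN injD])
    (simp only: i_bracket linear_neg[OF real_linear_i] bracket_skew[of "i x"])

lemma coad'_pair: "pL (coad G' z \<alpha>) w = pL \<alpha> (bracket G' z w)"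
  using transpose_map[OF duality_sub duality_sub, of "bracket G' z" \<alpha> w] bracket'_linear
  by (simp add: coad_def)

lemma cobracket_linear: "cobracket G (x + y) \<xi> = cobracket G x \<xi> + cobracket G y \<xi>"
  "cobracket G (scal G c x) \<xi> = scal G c (cobracket G x \<xi>)"
proof -
  have "Vector_Spaces.linear (scal G) (scal G) (\<lambda>x. cobracket G x \<xi>)" for \<xi>
    using qb by (simp add: lie_quasi_bialgebra_def)
  from Vector_Spaces_linearD[OF this]
  show "cobracket G (x + y) \<xi> = cobracket G x \<xi> + cobracket G y \<xi>"
    "cobracket G (scal G c x) \<xi> = scal G c (cobracket G x \<xi>)" by blast+
qed

lemma cobracket_skew: "pG \<xi> (cobracket G x \<eta>) = - pG \<eta> (cobracket G x \<xi>)"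
  using qb unfolding lie_quasi_bialgebra_def by blast

lemma covcob_pair: "pG (covector_cobracket G \<xi> \<eta>) x = pG \<xi> (cobracket G x \<eta>)"
  unfolding covector_cobracket_def
  by (rule dG.covector_of) (simp_all add: cobracket_linear dG.pair.add_right dG.pairing_scal)

lemma covcob_skew: "covector_cobracket G \<xi> \<eta> = - covector_cobracket G \<eta> \<xi>"
  by (rule dG.covector_eqI) (simp add: covcob_pair dG.pair.minus_left cobracket_skew[of \<xi>])

lemma cobracket_i: "cobracket G (i z) \<eta> = 0"
  using comp by (simp add: canonically_compatible_def)

lemma cobracket_ss: "pG (s \<alpha>) (cobracket G x (s \<beta>)) = 0"
  using comp s_annihilates unfolding canonically_compatible_def annihilator_def by blast

lemma covcob_ss: "covector_cobracket G (s \<alpha>) (s \<beta>) = 0"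
  by (rule dG.covector_eqI) (simp add: covcob_pair cobracket_ss dG.pair.zero_left)

lemma covcob': "covector_cobracket G' \<alpha> \<beta> = 0"
proof -
  interpret d: duality G' by (rule duality_sub)
  have "pL (covector_cobracket G' \<alpha> \<beta>) x = 0" for x
    using d.covector_of[of "\<lambda>x. pairing G' \<alpha> (cobracket G' x \<beta>)" x]
    by (simp add: covector_cobracket_def dL.pair.zero_right)
  then show ?thesis by (intro dL.covector_eqI) (simp add: dL.pair.zero_left)
qed

lemma vec_pair: "pG \<xi> (vector_of G (\<phi> \<eta> \<zeta>)) = \<phi> \<eta> \<zeta> \<xi>"
  by (rule dG.vector_of) (simp_all add: \<phi>_linear)

lemma vec'_pair: "pL \<gamma> (vector_of G' (associator G' \<alpha> \<beta>)) = \<phi> (s \<alpha>) (s \<beta>) (s \<gamma>)"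
proof -
  interpret d: duality G' by (rule duality_sub)
  show ?thesis using d.vector_of[of "associator G' \<alpha> \<beta>" \<gamma>] by (simp add: s_linear \<phi>_linear)
qed

lemma i_vec': "i (vector_of G' (associator G' \<alpha> \<beta>)) = vector_of G (\<phi> (s \<alpha>) (s \<beta>))"
  by (rule dG.vector_eqI) (simp add: vec_pair rs_pair[symmetric] vec'_pair \<phi>_restrict[symmetric] del: G'_sel)

text \<open>Since \<open>\<mm>\<close> is stable under \<open>\<ll>\<close>, the projection to
  \<open>\<ll>\<close> intertwines the actions of \<open>\<ll>\<close>, and \<open>s\<close> is its
  transpose.\<close>

lemma s_coad': "s (coad G' z \<alpha>) = coad G (i z) (s \<alpha>)"
proof (rule dG.covector_eqI)
  fix x
  have "bracket G (i z) x - i (bracket G' z (pr x)) = bracket G (i z) (x - i (pr x))"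
    using bracket_linear(2)[of "i z" "x - i (pr x)" "i (pr x)"] by (simp add: i_bracket del: G'_sel)
  then have "pr (bracket G (i z) x) = bracket G' z (pr x)"
    using bracket_i_M[OF pr_spec] by (intro pr_unique) simp
  then show "pG (s (coad G' z \<alpha>)) x = pG (coad G (i z) (s \<alpha>)) x"
    by (simp add: s_pair coad'_pair coad_pair del: G'_sel)
qed

section \<open>The double of the subalgebra inside the canonical double\<close>

definition j :: "'l \<times> 'q \<Rightarrow> 'g \<times> 'h" where "j x = (i (fst x), s (snd x))"

lemma db_eq: "db x y =
    (bracket G (fst x) (fst y) + cobracket G (fst x) (snd y) - cobracket G (fst y) (snd x) + vector_of G (\<phi> (snd x) (snd y)),
     coad G (fst y) (snd x) - coad G (fst x) (snd y) + covector_cobracket G (snd y) (snd x))"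
  by (simp add: double_bracket_def case_prod_unfold)

lemma db'_eq: "db' x y =
    (bracket G' (fst x) (fst y) + vector_of G' (associator G' (snd x) (snd y)),
     coad G' (fst y) (snd x) - coad G' (fst x) (snd y))"
  by (simp add: double_bracket_def case_prod_unfold covcob' del: G'_sel(4,6))

text \<open>Compatibility removes the terms leaving the image: \<open>\<varpi>\<close> vanishes on
  \<open>\<ll>\<close>, its pairing with two covectors in \<open>\<mm>\<^sup>\<bottom>\<close> is
  zero, and the associator of two \<open>s\<close> covectors lies in \<open>\<ll>\<close>. The
  coadjoint terms agree by \<open>s_coad'\<close>.\<close>

lemma j_db: "j (db' x y) = db (j x) (j y)"
  unfolding db_eq db'_eq j_def
  by (simp add: i_linear i_bracket i_vec' cobracket_i covcob_ss s_coad' linear_diff[OF linear_covectors(1)] del: G'_sel)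

lemma j_linear: "j (x + y) = j x + j y" "j (r *\<^sub>R x) = r *\<^sub>R j x"
  by (simp_all add: j_def i_linear s_linear linear_cmul[OF real_linear_i] linear_cmul[OF linear_covectors(1)])

lemma linear_j: "linear j" by (rule linearI) (rule j_linear)+

lemma j_inj: "j x = j y \<Longrightarrow> x = y" by (simp add: j_def prod_eq_iff)

lemma j_scale: "j (pair_scale (scal L) (coscal L) c x) = pair_scale (scal G) (coscal G) c (j x)"
  by (cases x) (simp add: j_def pair_scale_def i_linear s_linear)

lemma db_lie: "lie_bracket (pair_scale (scal G) (coscal G)) db"
  using qb by (simp add: lie_quasi_bialgebra_def)

lemma db_linear: "db (x + y) z = db x z + db y z" "db x (y + z) = db x y + db x z"
  "db (pair_scale (scal G) (coscal G) c x) y = pair_scale (scal G) (coscal G) c (db x y)"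
  "db x (pair_scale (scal G) (coscal G) c y) = pair_scale (scal G) (coscal G) c (db x y)"
proof -
  have l: "Vector_Spaces.linear (pair_scale (scal G) (coscal G)) (pair_scale (scal G) (coscal G)) (db x)" for x
    using db_lie unfolding lie_bracket_def by blast
  have r: "Vector_Spaces.linear (pair_scale (scal G) (coscal G)) (pair_scale (scal G) (coscal G)) (\<lambda>x. db x y)" for y
    using db_lie unfolding lie_bracket_def by blast
  show "db (x + y) z = db x z + db y z" "db x (y + z) = db x y + db x z"
    "db (pair_scale (scal G) (coscal G) c x) y = pair_scale (scal G) (coscal G) c (db x y)"
    "db x (pair_scale (scal G) (coscal G) c y) = pair_scale (scal G) (coscal G) c (db x y)"
    using Vector_Spaces_linearD[OF l] Vector_Spaces_linearD[OF r] by blast+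
qed

lemma pair_scale_of_real: "pair_scale (scal G) (coscal G) (of_real r) x = r *\<^sub>R x"
  "pair_scale (scal L) (coscal L) (of_real r) y = r *\<^sub>R y"
  "pair_scale (scal L) (coscal G) (of_real r) z = r *\<^sub>R z"
  by (simp_all add: pair_scale_def prod_eq_iff dG.V.scale_of_real dG.V'.scale_of_real dL.V.scale_of_real dL.V'.scale_of_real)

lemma db_real_linear: "linear (db x)" "linear (\<lambda>x. db x y)"
proof -
  show "linear (db x)"
    by (rule linearI) (rule db_linear, metis db_linear(4) pair_scale_of_real(1))
  show "linear (\<lambda>x. db x y)"
    by (rule linearI) (rule db_linear, metis db_linear(3) pair_scale_of_real(1))
qed

lemma fin_dim_GL: "fin_dim TYPE('g \<times> 'h)" "fin_dim TYPE('l \<times> 'q)"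
  by (rule fin_dim_prod dG.fin_dim_V dG.fin_dim_V' dL.fin_dim_V dL.fin_dim_V')+

sublocale D: normed_lie db
proof (rule normed_lie.intro)
  show "fin_dim TYPE('g \<times> 'h)" by (rule fin_dim_GL)
  show "bounded_bilinear db" by (rule fin_dim_bounded_bilinear[OF fin_dim_GL(1) fin_dim_GL(1) db_real_linear])
  show "db x x = 0" for x
    using db_lie unfolding lie_bracket_def by blast
  show "db x (db y z) + db y (db z x) + db z (db x y) = 0" for x y z
    using db_lie unfolding lie_bracket_def by blast
qed

definition B :: "'l \<times> 'q \<Rightarrow> 'l \<times> 'q \<Rightarrow> 'k" where
  "B x y = pL (snd x) (fst y) + pL (snd y) (fst x)"

lemma db'_linear: "db' (x + y) z = db' x z + db' y z" "db' x (y + z) = db' x y + db' x z"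
  "db' (r *\<^sub>R x) z = r *\<^sub>R db' x z" "db' x (r *\<^sub>R z) = r *\<^sub>R db' x z"
  "db' x (pair_scale (scal L) (coscal L) c y) = pair_scale (scal L) (coscal L) c (db' x y)"
  by (rule j_inj, simp only: j_db j_linear db_linear linear_cmul[OF db_real_linear(1)] linear_cmul[OF db_real_linear(2)] j_scale)+

text \<open>The Lie axioms are pulled back along the injective \<open>j\<close>. Invariance of the
  canonical pairing comes from the definition of \<open>coad\<close>, the skewness of the bracket
  and the cyclic symmetry of the associator.\<close>

sublocale D': normed_quadratic_lie db' B
proof (intro normed_quadratic_lie.intro normed_lie.intro normed_quadratic_lie_axioms.intro)
  show "fin_dim TYPE('l \<times> 'q)" by (rule fin_dim_GL)
  show "bounded_bilinear db'"
    by (rule fin_dim_bounded_bilinear[OF fin_dim_GL(2) fin_dim_GL(2)]; rule linearI; rule db'_linear)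
  have j0: "j 0 = 0" by (simp add: j_def zero_prod_def)
  show "db' x x = 0" for x
    by (rule j_inj, simp only: j_db D.alt j0)
  show "db' x (db' y z) + db' y (db' z x) + db' z (db' x y) = 0" for x y z
    by (rule j_inj, simp only: j_db j_linear D.jacobi j0)
  show "bounded_bilinear B"
    by (rule fin_dim_bounded_bilinear[OF fin_dim_GL(2) fin_dim_GL(2)])
      (auto intro!: linearI simp: B_def dL.pair.add_left dL.pair.add_right dL.pair.scaleR_left dL.pair.scaleR_right
        scaleR_add_right)
  show "B x y = B y x" for x y by (simp add: B_def)
  show "B (db' x y) z = B x (db' y z)" for x y z
    unfolding B_def db'_eq
    by (simp add: dL.pair.add_right dL.pair.diff_left coad'_pair vec'_pair bracket'_skew[of "fst y" "fst x"]
        bracket'_skew[of "fst z" "fst x"] bracket'_skew[of "fst z" "fst y"] dL.pair.minus_right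
        \<phi>_cyclic[of "s (snd y)" "s (snd z)" "s (snd x)"] del: G'_sel)
qed

end

section \<open>Identities in the double of the subalgebra\<close>

lemma eseries_parity:
  fixes f :: "nat \<Rightarrow> 'd::real_normed_vector"
  assumes fd: "fin_dim TYPE('d)" and f: "exp_bounded f" and c: "\<And>n. f n \<noteq> 0 \<Longrightarrow> (-1) ^ n = c"
  shows "eseries j f (- t) = ((-1) ^ j * c) *\<^sub>R eseries j f t"
proof -
  have "((- t) ^ (n + j) / fact (n + j)) *\<^sub>R f n = ((-1) ^ j * c) *\<^sub>R (t ^ (n + j) / fact (n + j)) *\<^sub>R f n" for n
  proof (cases "f n = 0")
    case False
    then show ?thesis by (simp add: c[symmetric] power_minus[of t] power_add)
  qed simp
  then show ?thesis unfolding eseries_def suminf_scaleR_right[OF eseries_summable[OF fd f]]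
    by (intro suminf_cong) simp
qed

text \<open>In the applications \<open>R\<close> projects to \<open>\<ll>\<close> or to
  \<open>\<ll>\<^sup>*\<close>. Since powers of \<open>A\<close> alternate between the two, it
  deletes the terms of the wrong parity, and hyperbolic series become parts of exponential
  ones.\<close>

lemma fps_op_eseries:
  fixes A :: "'d::real_normed_vector \<Rightarrow> 'd"
  assumes fd: "fin_dim TYPE('d)" and A: "bounded_linear A" and R: "bounded_linear R"
    and F: "\<And>n. fps_nth F n *\<^sub>R (A ^^ n) x = R ((1 / fact (n + k)) *\<^sub>R (A ^^ n) x)"
  shows "(\<lambda>n. fps_nth F n *\<^sub>R (A ^^ n) x) sums R (eseries k (\<lambda>n. (A ^^ n) x) 1)"
    "fps_op F A x = R (eseries k (\<lambda>n. (A ^^ n) x) 1)"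
proof -
  have "(\<lambda>n. (1 ^ (n + k) / fact (n + k)) *\<^sub>R (A ^^ n) x) sums eseries k (\<lambda>n. (A ^^ n) x) 1"
    unfolding eseries_def by (intro summable_sums eseries_summable fd exp_bounded_power A)
  from bounded_linear.sums[OF R this]
  show "(\<lambda>n. fps_nth F n *\<^sub>R (A ^^ n) x) sums R (eseries k (\<lambda>n. (A ^^ n) x) 1)" unfolding F by simp
  then show "fps_op F A x = R (eseries k (\<lambda>n. (A ^^ n) x) 1)" by (simp add: fps_op_def sums_iff)
qed

text \<open>The second line shows the numerator of \<open>F\<close> as the difference of the odd
  parts of the series of \<open>W\<close> and \<open>T\<close>; this is the origin of
  \<open>W - T\<close> in the \<open>\<ell>\<close>-matrix.\<close>

lemma theta_series_nth:
  "fps_nth ((sinh_fps - fps_X) / fps_X ^ 2) n = (if odd n then 1 / fact (n + 2) else 0)"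
  "fps_nth ((fps_X * cosh_fps - sinh_fps) / fps_X ^ 2) n = (if odd n then 1 / fact (n + 1) - 1 / fact (n + 2) else 0)"
  by (simp_all add: sinh_fps_def cosh_fps_def fps_X_nth del: fact_Suc)

context compatible_decomposition begin

abbreviation "bl \<equiv> bracket G'"
abbreviation "W1 p \<alpha> \<equiv> D'.W (0, p) 1 (0, \<alpha>)"
abbreviation "T1 p \<alpha> \<equiv> D'.T (0, p) 1 (0, \<alpha>)"
abbreviation "DW1 p \<gamma> \<beta> \<equiv> D'.DW (0, p) (0, \<gamma>) 1 (0, \<beta>)"
abbreviation "DT1 p \<gamma> \<beta> \<equiv> D'.DT (0, p) (0, \<gamma>) 1 (0, \<beta>)"
abbreviation "vc \<alpha> \<beta> \<equiv> vector_of G' (associator G' \<alpha> \<beta>)"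

lemma bl_real_linear: "linear (bl x)" "linear (\<lambda>x. bl x y)"
proof -
  show "linear (bl x)"
    by (rule dL.linear_of_additive[where s="scal L"]) (simp_all only: bracket'_linear dL.V.scale_of_real)
  show "linear (\<lambda>x. bl x y)"
    by (rule dL.linear_of_additive[where s="scal L"]) (simp_all only: bracket'_linear dL.V.scale_of_real)
qed

sublocale bl: bounded_bilinear bl
  by (rule fin_dim_bounded_bilinear[OF dL.fin_dim_V dL.fin_dim_V bl_real_linear])

lemma coad'_0: "coad G' 0 \<alpha> = 0"
  by (rule dL.covector_eqI) (simp add: coad'_pair bl.zero_left dL.pair.zero_right dL.pair.zero_left del: G'_sel)

lemma coad'_0': "coad G' z 0 = 0"
  by (rule dL.covector_eqI) (simp add: coad'_pair dL.pair.zero_left del: G'_sel)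

lemma \<phi>_0: "\<phi> \<xi> \<eta> 0 = 0" using \<phi>_linear(1)[of \<xi> \<eta> 0 0] by simp

lemma vc_0: "vc \<alpha> 0 = 0" "vc 0 \<alpha> = 0"
proof -
  show "vc \<alpha> 0 = 0"
    by (rule dL.vector_eqI)
      (simp add: vec'_pair \<phi>_cyclic[of "s \<alpha>" 0] \<phi>_0 dL.pair.zero_right del: G'_sel)
  have "\<phi> 0 \<xi> \<eta> = 0" for \<xi> \<eta> using \<phi>_cyclic[of \<xi> \<eta> 0] \<phi>_0 by simp
  then show "vc 0 \<alpha> = 0"
    by (intro dL.vector_eqI) (simp add: vec'_pair dL.pair.zero_right del: G'_sel)
qed

lemma db'_covector: "db' (0, \<gamma>) x = (vc \<gamma> (snd x), coad G' (fst x) \<gamma>)"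
  by (simp add: db'_eq bl.zero_left coad'_0 del: G'_sel)

lemma db'_vector: "db' (z, 0) x = (bl z (fst x), - coad G' z (snd x))"
  by (simp add: db'_eq vc_0 coad'_0' del: G'_sel)

text \<open>Covector parts of \<open>ad_W\<close>, \<open>ad_T\<close> and of their derivatives.
  They express a covector part by the vector part of the next series in the list \<open>E\<close>,
  \<open>W\<close>, \<open>T\<close>, so that pairings reduce to brackets in
  \<open>\<ll>\<close>.\<close>

lemma snd_covector:
  shows E_snd: "pL (snd (D'.E (0, p) t (0, \<alpha>))) z =
      pL \<alpha> z + pL p (bl (fst (D'.W (0, p) t (0, \<alpha>))) z)"
    and W_snd: "pL (snd (D'.W (0, p) t (0, \<alpha>))) z =
      t *\<^sub>R pL \<alpha> z + pL p (bl (fst (D'.T (0, p) t (0, \<alpha>))) z)"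
    and DE_snd: "pL (snd (D'.DE (0, p) (0, \<gamma>) t x)) z =
      pL p (bl (fst (D'.DW (0, p) (0, \<gamma>) t x)) z) + pL \<gamma> (bl (fst (D'.W (0, p) t x)) z)"
    and DW_snd: "pL (snd (D'.DW (0, p) (0, \<gamma>) t x)) z =
      pL p (bl (fst (D'.DT (0, p) (0, \<gamma>) t x)) z) + pL \<gamma> (bl (fst (D'.T (0, p) t x)) z)"
proof -
  have "snd (D'.E (0, p) t (0, \<alpha>)) = \<alpha> + coad G' (fst (D'.W (0, p) t (0, \<alpha>))) p"
    using D'.ad_W[of "(0, p)" t "(0, \<alpha>)"] by (simp add: db'_covector prod_eq_iff)
  then show "pL (snd (D'.E (0, p) t (0, \<alpha>))) z =
      pL \<alpha> z + pL p (bl (fst (D'.W (0, p) t (0, \<alpha>))) z)"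
    by (simp add: dL.pair.add_left coad'_pair del: G'_sel)
  have "snd (D'.W (0, p) t (0, \<alpha>)) = t *\<^sub>R \<alpha> + coad G' (fst (D'.T (0, p) t (0, \<alpha>))) p"
    using D'.ad_T[of "(0, p)" t "(0, \<alpha>)"] by (simp add: db'_covector prod_eq_iff)
  then show "pL (snd (D'.W (0, p) t (0, \<alpha>))) z =
      t *\<^sub>R pL \<alpha> z + pL p (bl (fst (D'.T (0, p) t (0, \<alpha>))) z)"
    by (simp add: dL.pair.add_left coad'_pair dL.pair.scaleR_left del: G'_sel)
  show "pL (snd (D'.DE (0, p) (0, \<gamma>) t x)) z =
      pL p (bl (fst (D'.DW (0, p) (0, \<gamma>) t x)) z) + pL \<gamma> (bl (fst (D'.W (0, p) t x)) z)"
    unfolding D'.ad_DW[symmetric] by (simp add: db'_covector dL.pair.add_left coad'_pair del: G'_sel)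
  show "pL (snd (D'.DW (0, p) (0, \<gamma>) t x)) z =
      pL p (bl (fst (D'.DT (0, p) (0, \<gamma>) t x)) z) + pL \<gamma> (bl (fst (D'.T (0, p) t x)) z)"
    unfolding D'.ad_DT[symmetric] by (simp add: db'_covector dL.pair.add_left coad'_pair del: G'_sel)
qed

lemmas L_rules = D'.vd has_vector_derivative_add has_vector_derivative_diff has_vector_derivative_minus
  dL.pair.has_vector_derivative bl.has_vector_derivative
  bounded_linear.has_vector_derivative[OF bounded_linear_fst]
  bounded_linear.has_vector_derivative[OF bounded_linear_snd]
  has_vector_derivative_scaleR[OF DERIV_ident] has_vector_derivative_const

text \<open>By \<open>W_snd\<close> and \<open>DW_snd\<close> the covector parts are coadjoint terms
  of \<open>p\<close> and \<open>\<gamma>\<close>, and the resulting brackets cancel by skewness;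
  the proof performs the cancellation on \<open>t\<close>-derivatives. The identity trades the
  pairing with \<open>\<alpha>\<close>, as delivered by \<open>curvature_form\<close>, for pairings
  with series.\<close>

lemma T_DT_form:
  fixes p \<alpha> \<beta> \<gamma> :: 'q
  defines "u \<equiv> (0, \<alpha>)" and "v \<equiv> (0, \<beta>)" and "P \<equiv> (0, p)" and "g \<equiv> (0, \<gamma>)"
  shows "t *\<^sub>R pL \<alpha> (fst (D'.DT P g t v)) = pL \<gamma> (bl (fst (D'.T P t u)) (fst (D'.T P t v)))
    + pL (snd (D'.W P t u)) (fst (D'.DT P g t v)) + pL (snd (D'.DW P g t v)) (fst (D'.T P t u))"
proof -
  let ?f = "\<lambda>t. t *\<^sub>R pL \<alpha> (fst (D'.DT P g t v)) - pL \<gamma> (bl (fst (D'.T P t u)) (fst (D'.T P t v)))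
    - pL (snd (D'.W P t u)) (fst (D'.DT P g t v)) - pL (snd (D'.DW P g t v)) (fst (D'.T P t u))"
  have "?f t = (0 :: 'k)"
  proof (rule vector_derivative_eq_imp_eq[of ?f "\<lambda>t. 0"])
    fix t
    show "(?f has_vector_derivative 0) (at t)"
      by (rule has_vector_derivative_eq_rhs, (rule L_rules)+)
        (simp add: u_def v_def P_def g_def E_snd W_snd DE_snd DW_snd dL.pair.zero_left dL.pair.add_right
          bracket'_skew[of "fst (D'.DT (0, p) (0, \<gamma>) t (0, \<beta>))" "fst (D'.W (0, p) t (0, \<alpha>))"]
          bracket'_skew[of "fst (D'.DW (0, p) (0, \<gamma>) t (0, \<beta>))" "fst (D'.T (0, p) t (0, \<alpha>))"]
          bracket'_skew[of "fst (D'.T (0, p) t (0, \<beta>))" "fst (D'.W (0, p) t (0, \<alpha>))"]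
          bracket'_skew[of "fst (D'.W (0, p) t (0, \<beta>))" "fst (D'.T (0, p) t (0, \<alpha>))"]
          dL.pair.minus_right del: G'_sel)
  qed (auto simp: dL.pair.zero_left dL.pair.zero_right bl.zero_left simp del: G'_sel)
  then show ?thesis by (simp add: algebra_simps del: G'_sel)
qed

text \<open>The \<open>\<ll>\<close>-component of flatness, at the parameter \<open>t = 1\<close> and before the \<open>\<ell>\<close>-matrix is differentiated.\<close>

lemma flatness_form:
  fixes p \<alpha> \<beta> \<gamma> :: 'q
  defines "u \<equiv> (0, \<alpha>)" and "v \<equiv> (0, \<beta>)" and "P \<equiv> (0, p)" and "g \<equiv> (0, \<gamma>)"
  shows "pL (snd (D'.W P 1 u)) (fst (D'.DW P g 1 v) - fst (D'.DT P g 1 v))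
      + pL (snd (D'.DW P g 1 v)) (fst (D'.W P 1 u) - fst (D'.T P 1 u))
    = pL \<gamma> (bl (fst (D'.T P 1 u)) (fst (D'.T P 1 v)) - fst (D'.DT P u 1 v) + fst (D'.DT P v 1 u))"
proof -
  have "B (D'.DT P u 1 v - D'.DT P v 1 u) g + B (D'.W P 1 u) (D'.DW P g 1 v) = B (D'.DT P g 1 v) u"
    by (rule D'.curvature_form)
  moreover have "pL \<alpha> (fst (D'.DT P g 1 v)) = pL \<gamma> (bl (fst (D'.T P 1 u)) (fst (D'.T P 1 v)))
    + pL (snd (D'.W P 1 u)) (fst (D'.DT P g 1 v)) + pL (snd (D'.DW P g 1 v)) (fst (D'.T P 1 u))"
    using T_DT_form[of 1 \<alpha> p \<gamma> \<beta>] by (simp add: u_def v_def P_def g_def)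
  ultimately show ?thesis
    by (simp add: B_def u_def[symmetric] v_def[symmetric] g_def[symmetric])
      (simp add: u_def v_def g_def dL.pair.zero_right dL.pair.diff_right dL.pair.add_right algebra_simps)
qed

lemma power_parity:
  shows "even n \<Longrightarrow> fst ((db' (0, p) ^^ n) (0, \<alpha>)) = 0" "odd n \<Longrightarrow> snd ((db' (0, p) ^^ n) (0, \<alpha>)) = 0"
    "odd n \<Longrightarrow> fst ((db' (0, p) ^^ n) (z, 0)) = 0" "even n \<Longrightarrow> snd ((db' (0, p) ^^ n) (z, 0)) = 0"
proof (induction n)
  case (Suc n)
  show "even (Suc n) \<Longrightarrow> fst ((db' (0, p) ^^ Suc n) (0, \<alpha>)) = 0"
    "odd (Suc n) \<Longrightarrow> snd ((db' (0, p) ^^ Suc n) (0, \<alpha>)) = 0"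
    "odd (Suc n) \<Longrightarrow> fst ((db' (0, p) ^^ Suc n) (z, 0)) = 0"
    "even (Suc n) \<Longrightarrow> snd ((db' (0, p) ^^ Suc n) (z, 0)) = 0"
    unfolding funpow.simps o_apply db'_covector[of p "(db' (0, p) ^^ n) _"] using Suc
    by (auto simp: vc_0 coad'_0 simp del: G'_sel)
qed simp_all

lemma fst_eseries: "fst (eseries k (\<lambda>n. (db' P ^^ n) x) t) = eseries k (\<lambda>n. fst ((db' P ^^ n) x)) t"
  by (rule eseries_linear_image[OF fin_dim_GL(2) D'.pw bounded_linear_fst])

lemma snd_eseries: "snd (eseries k (\<lambda>n. (db' P ^^ n) x) t) = eseries k (\<lambda>n. snd ((db' P ^^ n) x)) t"
  by (rule eseries_linear_image[OF fin_dim_GL(2) D'.pw bounded_linear_snd])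

lemma W_neg: "D'.W (0, p) (- t) (0, \<alpha>) = (fst (D'.W (0, p) t (0, \<alpha>)), - snd (D'.W (0, p) t (0, \<alpha>)))"
proof -
  have 1: "eseries 1 (\<lambda>n. fst ((db' (0, p) ^^ n) (0, \<alpha>))) (- t) = ((-1) ^ 1 * -1) *\<^sub>R eseries 1 (\<lambda>n. fst ((db' (0, p) ^^ n) (0, \<alpha>))) t"
    by (rule eseries_parity[OF dL.fin_dim_V exp_bounded_linear[OF D'.pw bounded_linear_fst]])
      (use power_parity(1) in \<open>auto simp: minus_one_power_iff\<close>)
  have 2: "eseries 1 (\<lambda>n. snd ((db' (0, p) ^^ n) (0, \<alpha>))) (- t) = ((-1) ^ 1 * 1) *\<^sub>R eseries 1 (\<lambda>n. snd ((db' (0, p) ^^ n) (0, \<alpha>))) t"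
    by (rule eseries_parity[OF dL.fin_dim_V' exp_bounded_linear[OF D'.pw bounded_linear_snd]])
      (use power_parity(2) in \<open>auto simp: minus_one_power_iff\<close>)
  show ?thesis using 1 2 unfolding D'.W_def by (simp add: prod_eq_iff fst_eseries snd_eseries)
qed

text \<open>The isometry \<open>E P (- t)\<close> takes \<open>W P t\<close> to
  \<open>- W P (- t)\<close>, which is \<open>W P t\<close> with the sign of its
  \<open>\<ll>\<close>-part changed. That reverses the sign of \<open>B\<close>.\<close>

lemma W_isotropic: "B (D'.W (0, p) t (0, \<alpha>)) (D'.W (0, p) t (0, \<beta>)) = 0"
proof -
  let ?u = "D'.W (0, p) t (0, \<alpha>)" and ?v = "D'.W (0, p) t (0, \<beta>)"
  have "B ?u ?v = B (D'.E (0, p) (- t) ?u) (D'.E (0, p) (- t) ?v)" by (rule D'.E_isometry[symmetric])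
  also have "\<dots> = - B ?u ?v"
    by (simp add: D'.E_neg_W W_neg B_def dL.pair.minus_left dL.pair.minus_right)
  finally show ?thesis by (simp add: eq_neg_iff_add_eq_0 flip: scaleR_2)
qed

text \<open>Its \<open>t\<close>-derivative is the same relation for \<open>W\<close>, which is
  \<open>W_transpose\<close> once \<open>W_neg\<close> rewrites the value at
  \<open>- t\<close>.\<close>

lemma T_skew: "pL \<alpha> (fst (D'.T (0, p) t (0, \<beta>))) + pL \<beta> (fst (D'.T (0, p) t (0, \<alpha>))) = 0"
proof (rule vector_derivative_eq_imp_eq[of _ "\<lambda>t. 0" "\<lambda>t. 0"])
  show "((\<lambda>t. pL \<alpha> (fst (D'.T (0, p) t (0, \<beta>))) + pL \<beta> (fst (D'.T (0, p) t (0, \<alpha>))))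
      has_vector_derivative 0) (at t)" for t
  proof (rule has_vector_derivative_eq_rhs, (rule L_rules)+)
    have "B (D'.W (0, p) (- t) (0, \<alpha>)) (0, \<beta>) = - B (0, \<alpha>) (D'.W (0, p) t (0, \<beta>))" by (rule D'.W_transpose)
    then have "pL \<beta> (fst (D'.W (0, p) t (0, \<alpha>))) = - pL \<alpha> (fst (D'.W (0, p) t (0, \<beta>)))"
      by (simp add: W_neg B_def dL.pair.zero_right)
    then show "pL \<alpha> (fst (D'.W (0, p) t (0, \<beta>))) + pL 0 (fst (D'.T (0, p) t (0, \<beta>))) +
       (pL \<beta> (fst (D'.W (0, p) t (0, \<alpha>))) + pL 0 (fst (D'.T (0, p) t (0, \<alpha>)))) = 0"
      by (simp add: dL.pair.zero_left)
  qed
qed (auto simp: dL.pair.zero_right)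

text \<open>Skewness of the \<open>\<ll>\<close>-part of the \<open>\<ell>\<close>-matrix, with the denominator \<open>sinh A / A\<close> multiplied out.\<close>

lemma coth_skew:
  "pL (snd (W1 p \<alpha>)) (fst (W1 p \<beta>) - fst (T1 p \<beta>))
   + pL (snd (W1 p \<beta>)) (fst (W1 p \<alpha>) - fst (T1 p \<alpha>)) = 0"
proof -
  have "pL (snd (W1 p \<alpha>)) (fst (T1 p \<beta>))
      + pL (snd (W1 p \<beta>)) (fst (T1 p \<alpha>)) = 0"
    using T_skew[of \<alpha> p 1 \<beta>]
    by (simp add: W_snd bracket'_skew[of "fst (T1 p \<beta>)"] dL.pair.minus_right del: G'_sel)
  moreover have "pL (snd (W1 p \<alpha>)) (fst (W1 p \<beta>))
      + pL (snd (W1 p \<beta>)) (fst (W1 p \<alpha>)) = 0"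
    using W_isotropic[of p 1 \<alpha> \<beta>] by (simp add: B_def)
  moreover have "(a - c) + (b - d) = (a + b) - (c + d)" for a b c d :: 'k by simp
  ultimately show ?thesis by (simp only: dL.pair.diff_right diff_self)
qed

section \<open>The power series of the statement\<close>

lemma bounded_linear_j: "bounded_linear j"
  by (rule fin_dim_bounded_linear[OF fin_dim_GL(2) linear_j])

lemma j_power: "(db (j P) ^^ n) (j x) = j ((db' P ^^ n) x)"
  by (induction n) (simp_all add: j_db)

lemma fps_op_j:
  assumes R: "bounded_linear R"
    and F: "\<And>n. fps_nth F n *\<^sub>R (db' P ^^ n) x = R ((1 / fact (n + k)) *\<^sub>R (db' P ^^ n) x)"
  shows "fps_op F (db (j P)) (j x) = j (R (eseries k (\<lambda>n. (db' P ^^ n) x) 1))"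
proof -
  have "(\<lambda>n. j (fps_nth F n *\<^sub>R (db' P ^^ n) x)) sums j (R (eseries k (\<lambda>n. (db' P ^^ n) x) 1))"
    by (rule bounded_linear.sums[OF bounded_linear_j fps_op_eseries(1)[OF fin_dim_GL(2) D'.br.bounded_linear_right R F]])
  then show ?thesis by (simp add: fps_op_def j_power j_linear(2) sums_iff)
qed

lemma bounded_linear_parts: "bounded_linear (\<lambda>x::'l \<times> 'q. (fst x, 0 :: 'q))" "bounded_linear (\<lambda>x::'l \<times> 'q. (0 :: 'l, snd x))"
  by (intro bounded_linear_Pair bounded_linear_fst bounded_linear_snd bounded_linear_zero)+

lemma ad_s_eq: "ad_s G L i M p = db (j (0, p))"
  by (simp add: ad_s_def j_def)

lemma theta_l_eq: "theta_l G L i M p \<alpha> = (i (fst (T1 p \<alpha>)), 0)"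
proof -
  have "theta_l G L i M p \<alpha> = fps_op ((sinh_fps - fps_X) / fps_X ^ 2) (db (j (0, p))) (j (0, \<alpha>))"
    by (simp add: theta_l_def ad_s_eq) (simp add: j_def)
  also have "\<dots> = j (fst (T1 p \<alpha>), 0)" unfolding D'.T_def
    by (rule fps_op_j[OF bounded_linear_parts(1)]) (simp only: theta_series_nth, simp add: prod_eq_iff power_parity del: fact_Suc)
  finally show ?thesis by (simp add: j_def)
qed

lemma theta_g_eq: "theta_g G L i M p \<alpha> = (0, s (snd (W1 p \<alpha>)))"
proof -
  have "theta_g G L i M p \<alpha> = fps_op (sinh_fps / fps_X) (db (j (0, p))) (j (0, \<alpha>))"
    by (simp add: theta_g_def ad_s_eq) (simp add: j_def)
  also have "\<dots> = j (0, snd (W1 p \<alpha>))" unfolding D'.W_def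
    by (rule fps_op_j[OF bounded_linear_parts(2)]) (simp only: sinhc_nth, simp add: prod_eq_iff power_parity del: fact_Suc)
  finally show ?thesis by (simp add: j_def)
qed

lemma theta_eq: "\<theta> p \<alpha> = (fst (T1 p \<alpha>), s (snd (W1 p \<alpha>)))"
  by (simp add: theta_def theta_l_eq theta_g_eq)

lemma ad_sub_eq: "ad_sub G L i M p = db' (0, p)" by (simp add: ad_sub_def)

text \<open>An even series in \<open>A\<close> preserves both summands, so it can be inverted on
  covectors separately.\<close>

lemma sinhc_eq: "sinhc_op (db' (0, p)) x = (fst (D'.W (0, p) 1 (fst x, 0)), snd (D'.W (0, p) 1 (0, snd x)))"
proof -
  have 1: "sinhc_op (db' (0, p)) (z, 0) = (fst (D'.W (0, p) 1 (z, 0)), 0)" for z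
    unfolding sinhc_op_def D'.W_def
    by (rule fps_op_eseries(2)[OF fin_dim_GL(2) D'.br.bounded_linear_right bounded_linear_parts(1)])
      (simp only: sinhc_nth, simp add: prod_eq_iff power_parity del: fact_Suc)
  have 2: "sinhc_op (db' (0, p)) (0, \<alpha>) = (0, snd (W1 p \<alpha>))" for \<alpha>
    unfolding sinhc_op_def D'.W_def
    by (rule fps_op_eseries(2)[OF fin_dim_GL(2) D'.br.bounded_linear_right bounded_linear_parts(2)])
      (simp only: sinhc_nth, simp add: prod_eq_iff power_parity del: fact_Suc)
  have "linear (sinhc_op (db' (0, p)))"
    by (rule sinhc_op_commute(1)[OF fin_dim_GL(2) bounded_linear.linear[OF D'.br.bounded_linear_right]])
  from linear_add[OF this, of "(fst x, 0)" "(0, snd x)"] show ?thesis by (simp add: 1 2)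
qed

lemma coth_numerator_eq:
  "fps_op ((fps_X * cosh_fps - sinh_fps) / fps_X ^ 2) (db' (0, p)) (0, \<beta>)
    = (fst (W1 p \<beta>) - fst (T1 p \<beta>), 0)"
proof -
  let ?F = "Abs_fps (\<lambda>n. if odd n then 1 / fact (n + 1) else 0 :: real)"
  let ?H = "Abs_fps (\<lambda>n. if odd n then 1 / fact (n + 2) else 0 :: real)"
  have "(\<lambda>n. fps_nth ?F n *\<^sub>R (db' (0, p) ^^ n) (0, \<beta>)) sums (fst (W1 p \<beta>), 0)"
    unfolding D'.W_def
    by (rule fps_op_eseries(1)[OF fin_dim_GL(2) D'.br.bounded_linear_right bounded_linear_parts(1)])
      (simp add: prod_eq_iff power_parity del: fact_Suc)
  moreover have "(\<lambda>n. fps_nth ?H n *\<^sub>R (db' (0, p) ^^ n) (0, \<beta>)) sums (fst (T1 p \<beta>), 0)"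
    unfolding D'.T_def
    by (rule fps_op_eseries(1)[OF fin_dim_GL(2) D'.br.bounded_linear_right bounded_linear_parts(1)])
      (simp add: prod_eq_iff power_parity del: fact_Suc)
  ultimately have "(\<lambda>n. fps_nth ?F n *\<^sub>R (db' (0, p) ^^ n) (0, \<beta>) - fps_nth ?H n *\<^sub>R (db' (0, p) ^^ n) (0, \<beta>))
      sums ((fst (W1 p \<beta>), 0) - (fst (T1 p \<beta>), 0))"
    by (rule sums_diff)
  moreover have "fps_nth ?F n *\<^sub>R x - fps_nth ?H n *\<^sub>R x = fps_nth ((fps_X * cosh_fps - sinh_fps) / fps_X ^ 2) n *\<^sub>R x"
    for n and x :: "'l \<times> 'q"
    by (simp only: theta_series_nth) (simp add: scaleR_diff_left del: fact_Suc)
  ultimately show ?thesis unfolding fps_op_def by (simp add: sums_iff)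
qed

lemma Ad_ms_eq: "Ad_ms G L i M p x = D.E (0, s p) (- 1) x"
proof -
  have pw: "(db (- P) ^^ n) x = (-1) ^ n *\<^sub>R (db P ^^ n) x" for P n
    by (induction n) (simp_all add: D.br.minus_left D.br.scaleR_right)
  have "(db (0, - s p) ^^ n) x = (-1) ^ n *\<^sub>R (db (0, s p) ^^ n) x" for n
    using pw[of n "(0, s p)"] by simp
  then show ?thesis
    unfolding Ad_ms_def Ad_exp_def fps_op_def D.E_def eseries_def
    by (intro suminf_cong) simp
qed

lemma E_j: "D.E (j P) t (j x) = j (D'.E P t x)"
  and W_j: "D.W (j P) t (j x) = j (D'.W P t x)"
  unfolding D.E_def D'.E_def D.W_def D'.W_def j_power
  by (rule eseries_linear_image[OF fin_dim_GL(2) D'.pw bounded_linear_j, symmetric])+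

end

section \<open>The canonical \<open>\<ell>\<close>-matrix and its derivative\<close>

lemma has_derivative_eventually_eq:
  assumes "(f has_derivative f') (at p)" "\<forall>\<^sub>F q in nhds p. g q = f q"
  shows "(g has_derivative f') (at p)"
proof (rule has_derivative_transform_eventually[OF assms(1)])
  show "\<forall>\<^sub>F q in at p. f q = g q"
    using assms(2) unfolding eventually_at_filter by eventually_elim simp
  show "f p = g p" using eventually_nhds_x_imp_x[OF assms(2)] by simp
qed simp

context compatible_decomposition begin

abbreviation "U \<equiv> U_dom G L i M"

text \<open>\<open>Tm p\<close> is the operator \<open>p\<^sub>\<gg> Ad i\<^sub>\<gg>\<close> at \<open>exp (- s p)\<close>.\<close>

definition Tm :: "'q \<Rightarrow> 'g \<Rightarrow> 'g" where "Tm p x = fst (D.E (0, s p) (- 1) (x, 0))"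

lemma bounded_linear_s: "bounded_linear s"
  by (rule fin_dim_bounded_linear[OF dL.fin_dim_V' linear_covectors(1)])

lemma bounded_linear_i: "bounded_linear i"
  by (rule fin_dim_bounded_linear[OF dL.fin_dim_V real_linear_i])

lemma bounded_bilinear_ad: "bounded_bilinear (\<lambda>q. db' (0, q))" "bounded_bilinear (\<lambda>q. db (0, s q))"
  by (rule bounded_bilinear.comp1[OF D'.bil] bounded_bilinear.comp1[OF D.bil]
      bounded_linear_Pair[OF bounded_linear_zero] bounded_linear_ident bounded_linear_s)+

lemma series_deriv:
  "((\<lambda>q. D'.E (0, q) t x) has_derivative (\<lambda>\<gamma>. D'.DE (0, p) (0, \<gamma>) t x)) (at p)"
  "((\<lambda>q. D'.W (0, q) t x) has_derivative (\<lambda>\<gamma>. D'.DW (0, p) (0, \<gamma>) t x)) (at p)"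
  "((\<lambda>q. D'.T (0, q) t x) has_derivative (\<lambda>\<gamma>. D'.DT (0, p) (0, \<gamma>) t x)) (at p)"
  "((\<lambda>q. D.E (0, s q) t y) has_derivative (\<lambda>\<gamma>. D.DE (0, s p) (0, s \<gamma>) t y)) (at p)"
  unfolding D'.E_def D'.W_def D'.T_def D'.DE_def D'.DW_def D'.DT_def D.E_def D.DE_def
  by (rule eseries_operator_has_derivative[OF fin_dim_GL(2) bounded_bilinear_ad(1)]
      eseries_operator_has_derivative[OF fin_dim_GL(1) bounded_bilinear_ad(2)])+

lemma linear_Tm: "linear (Tm p)"
proof (rule linearI)
  show "Tm p (x + y) = Tm p x + Tm p y" for x y
    using D.E_add[of "(0, s p)" "- 1" "(x, 0)" "(y, 0)"] by (simp add: Tm_def prod_eq_iff)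
  show "Tm p (r *\<^sub>R x) = r *\<^sub>R Tm p x" for r x
    using D.E_scale[of r "(0, s p)" "- 1" "(x, 0)"] by (simp add: Tm_def prod_eq_iff)
qed

lemma Tm_deriv: "((\<lambda>q. Tm q x) has_derivative (\<lambda>\<gamma>. fst (D.DE (0, s p) (0, s \<gamma>) (- 1) (x, 0)))) (at p)"
  unfolding Tm_def by (intro has_derivative_fst series_deriv)

lemma sinhc_linear: "linear (sinhc_op (db' (0, p)))"
  by (rule sinhc_op_commute(1)[OF fin_dim_GL(2) bounded_linear.linear[OF D'.br.bounded_linear_right]])

lemma sinhc_deriv: "((\<lambda>q. sinhc_op (db' (0, q)) x) has_derivative
    (\<lambda>\<gamma>. (fst (D'.DW (0, p) (0, \<gamma>) 1 (fst x, 0)), snd (D'.DW (0, p) (0, \<gamma>) 1 (0, snd x))))) (at p)"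
  unfolding sinhc_eq by (intro has_derivative_Pair has_derivative_fst has_derivative_snd series_deriv)

lemma U_iff: "p \<in> U \<longleftrightarrow> inj (sinhc_op (db' (0, p))) \<and> bij (Tm p)"
proof -
  have vs: "vector_space (pair_scale (scal L) (coscal L))"
    by (rule vector_space_pair_scale[OF dL.V.vector_space_axioms dL.V'.vector_space_axioms])
  have "Vector_Spaces.linear (pair_scale (scal L) (coscal L)) (pair_scale (scal L) (coscal L)) (db' (0, p))"
    by (rule Vector_Spaces_linearI[OF vs vs]) (rule db'_linear(2), rule db'_linear(5))
  from spectrum_avoids_iff[OF vs pair_scale_of_real(2) this]
    sinhc_op_inj_iff[OF fin_dim_GL(2) bounded_linear.linear[OF D'.br.bounded_linear_right]]
  have "spectrum_of (pair_scale (scal L) (coscal L)) (db' (0, p)) \<inter> {\<i> * of_real pi * of_int k |k. k \<noteq> 0} = {}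
      \<longleftrightarrow> inj (sinhc_op (db' (0, p)))" by simp
  then show ?thesis unfolding U_dom_def ad_sub_eq Ad_ms_eq Tm_def[symmetric] by simp
qed

lemma U_bij: "p \<in> U \<Longrightarrow> bij (sinhc_op (db' (0, p)))" "p \<in> U \<Longrightarrow> bij (Tm p)"
  unfolding U_iff by (auto intro: fin_dim_inj_imp_bij[OF fin_dim_GL(2) sinhc_linear])

lemma eventually_U: assumes "p \<in> U" shows "\<forall>\<^sub>F q in nhds p. q \<in> U"
proof -
  have c1: "((\<lambda>q. sinhc_op (db' (0, q)) x) \<longlongrightarrow> sinhc_op (db' (0, p)) x) (at p)" for x
    using has_derivative_continuous[OF sinhc_deriv] by (simp add: continuous_within)
  have c2: "((\<lambda>q. Tm q x) \<longlongrightarrow> Tm p x) (at p)" for x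
    using has_derivative_continuous[OF Tm_deriv] by (simp add: continuous_within)
  obtain c where "\<forall>\<^sub>F q in nhds p. bij (sinhc_op (db' (0, q))) \<and> (\<forall>x. norm (sinhc_op (db' (0, q)) x) \<ge> c * norm x)"
    using eventually_bij[OF fin_dim_GL(2) sinhc_linear c1 bij_is_inj[OF U_bij(1)[OF assms]]] .
  moreover obtain d where "\<forall>\<^sub>F q in nhds p. bij (Tm q) \<and> (\<forall>x. norm (Tm q x) \<ge> d * norm x)"
    using eventually_bij[OF dG.fin_dim_V linear_Tm c2 bij_is_inj[OF U_bij(2)[OF assms]]] .
  ultimately show ?thesis
    by eventually_elim (simp add: U_iff bij_is_inj)
qed

text \<open>The covector \<open>snd (W1 q \<beta>)\<close> is \<open>sinh A / A\<close> applied to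
  \<open>\<beta>\<close>; arguments of this form make the inverse in the
  \<open>\<ell>\<close>-matrix explicit at \<open>q\<close>. The second fact keeps the inverse
  within \<open>\<ll>\<^sup>*\<close> for arguments not adapted to \<open>q\<close>.\<close>

lemma sinhc_inv: assumes "q \<in> U"
  shows "inv (sinhc_op (db' (0, q))) (0, snd (W1 q \<beta>)) = (0, \<beta>)"
    "fst (inv (sinhc_op (db' (0, q))) (0, \<beta>')) = 0"
proof -
  let ?S = "sinhc_op (db' (0, q))"
  have W0: "D'.W (0, q) 1 (0, 0) = 0"
    using linear_0[OF D'.linear_W] by (simp add: zero_prod_def)
  have inj: "inj ?S" using U_bij(1)[OF assms] by (rule bij_is_inj)
  show "inv ?S (0, snd (W1 q \<beta>)) = (0, \<beta>)"
    by (rule inv_f_eq[OF inj]) (simp add: sinhc_eq W0)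
  define x where "x = inv ?S (0, \<beta>')"
  have "?S x = (0, \<beta>')" unfolding x_def by (rule surj_f_inv_f[OF bij_is_surj[OF U_bij(1)[OF assms]]])
  then have "fst (D'.W (0, q) 1 (fst x, 0)) = 0" by (simp add: sinhc_eq)
  then have "?S (fst x, 0) = ?S (0, 0)" by (simp add: sinhc_eq W0)
  then have "(fst x, 0) = ((0, 0) :: 'l \<times> 'q)" by (rule injD[OF inj])
  then show "fst (inv ?S (0, \<beta>')) = 0" by (simp add: x_def)
qed

text \<open>For the vector part: on \<open>s \<alpha>\<close> neither \<open>\<varpi>\<close> paired
  with two \<open>s\<close> covectors nor the associator with one argument in
  \<open>\<ll>\<^sup>\<bottom>\<close> survives. For the covector part: \<open>\<mm>\<close> is
  stable under \<open>\<ll>\<close> and annihilated by \<open>s p\<close>, and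
  \<open>\<varpi>\<close> vanishes on \<open>\<ll>\<close>.\<close>

lemma ad_M_ann: assumes "fst x \<in> M" "rs (snd x) = 0"
  shows "fst (db (0, s p) x) \<in> M" "rs (snd (db (0, s p) x)) = 0"
proof -
  have z: "bracket G 0 y = 0" "cobracket G 0 \<xi> = 0" for y \<xi>
    using bracket_linear(1)[of 0 0 y] cobracket_linear(1)[of 0 0 \<xi>] by simp_all
  have c0: "coad G 0 \<xi> = 0" for \<xi>
    by (rule dG.covector_eqI) (simp add: coad_pair z dG.pair.zero_left dG.pair.zero_right)
  have eq: "db (0, s p) x = (- cobracket G (fst x) (s p) + vector_of G (\<phi> (s p) (snd x)),
      coad G (fst x) (s p) + covector_cobracket G (snd x) (s p))"
    by (simp add: db_eq z c0)
  show "fst (db (0, s p) x) \<in> M"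
    unfolding in_M_iff eq
    by (simp add: dG.pair.add_right dG.pair.minus_right dG.pair.diff_right cobracket_ss vec_pair \<phi>_vanish'[OF assms(2)])
  have "bracket G (fst x) (i z) \<in> M" for z
    using M_sub(4)[OF bracket_i_M[OF assms(1), of z]] by (simp add: bracket_skew[of "fst x"])
  then show "rs (snd (db (0, s p) x)) = 0"
    unfolding rs_eq_0 eq
    by (simp add: dG.pair.add_left coad_pair covcob_pair cobracket_i s_annihilates dG.pair.zero_right)
qed

lemma E_M_ann: assumes "fst x \<in> M" "rs (snd x) = 0"
  shows "fst (D.E (0, s p) t x) \<in> M" "rs (snd (D.E (0, s p) t x)) = 0"
proof -
  have pw: "fst ((db (0, s p) ^^ n) x) \<in> M \<and> rs (snd ((db (0, s p) ^^ n) x)) = 0" for n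
    by (induction n) (use assms in \<open>auto intro: ad_M_ann\<close>)
  have z: "eseries 0 (\<lambda>n. 0 :: 'a::real_normed_vector) t = 0" by (simp add: eseries_def)
  have "pG (s \<alpha>) (fst (D.E (0, s p) t x)) = eseries 0 (\<lambda>n. pG (s \<alpha>) (fst ((db (0, s p) ^^ n) x))) t" for \<alpha>
    unfolding D.E_def
    by (rule eseries_linear_image[OF fin_dim_GL(1) D.pw bounded_linear_compose[OF dG.pair.bounded_linear_right bounded_linear_fst]])
  then show "fst (D.E (0, s p) t x) \<in> M"
    using pw by (simp add: in_M_iff z)
  have "rs (snd (D.E (0, s p) t x)) = eseries 0 (\<lambda>n. rs (snd ((db (0, s p) ^^ n) x))) t"
    unfolding D.E_def
    by (rule eseries_linear_image[OF fin_dim_GL(1) D.pw bounded_linear_compose[OF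
            fin_dim_bounded_linear[OF dG.fin_dim_V' linear_covectors(2)] bounded_linear_snd]])
  then show "rs (snd (D.E (0, s p) t x)) = 0" using pw by (simp add: z)
qed

lemma Tm_i: "Tm q (i z) = i (fst (D'.E (0, q) (- 1) (z, 0)))"
proof -
  have "D.E (j (0, q)) (- 1) (j (z, 0)) = j (D'.E (0, q) (- 1) (z, 0))" by (rule E_j)
  then show ?thesis by (simp add: Tm_def j_def)
qed

text \<open>\<open>Tm q\<close> preserves both \<open>\<ll>\<close> and \<open>\<mm>\<close>, so the
  \<open>\<ll>\<close>-part of a preimage is sent into their intersection, which is zero.\<close>

lemma inv_Tm_M: assumes "q \<in> U" "y \<in> M" shows "inv (Tm q) y \<in> M"
proof -
  have b: "bij (Tm q)" by (rule U_bij(2)[OF assms(1)])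
  define x where "x = inv (Tm q) y"
  define m where "m = x - i (pr x)"
  have m: "m \<in> M" unfolding m_def by (rule pr_spec)
  have "Tm q m \<in> M" unfolding Tm_def by (rule E_M_ann(1)) (use m in simp_all)
  moreover have "Tm q x = y" unfolding x_def by (rule surj_f_inv_f[OF bij_is_surj[OF b]])
  moreover have "Tm q (i (pr x)) = Tm q x - Tm q m" by (simp add: m_def linear_diff[OF linear_Tm])
  ultimately have "Tm q (i (pr x)) \<in> M" using assms(2) M_sub(5) by simp
  then have "Tm q (i (pr x)) = 0" unfolding Tm_i using i_in_M by force
  then have "Tm q (i (pr x)) = Tm q 0" using linear_0[OF linear_Tm] by simp
  then have "i (pr x) = 0" by (rule injD[OF bij_is_inj[OF b]])
  then show ?thesis using m by (simp add: m_def x_def)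
qed

lemma l_can_eq:
  assumes "rs \<xi> = 0"
  shows "lcan q (s \<beta> + \<xi>) =
    i (fst (fps_op ((fps_X * cosh_fps - sinh_fps) / fps_X ^ 2) (db' (0, q)) (inv (sinhc_op (db' (0, q))) (0, \<beta>))))
    - inv (Tm q) (fst (D.E (0, s q) (- 1) (0, \<xi>)))"
proof -
  have "rs (s \<beta> + \<xi>) = \<beta>" using assms by (simp add: rs_linear)
  moreover have "(\<lambda>x. fst (Ad_ms G L i M q (x, 0))) = Tm q" by (rule ext) (simp add: Tm_def Ad_ms_eq)
  ultimately show ?thesis
    by (simp add: l_can_def Let_def coth_minus_inverse_op_def ad_sub_eq Ad_ms_eq sinhc_op_def del: fps_divide_X_power fps_divide_X)
qed

lemma l_can_at:
  assumes "q \<in> U" "rs \<xi> = 0"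
  shows "lcan q (s (snd (W1 q \<beta>)) + \<xi>) =
    i (fst (W1 q \<beta>) - fst (T1 q \<beta>)) - inv (Tm q) (fst (D.E (0, s q) (- 1) (0, \<xi>)))"
  unfolding l_can_eq[OF assms(2)] sinhc_inv(1)[OF assms(1)] coth_numerator_eq by simp

text \<open>This part of the \<open>\<ell>\<close>-matrix has values in \<open>\<mm>\<close> for all
  \<open>q\<close> near \<open>p\<close>, so its derivative is invisible to every
  \<open>s \<alpha>\<close> and its formula never matters.\<close>

lemma l_can_m_part_deriv:
  assumes "p \<in> U" "rs \<xi> = 0"
  obtains k where "((\<lambda>q. inv (Tm q) (fst (D.E (0, s q) (- 1) (0, \<xi>)))) has_derivative k) (at p)"
    "\<And>\<alpha> \<gamma>. pG (s \<alpha>) (k \<gamma>) = 0"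
proof -
  define y where "y q = fst (D.E (0, s q) (- 1) (0, \<xi>))" for q
  obtain k where k: "((\<lambda>q. inv (Tm q) (y q)) has_derivative k) (at p)"
  proof (rule that)
    have lin: "linear (\<lambda>x. fst (D.DE (0, s p) (0, s v) (- 1) (x, 0)))" for v
    proof (rule linearI)
      show "fst (D.DE (0, s p) (0, s v) (- 1) (x + y, 0)) =
          fst (D.DE (0, s p) (0, s v) (- 1) (x, 0)) + fst (D.DE (0, s p) (0, s v) (- 1) (y, 0))" for x y
        using D.DE_add[of "(0, s p)" "(0, s v)" "- 1" "(x, 0)" "(y, 0)"] by (simp add: prod_eq_iff)
      show "fst (D.DE (0, s p) (0, s v) (- 1) (r *\<^sub>R x, 0)) = r *\<^sub>R fst (D.DE (0, s p) (0, s v) (- 1) (x, 0))" for r x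
        using D.DE_scale[of r "(0, s p)" "(0, s v)" "- 1" "(x, 0)"] by (simp add: prod_eq_iff)
    qed
    show "((\<lambda>q. inv (Tm q) (y q)) has_derivative
       (\<lambda>v. inv (Tm p) (fst (D.DE (0, s p) (0, s v) (- 1) (0, \<xi>)) - fst (D.DE (0, s p) (0, s v) (- 1) (inv (Tm p) (y p), 0))))) (at p)"
      unfolding y_def
      by (rule has_derivative_inv_apply[OF dG.fin_dim_V linear_Tm lin Tm_deriv has_derivative_fst[OF series_deriv(4)] U_bij(2)[OF assms(1)]])
  qed
  have "pG (s \<alpha>) (k \<gamma>) = 0" for \<alpha> \<gamma>
  proof -
    have 1: "((\<lambda>q. pG (s \<alpha>) (inv (Tm q) (y q))) has_derivative (\<lambda>\<gamma>. pG (s \<alpha>) (k \<gamma>))) (at p)"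
      by (rule bounded_linear.has_derivative[OF dG.pair.bounded_linear_right k])
    have "pG (s \<alpha>) (inv (Tm q) (y q)) = 0" if "q \<in> U" for q
      using inv_Tm_M[OF that, of "y q"] E_M_ann(1)[of "(0, \<xi>)" q "- 1"] assms(2)
      by (simp add: y_def M_sub s_annihilates)
    then have "\<forall>\<^sub>F q in nhds p. pG (s \<alpha>) (inv (Tm q) (y q)) = 0"
      using eventually_U[OF assms(1)] by (rule eventually_mono[rotated]) 
    then have "((\<lambda>q. pG (s \<alpha>) (inv (Tm q) (y q))) has_derivative (\<lambda>\<gamma>. 0)) (at p)"
      by (rule has_derivative_eventually_eq[OF has_derivative_const])
    from has_derivative_unique[OF 1 this] show ?thesis by meson
  qed
  then show ?thesis using that k unfolding y_def by blast
qed

lemma l_can_deriv: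
  assumes p: "p \<in> U" and \<xi>: "rs \<xi> = 0"
  obtains dl where "((\<lambda>q. lcan q (s (snd (W1 p \<beta>)) + \<xi>)) has_derivative dl) (at p)"
    "\<And>\<alpha> \<gamma>. pG (s (snd (W1 p \<alpha>))) (dl \<gamma>) =
      pL (snd (W1 p \<alpha>)) (fst (DW1 p \<gamma> \<beta>) - fst (DT1 p \<gamma> \<beta>))
      + pL (snd (DW1 p \<gamma> \<beta>)) (fst (W1 p \<alpha>) - fst (T1 p \<alpha>))"
proof -
  let ?S = "\<lambda>q. sinhc_op (db' (0, q))"
  \<comment> \<open>The argument is frozen at \<open>p\<close> while the operators vary with
    \<open>q\<close>; the inverse is explicit only at \<open>q = p\<close>.\<close>
  define \<beta>' where "\<beta>' = snd (W1 p \<beta>)"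
  obtain k where k: "((\<lambda>q. inv (Tm q) (fst (D.E (0, s q) (- 1) (0, \<xi>)))) has_derivative k) (at p)"
    "\<And>\<alpha> \<gamma>. pG (s \<alpha>) (k \<gamma>) = 0"
    using that by (rule l_can_m_part_deriv[OF p \<xi>])
  define N where "N q \<eta> = fst (W1 q \<eta>) - fst (T1 q \<eta>)" for q \<eta>
  define N' where "N' \<gamma> \<eta> = fst (DW1 p \<gamma> \<eta>) - fst (DT1 p \<gamma> \<eta>)" for \<gamma> \<eta>
  have Pair0: "linear (\<lambda>\<eta>. (0 :: 'l, \<eta> :: 'q))" "linear (\<lambda>z. (z :: 'l, 0 :: 'q))" by (simp_all add: linearI)
  have linN: "linear (N q)" for q
    unfolding N_def
    by (intro linear_compose_sub linear_compose[OF linear_compose[OF Pair0(1) D'.linear_W] linear_fst, unfolded o_def]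
        linear_compose[OF linear_compose[OF Pair0(1) D'.linear_T] linear_fst, unfolded o_def])
  have linN': "linear (N' \<gamma>)" for \<gamma>
    unfolding N'_def
    by (intro linear_compose_sub linear_compose[OF linear_compose[OF Pair0(1) D'.linear_DW] linear_fst, unfolded o_def]
        linear_compose[OF linear_compose[OF Pair0(1) D'.linear_DT] linear_fst, unfolded o_def])
  have dN: "((\<lambda>q. N q \<eta>) has_derivative (\<lambda>\<gamma>. N' \<gamma> \<eta>)) (at p)" for \<eta>
    unfolding N_def N'_def by (intro has_derivative_diff has_derivative_fst series_deriv)
  define S' where "S' \<gamma> x = (fst (D'.DW (0, p) (0, \<gamma>) 1 (fst x, 0)), snd (D'.DW (0, p) (0, \<gamma>) 1 (0, snd x)))" for \<gamma> x
  have linS': "linear (S' \<gamma>)" for \<gamma>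
  proof -
    have a: "linear (\<lambda>z. fst (D'.DW (0, p) (0, \<gamma>) 1 (z, 0)))"
      by (rule linear_compose[OF linear_compose[OF Pair0(2) D'.linear_DW] linear_fst, unfolded o_def])
    have b: "linear (\<lambda>z. snd (D'.DW (0, p) (0, \<gamma>) 1 (0, z)))"
      by (rule linear_compose[OF linear_compose[OF Pair0(1) D'.linear_DW] linear_snd, unfolded o_def])
    show ?thesis unfolding S'_def
      by (rule linearI) (simp_all add: linear_add[OF a] linear_add[OF b] linear_cmul[OF a] linear_cmul[OF b])
  qed
  have dSx: "((\<lambda>q. ?S q x) has_derivative (\<lambda>\<gamma>. S' \<gamma> x)) (at p)" for x
    unfolding S'_def by (rule sinhc_deriv)
  have Sp: "inv (?S p) (0, \<beta>') = (0, \<beta>)" unfolding \<beta>'_def by (rule sinhc_inv(1)[OF p])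
  have dS: "((\<lambda>q. inv (?S q) (0, \<beta>')) has_derivative (\<lambda>\<gamma>. inv (?S p) (0 - S' \<gamma> (0, \<beta>)))) (at p)"
    using has_derivative_inv_apply[OF fin_dim_GL(2) sinhc_linear linS' dSx
        has_derivative_const[of "(0, \<beta>')"] U_bij(1)[OF p]] unfolding Sp .
  define \<eta>' where "\<eta>' \<gamma> = snd (inv (?S p) (0 - S' \<gamma> (0, \<beta>)))" for \<gamma>
  have S'\<beta>: "0 - S' \<gamma> (0, \<beta>) = (0, - snd (DW1 p \<gamma> \<beta>))" for \<gamma>
  proof -
    have "D'.DW (0, p) (0, \<gamma>) 1 (0, 0) = 0" using linear_0[OF D'.linear_DW] by (simp add: zero_prod_def)
    then show ?thesis by (simp add: S'_def prod_eq_iff)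
  qed
  \<comment> \<open>The derivative \<open>\<eta>'\<close> of the inverse is known only through its
    image under \<open>sinh A / A\<close>, and this image is explicit.\<close>
  have W\<eta>': "snd (W1 p (\<eta>' \<gamma>)) = - snd (DW1 p \<gamma> \<beta>)" for \<gamma>
  proof -
    define x where "x = inv (?S p) (0 - S' \<gamma> (0, \<beta>))"
    have "?S p x = 0 - S' \<gamma> (0, \<beta>)"
      unfolding x_def by (rule surj_f_inv_f[OF bij_is_surj[OF U_bij(1)[OF p]]])
    then have "snd (?S p x) = - snd (DW1 p \<gamma> \<beta>)" by (simp only: S'\<beta> snd_conv)
    then show ?thesis unfolding \<eta>'_def x_def[symmetric] by (simp add: sinhc_eq)
  qed
  have "((\<lambda>q. N q (snd (inv (?S q) (0, \<beta>')))) has_derivative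
      (\<lambda>\<gamma>. N' \<gamma> (snd (inv (?S p) (0, \<beta>'))) + N p (\<eta>' \<gamma>))) (at p)"
    unfolding \<eta>'_def by (rule has_derivative_apply[OF dL.fin_dim_V' linN linN' dN has_derivative_snd[OF dS]])
  then have dNS: "((\<lambda>q. N q (snd (inv (?S q) (0, \<beta>')))) has_derivative (\<lambda>\<gamma>. N' \<gamma> \<beta> + N p (\<eta>' \<gamma>))) (at p)"
    unfolding Sp by simp
  have "((\<lambda>q. i (N q (snd (inv (?S q) (0, \<beta>')))) - inv (Tm q) (fst (D.E (0, s q) (- 1) (0, \<xi>)))) has_derivative
      (\<lambda>\<gamma>. i (N' \<gamma> \<beta> + N p (\<eta>' \<gamma>)) - k \<gamma>)) (at p)"
    by (intro has_derivative_diff k(1) bounded_linear.has_derivative[OF bounded_linear_i dNS])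
  moreover have "\<forall>\<^sub>F q in nhds p. lcan q (s \<beta>' + \<xi>) =
      i (N q (snd (inv (?S q) (0, \<beta>')))) - inv (Tm q) (fst (D.E (0, s q) (- 1) (0, \<xi>)))"
    using eventually_U[OF p]
  proof (rule eventually_mono)
    fix q assume q: "q \<in> U"
    have "inv (?S q) (0, \<beta>') = (0, snd (inv (?S q) (0, \<beta>')))"
      using sinhc_inv(2)[OF q] by (simp add: prod_eq_iff)
    then show "lcan q (s \<beta>' + \<xi>) =
      i (N q (snd (inv (?S q) (0, \<beta>')))) - inv (Tm q) (fst (D.E (0, s q) (- 1) (0, \<xi>)))"
      unfolding l_can_eq[OF \<xi>] N_def by (metis coth_numerator_eq fst_conv)
  qed
  ultimately have dl: "((\<lambda>q. lcan q (s \<beta>' + \<xi>)) has_derivative (\<lambda>\<gamma>. i (N' \<gamma> \<beta> + N p (\<eta>' \<gamma>)) - k \<gamma>)) (at p)"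
    by (rule has_derivative_eventually_eq)
  show ?thesis
  proof (rule that[OF dl[unfolded \<beta>'_def]])
    fix \<alpha> \<gamma>
    \<comment> \<open>Skewness moves the numerator \<open>N\<close> from the unknown
      \<open>\<eta>' \<gamma>\<close> to \<open>\<alpha>\<close>; what remains of
      \<open>\<eta>' \<gamma>\<close> is the image computed in \<open>W\<eta>'\<close>.\<close>
    have "pL (snd (W1 p \<alpha>)) (N p (\<eta>' \<gamma>)) =
        pL (snd (DW1 p \<gamma> \<beta>)) (N p \<alpha>)"
      using coth_skew[of p \<alpha> "\<eta>' \<gamma>"] unfolding W\<eta>' N_def[symmetric] by (simp add: dL.pair.minus_left)
    then show "pG (s (snd (W1 p \<alpha>))) (i (N' \<gamma> \<beta> + N p (\<eta>' \<gamma>)) - k \<gamma>) =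
      pL (snd (W1 p \<alpha>)) (fst (DW1 p \<gamma> \<beta>) - fst (DT1 p \<gamma> \<beta>))
      + pL (snd (DW1 p \<gamma> \<beta>)) (fst (W1 p \<alpha>) - fst (T1 p \<alpha>))"
      unfolding N'_def[symmetric] N_def[symmetric]
      by (simp add: dG.pair.diff_right k(2)[unfolded s_pair] s_pair dL.pair.add_right)
  qed
qed

end

section \<open>The flat connection and the isotropy bundle\<close>

context compatible_decomposition begin

lemma anchor_eq: "anc p x = rs (snd x) - coad G' (fst x) p"
  by (simp add: anchor_def case_prod_unfold)

text \<open>The functional built from the derivative of \<open>l\<close> enters through a
  representing vector \<open>c\<close>; in both uses \<open>flatness_form\<close> supplies
  it.\<close>

lemma N_bracket_eq:
  assumes A: "(A has_derivative A') (at p)" and B: "(C has_derivative C') (at p)"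
    and l: "((\<lambda>q. lcan q (snd (C p))) has_derivative dl) (at p)"
    and c: "\<And>\<gamma>. pG (snd (A p)) (dl \<gamma>) = pL \<gamma> c"
  shows "Nbr A C p = C' (anc p (A p)) - A' (anc p (C p)) +
    (c - bl (fst (A p)) (fst (C p)),
     coad G (i (fst (A p))) (snd (C p)) - coad G (i (fst (C p))) (snd (A p)) + covector_cobracket G (snd (A p)) (snd (C p))
     + coad G (lcan p (snd (A p))) (snd (C p)) - coad G (lcan p (snd (C p))) (snd (A p)))"
proof -
  have "vector_of L (\<lambda>\<gamma>. pG (snd (A p)) (frechet_derivative (\<lambda>q. lcan q (snd (C p))) (at p) \<gamma>)) = c"
    by (rule dL.vector_of_eqI) (simp add: frechet_derivative_at[OF l, symmetric] c)
  then show ?thesis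
    unfolding N_bracket_def Let_def case_prod_unfold
    by (simp add: frechet_derivative_at[OF A, symmetric] frechet_derivative_at[OF B, symmetric] del: G'_sel)
qed

lemma coad_linear: "coad G (x + y) \<xi> = coad G x \<xi> + coad G y \<xi>" "coad G (x - y) \<xi> = coad G x \<xi> - coad G y \<xi>"
  "coad G (- x) \<xi> = - coad G x \<xi>" "coad G x (- \<xi>) = - coad G x \<xi>"
proof -
  have n: "bracket G (- x) z = - bracket G x z" for x z
    using bracket_linear(1)[of x "- x" z] bracket_linear(1)[of 0 0 z] by (simp add: eq_neg_iff_add_eq_0 add.commute)
  show 1: "coad G (x + y) \<xi> = coad G x \<xi> + coad G y \<xi>" for x y
    by (rule dG.covector_eqI) (simp add: coad_pair bracket_linear dG.pair.add_left dG.pair.add_right)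
  show 2: "coad G (- x) \<xi> = - coad G x \<xi>" for x
    by (rule dG.covector_eqI) (simp add: coad_pair n dG.pair.minus_left dG.pair.minus_right)
  show "coad G (x - y) \<xi> = coad G x \<xi> - coad G y \<xi>" using 1[of x "- y"] 2[of y] by simp
  show "coad G x (- \<xi>) = - coad G x \<xi>"
    by (rule dG.covector_eqI) (simp add: coad_pair dG.pair.minus_left)
qed

lemma coad'_diff: "coad G' (x - y) \<xi> = coad G' x \<xi> - coad G' y \<xi>"
  by (rule dL.covector_eqI) (simp add: coad'_pair bl.diff_left dL.pair.diff_left dL.pair.diff_right del: G'_sel)

definition theta' :: "'q \<Rightarrow> 'q \<Rightarrow> 'q \<Rightarrow> 'l \<times> 'h" where
  "theta' p \<gamma> \<beta> = (fst (DT1 p \<gamma> \<beta>), s (snd (DW1 p \<gamma> \<beta>)))"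

lemma theta_additive:
  "\<theta> p (\<alpha> + \<beta>) = \<theta> p \<alpha> + \<theta> p \<beta>"
  "\<theta> p (coscal L c \<alpha>) = pair_scale (scal L) (coscal G) c (\<theta> p \<alpha>)"
proof -
  show "\<theta> p (\<alpha> + \<beta>) = \<theta> p \<alpha> + \<theta> p \<beta>"
    using D'.T_add[of "(0, p)" 1 "(0, \<alpha>)" "(0, \<beta>)"] D'.W_add[of "(0, p)" 1 "(0, \<alpha>)" "(0, \<beta>)"]
    by (simp add: theta_eq prod_eq_iff s_linear[symmetric])
  let ?K = "pair_scale (scal L) (coscal L) c"
  have K: "bounded_linear ?K"
  proof (rule fin_dim_bounded_linear[OF fin_dim_GL(2) linearI])
    show "?K (x + y) = ?K x + ?K y" for x y
      by (simp add: pair_scale_def prod_eq_iff dL.V.scale_right_distrib dL.V'.scale_right_distrib)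
    show "?K (r *\<^sub>R x) = r *\<^sub>R ?K x" for r x
      unfolding pair_scale_of_real(2)[symmetric]
      by (simp add: pair_scale_def prod_eq_iff dL.V.scale_left_commute dL.V'.scale_left_commute del: dL.V.scale_scale dL.V'.scale_scale)
  qed
  have pw: "(db' P ^^ n) (?K x) = ?K ((db' P ^^ n) x)" for P n x
    by (induction n) (simp_all add: db'_linear(5))
  have "eseries k (\<lambda>n. (db' P ^^ n) (?K x)) 1 = ?K (eseries k (\<lambda>n. (db' P ^^ n) x) 1)" for k P x
    unfolding pw by (rule eseries_linear_image[OF fin_dim_GL(2) D'.pw K, symmetric])
  from this[of _ "(0, p)" "(0, \<alpha>)"] show "\<theta> p (coscal L c \<alpha>) = pair_scale (scal L) (coscal G) c (\<theta> p \<alpha>)"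
    by (simp add: theta_eq D'.T_def D'.W_def pair_scale_def prod_eq_iff s_linear)
qed

lemma real_linear_theta: "linear (\<theta> p)"
proof (rule linearI)
  show "\<theta> p (r *\<^sub>R \<alpha>) = r *\<^sub>R \<theta> p \<alpha>" for r \<alpha>
    using theta_additive(2)[of p "of_real r" \<alpha>] by (simp only: dL.V'.scale_of_real pair_scale_of_real)
qed (rule theta_additive)

lemma real_linear_theta': "linear (theta' p \<gamma>)"
proof (rule linearI)
  show "theta' p \<gamma> (\<alpha> + \<beta>) = theta' p \<gamma> \<alpha> + theta' p \<gamma> \<beta>" for \<alpha> \<beta>
    using D'.DT_add[of "(0, p)" "(0, \<gamma>)" 1 "(0, \<alpha>)" "(0, \<beta>)"] D'.DW_add[of "(0, p)" "(0, \<gamma>)" 1 "(0, \<alpha>)" "(0, \<beta>)"]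
    by (simp add: theta'_def prod_eq_iff s_linear[symmetric])
  show "theta' p \<gamma> (r *\<^sub>R \<alpha>) = r *\<^sub>R theta' p \<gamma> \<alpha>" for r \<alpha>
    using D'.DT_scale[of r "(0, p)" "(0, \<gamma>)" 1 "(0, \<alpha>)"] D'.DW_scale[of r "(0, p)" "(0, \<gamma>)" 1 "(0, \<alpha>)"]
    by (simp add: theta'_def prod_eq_iff linear_cmul[OF linear_covectors(1), symmetric])
qed

lemma theta_deriv: "((\<lambda>q. \<theta> q \<beta>) has_derivative (\<lambda>\<gamma>. theta' p \<gamma> \<beta>)) (at p)"
  unfolding theta_eq theta'_def
  by (intro has_derivative_Pair has_derivative_fst bounded_linear.has_derivative[OF bounded_linear_s]
      has_derivative_snd series_deriv)

lemma theta_section_deriv: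
  assumes "(\<beta> has_derivative \<beta>') (at p)"
  shows "((\<lambda>q. \<theta> q (\<beta> q)) has_derivative (\<lambda>\<gamma>. theta' p \<gamma> (\<beta> p) + \<theta> p (\<beta>' \<gamma>))) (at p)"
  by (rule has_derivative_apply[OF dL.fin_dim_V' real_linear_theta real_linear_theta' theta_deriv assms])

lemma anchor_theta: "anc p (\<theta> p \<alpha>) = \<alpha>"
proof -
  have "snd (W1 p \<alpha>) - coad G' (fst (T1 p \<alpha>)) p = \<alpha>"
    using D'.ad_T[of "(0, p)" 1 "(0, \<alpha>)"] by (simp add: db'_covector prod_eq_iff)
  then show ?thesis by (simp add: anchor_eq theta_eq)
qed

lemma l_can_theta:
  assumes "p \<in> U"
  shows "lcan p (s (snd (W1 p \<alpha>))) =
    i (fst (W1 p \<alpha>) - fst (T1 p \<alpha>))"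
proof -
  have "inv (Tm p) 0 = 0"
    using linear_0[OF linear_Tm[of p]] by (intro inv_f_eq[OF bij_is_inj[OF U_bij(2)[OF assms]]])
  moreover have "D.E (0, s p) (- 1) (0, 0) = 0" using linear_0[OF D.linear_E] by (simp add: zero_prod_def)
  ultimately show ?thesis using l_can_at[OF assms, of 0 \<alpha>] by simp
qed

lemma theta_flat:
  assumes p: "p \<in> U" and \<alpha>: "(\<alpha> has_derivative \<alpha>') (at p)" and \<beta>: "(\<beta> has_derivative \<beta>') (at p)"
  shows "Nbr (\<lambda>q. \<theta> q (\<alpha> q)) (\<lambda>q. \<theta> q (\<beta> q)) p =
    \<theta> p (\<beta>' (\<alpha> p) - \<alpha>' (\<beta> p))"
proof -
  define u v P where "u = (0 :: 'l, \<alpha> p)" and "v = (0 :: 'l, \<beta> p)" and "P = (0 :: 'l, p)"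
  define c where "c = bl (fst (D'.T P 1 u)) (fst (D'.T P 1 v)) - fst (D'.DT P u 1 v) + fst (D'.DT P v 1 u)"
  obtain dl where dl: "((\<lambda>q. lcan q (s (snd (D'.W (0, p) 1 (0, \<beta> p))) + 0)) has_derivative dl) (at p)"
    "\<And>\<alpha> \<gamma>. pG (s (snd (W1 p \<alpha>))) (dl \<gamma>) =
      pL (snd (W1 p \<alpha>)) (fst (D'.DW (0, p) (0, \<gamma>) 1 (0, \<beta> p)) - fst (D'.DT (0, p) (0, \<gamma>) 1 (0, \<beta> p)))
      + pL (snd (D'.DW (0, p) (0, \<gamma>) 1 (0, \<beta> p))) (fst (W1 p \<alpha>) - fst (T1 p \<alpha>))"
    using that by (rule l_can_deriv[OF p rs_0])
  have "((\<lambda>q. lcan q (snd (\<theta> p (\<beta> p)))) has_derivative dl) (at p)"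
    using dl(1) by (simp add: theta_eq)
  moreover have "pG (snd (\<theta> p (\<alpha> p))) (dl \<gamma>) = pL \<gamma> c" for \<gamma>
    unfolding theta_eq snd_conv dl(2) c_def u_def v_def P_def by (rule flatness_form)
  ultimately have N: "Nbr (\<lambda>q. \<theta> q (\<alpha> q)) (\<lambda>q. \<theta> q (\<beta> q)) p =
      (theta' p (\<alpha> p) (\<beta> p) + \<theta> p (\<beta>' (\<alpha> p))) - (theta' p (\<beta> p) (\<alpha> p) + \<theta> p (\<alpha>' (\<beta> p)))
      + (c - bl (fst (D'.T P 1 u)) (fst (D'.T P 1 v)),
        coad G (i (fst (D'.T P 1 u))) (s (snd (D'.W P 1 v))) - coad G (i (fst (D'.T P 1 v))) (s (snd (D'.W P 1 u)))
        + covector_cobracket G (s (snd (D'.W P 1 u))) (s (snd (D'.W P 1 v)))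
        + coad G (lcan p (s (snd (D'.W P 1 u)))) (s (snd (D'.W P 1 v)))
        - coad G (lcan p (s (snd (D'.W P 1 v)))) (s (snd (D'.W P 1 u))))"
    unfolding u_def v_def P_def
    using N_bracket_eq[OF theta_section_deriv[OF \<alpha>] theta_section_deriv[OF \<beta>], of dl c]
    by (simp add: anchor_theta) (simp add: theta_eq del: G'_sel)
  have "D'.DW P u 1 v - D'.DW P v 1 u = db' (D'.W P 1 u) (D'.W P 1 v)" by (rule D'.maurer_cartan)
  then have mc: "snd (D'.DW P u 1 v) - snd (D'.DW P v 1 u) =
      coad G' (fst (D'.W P 1 v)) (snd (D'.W P 1 u)) - coad G' (fst (D'.W P 1 u)) (snd (D'.W P 1 v))"
    by (simp add: db'_eq prod_eq_iff del: G'_sel)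
  \<comment> \<open>Added to the \<open>\<ll>\<close>-parts of \<open>\<theta>\<close>, these values
    cancel all coadjoint terms with \<open>T\<close> and leave those with \<open>W\<close>, which
    match \<open>mc\<close>.\<close>
  have lu: "lcan p (s (snd (D'.W P 1 u))) = i (fst (D'.W P 1 u)) - i (fst (D'.T P 1 u))"
    "lcan p (s (snd (D'.W P 1 v))) = i (fst (D'.W P 1 v)) - i (fst (D'.T P 1 v))"
    unfolding u_def v_def P_def l_can_theta[OF p] linear_diff[OF real_linear_i] by (rule refl)+
  have t': "theta' p (\<alpha> p) (\<beta> p) - theta' p (\<beta> p) (\<alpha> p) =
     (fst (D'.DT P u 1 v) - fst (D'.DT P v 1 u),
      s (coad G' (fst (D'.W P 1 v)) (snd (D'.W P 1 u))) - s (coad G' (fst (D'.W P 1 u)) (snd (D'.W P 1 v))))"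
    unfolding linear_diff[OF linear_covectors(1), symmetric] mc[symmetric]
    by (simp add: theta'_def u_def v_def P_def linear_diff[OF linear_covectors(1)])
  have "Nbr (\<lambda>q. \<theta> q (\<alpha> q)) (\<lambda>q. \<theta> q (\<beta> q)) p =
     \<theta> p (\<beta>' (\<alpha> p)) - \<theta> p (\<alpha>' (\<beta> p))
     + ((theta' p (\<alpha> p) (\<beta> p) - theta' p (\<beta> p) (\<alpha> p)) +
       (c - bl (fst (D'.T P 1 u)) (fst (D'.T P 1 v)),
        coad G (i (fst (D'.W P 1 u))) (s (snd (D'.W P 1 v))) - coad G (i (fst (D'.W P 1 v))) (s (snd (D'.W P 1 u)))))"
    unfolding N covcob_ss lu coad_linear by (simp add: algebra_simps prod_eq_iff)
  also have "\<dots> = \<theta> p (\<beta>' (\<alpha> p)) - \<theta> p (\<alpha>' (\<beta> p))"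
    unfolding t' by (simp add: c_def s_coad' zero_prod_def[symmetric] del: G'_sel)
  finally show ?thesis by (simp add: linear_diff[OF real_linear_theta])
qed

lemma theta_smooth: "smooth_on U (\<lambda>p. \<theta> p \<alpha>)"
proof -
  define R1 where "R1 x = (fst x, 0 :: 'h)" for x :: "'l \<times> 'q"
  define R2 where "R2 x = (0 :: 'l, s (snd x))" for x :: "'l \<times> 'q"
  have R: "bounded_linear R1" "bounded_linear R2"
    unfolding R1_def R2_def
    by (intro bounded_linear_Pair bounded_linear_fst bounded_linear_zero bounded_linear_compose[OF bounded_linear_s bounded_linear_snd])+
  have "smooth_on UNIV (\<lambda>p. T1 p \<alpha>)" "smooth_on UNIV (\<lambda>p. W1 p \<alpha>)"
    unfolding D'.T_def D'.W_def by (rule eseries_operator_smooth[OF fin_dim_GL(2) bounded_bilinear_ad(1)])+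
  then have "times_differentiable_on k UNIV (\<lambda>p. R1 (T1 p \<alpha>) + R2 (W1 p \<alpha>))" for k
    unfolding smooth_on_def
    by (intro times_differentiable_on_add[OF times_differentiable_on_bounded_linear[OF R(1)]
          times_differentiable_on_bounded_linear[OF R(2)]]) blast+
  then show ?thesis
    unfolding smooth_on_def theta_eq by (auto simp: R1_def R2_def intro: times_differentiable_on_subset)
qed

lemma flat_connection_theta: "flat_connection G L i M (\<theta>)"
  unfolding flat_connection_def
proof (intro conjI ballI allI impI)
  show "Vector_Spaces.linear (coscal L) (pair_scale (scal L) (coscal G)) (\<theta> p)" for p
    by (rule Vector_Spaces_linearI[OF dL.V'.vector_space_axioms
          vector_space_pair_scale[OF dL.V.vector_space_axioms dG.V'.vector_space_axioms]])
      (rule theta_additive)+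
  show "smooth_on U (\<lambda>p. \<theta> p \<alpha>)" for \<alpha> by (rule theta_smooth)
  show "anc p (\<theta> p \<alpha>) = \<alpha>" for p \<alpha> by (rule anchor_theta)
  fix \<alpha> \<beta> :: "'q \<Rightarrow> 'q" and p
  assume s: "smooth_on U \<alpha>" "smooth_on U \<beta>" and p: "p \<in> U"
  have "times_differentiable_on (Suc 0) U \<alpha>" "times_differentiable_on (Suc 0) U \<beta>"
    using s unfolding smooth_on_def by blast+
  then have "\<alpha> differentiable at p" "\<beta> differentiable at p" using p by simp_all
  then show "Nbr (\<lambda>q. \<theta> q (\<alpha> q)) (\<lambda>q. \<theta> q (\<beta> q)) p =
      \<theta> p (frechet_derivative \<beta> (at p) (\<alpha> p) - frechet_derivative \<alpha> (at p) (\<beta> p))"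
    by (intro theta_flat p) (simp_all add: frechet_derivative_works)
qed

section \<open>The kernel of the anchor and its trivialisation\<close>

lemma gstar_0: "x \<in> gst 0 \<longleftrightarrow> fst x \<in> range i \<and> rs (snd x) = 0"
  unfolding gstar_def coad'_0' by (cases x) auto

lemma E_split: "D.E (0, s q) 1 (i w, \<eta>) = j (D'.E (0, q) 1 (w, 0)) + D.E (0, s q) 1 (0, \<eta>)"
proof -
  have "D.E (j (0, q)) 1 (j (w, 0)) = j (D'.E (0, q) 1 (w, 0))" by (rule E_j)
  then show ?thesis using D.E_add[of "(0, s q)" 1 "(i w, 0)" "(0, \<eta>)"] by (simp add: j_def)
qed

lemma ad_vector: "db' (0, q) (w, 0) = (0, coad G' w q)"
  by (simp add: db'_covector vc_0 del: G'_sel)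

text \<open>\<open>A\<close> sends \<open>w\<close> to the covector \<open>coad G' w q\<close>, and
  \<open>W A = exp A - 1\<close>. This puts the covector of a kernel element into the form that
  \<open>l_can_at\<close> accepts.\<close>

lemma snd_E: "snd (D'.E (0, q) 1 (w, 0)) = snd (D'.W (0, q) 1 (0, coad G' w q))"
  using D'.W_ad[of "(0, q)" 1 "(w, 0)"] by (simp add: ad_vector prod_eq_iff)

lemma snd_E_anchor: "coad G' (fst (D'.W (0, q) 1 (w, 0))) q = snd (D'.E (0, q) 1 (w, 0))"
  using D'.ad_W[of "(0, q)" 1 "(w, 0)"] by (simp add: db'_covector prod_eq_iff)

lemma rs_E: assumes "rs \<eta> = 0" shows "rs (snd (D.E (0, s q) 1 (i w, \<eta>))) = snd (D'.E (0, q) 1 (w, 0))"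
  unfolding E_split using E_M_ann(2)[of "(0, \<eta>)" q 1] assms by (simp add: rs_linear j_def M_sub)

text \<open>Equivalently, \<open>tau\<close> of the \<open>\<ell>\<close>-matrix completes
  \<open>(sinh A / A) w\<close> and the covector part of \<open>exp A (w + \<eta>)\<close> to all of
  \<open>exp A (w + \<eta>)\<close>; undoing \<open>exp A\<close> then gives back
  \<open>w + \<eta>\<close>, as \<open>psi_eq\<close> requires.\<close>

lemma l_can_E:
  assumes q: "q \<in> U" and \<eta>: "rs \<eta> = 0"
  shows "lcan q (snd (D.E (0, s q) 1 (i w, \<eta>))) =
    fst (D.E (0, s q) 1 (i w, \<eta>)) - i (fst (D'.W (0, q) 1 (w, 0)))"
proof -
  obtain a \<xi> where a: "D.E (0, s q) 1 (0, \<eta>) = (a, \<xi>)" by fastforce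
  have \<xi>: "rs \<xi> = 0" using E_M_ann(2)[of "(0, \<eta>)" q 1] \<eta> a by (simp add: M_sub)
  have "D.E (0, s q) (- 1) (a, \<xi>) = (0, \<eta>)" unfolding a[symmetric] by (rule D.E_inverse)
  \<comment> \<open>The vector part of \<open>(0, \<eta>)\<close> is zero, so the contributions of
    \<open>a\<close> and of \<open>\<xi>\<close> to it are opposite.\<close>
  then have "Tm q (- a) = fst (D.E (0, s q) (- 1) (0, \<xi>))"
    using D.E_add[of "(0, s q)" "- 1" "(a, 0)" "(0, \<xi>)"] unfolding linear_neg[OF linear_Tm]
    by (simp add: Tm_def prod_eq_iff neg_eq_iff_add_eq_0 add.commute)
  then have inv: "inv (Tm q) (fst (D.E (0, s q) (- 1) (0, \<xi>))) = - a"
    by (rule inv_f_eq[OF bij_is_inj[OF U_bij(2)[OF q]]])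
  \<comment> \<open>On \<open>A w\<close> the operators \<open>W\<close> and \<open>T\<close> give
    \<open>exp A w - w\<close> and \<open>W w - w\<close>, so \<open>W - T\<close> gives
    \<open>exp A w - W w\<close>.\<close>
  have "fst (D'.W (0, q) 1 (0, coad G' w q)) = fst (D'.E (0, q) 1 (w, 0)) - w"
    "fst (D'.T (0, q) 1 (0, coad G' w q)) = fst (D'.W (0, q) 1 (w, 0)) - w"
    using D'.W_ad[of "(0, q)" 1 "(w, 0)"] D'.T_ad[of "(0, q)" 1 "(w, 0)"] by (simp_all add: ad_vector prod_eq_iff)
  then show ?thesis
    unfolding E_split a using l_can_at[OF q \<xi>, of "coad G' w q"]
    by (simp add: j_def snd_E inv linear_diff[OF real_linear_i])
qed

lemma psi_eq:
  assumes q: "q \<in> U" and \<eta>: "rs \<eta> = 0"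
  shows "\<psi> q (i w, \<eta>) = - (fst (D'.W (0, q) 1 (w, 0)), snd (D.E (0, s q) 1 (i w, \<eta>)))"
proof -
  define Y where "Y = (i (fst (D'.W (0, q) 1 (w, 0))), snd (D.E (0, s q) 1 (i w, \<eta>)))"
  have "Y \<in> gst q"
    unfolding gstar_def Y_def using rs_E[OF \<eta>] snd_E_anchor[of q w] by auto
  moreover have "\<Phi> q Y = (i w, \<eta>)"
  proof -
    have "tau (lcan q) Y = D.E (0, s q) 1 (i w, \<eta>)"
      by (simp add: tau_def Y_def l_can_E[OF q \<eta>] prod_eq_iff)
    then show ?thesis by (simp add: phi_def Ad_ms_eq D.E_inverse)
  qed
  moreover have "inj (\<Phi> q)"
  proof (rule injI)
    fix x y assume "\<Phi> q x = \<Phi> q y"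
    then have "D.E (0, s q) 1 (\<Phi> q x) = D.E (0, s q) 1 (\<Phi> q y)" by simp
    then have "tau (lcan q) x = tau (lcan q) y"
      by (simp add: phi_def Ad_ms_eq D.E_inverse)
    then show "x = y" by (auto simp: tau_def case_prod_unfold prod_eq_iff)
  qed
  ultimately have "inv_into (gst q) (\<Phi> q) (i w, \<eta>) = Y"
    by (intro inv_into_f_eq) (auto intro: inj_on_subset)
  then show ?thesis by (simp add: psi_def Let_def Y_def)
qed

text \<open>
  The bundle map \<open>\<psi>\<close> extended linearly to all of \<open>\<dd>\<close>; unlike \<open>\<phi>\<^sub>p\<^sup>-\<^sup>1\<close> it is visibly entire in \<open>q\<close>.
\<close>

definition Psi :: "'q \<Rightarrow> 'g \<times> 'h \<Rightarrow> 'l \<times> 'h" where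
  "Psi q x = - (fst (D'.W (0, q) 1 (pr (fst x), 0)), snd (D.E (0, s q) 1 x))"

lemma psi_Psi:
  assumes q: "q \<in> U" and "x \<in> gst 0"
  shows "\<psi> q x = Psi q x"
proof -
  obtain w \<eta> where x: "x = (i w, \<eta>)" "rs \<eta> = 0" using assms(2) unfolding gstar_0 by (cases x) auto
  show ?thesis unfolding x(1) Psi_def using psi_eq[OF q x(2)] by simp
qed

definition Psi' :: "'q \<Rightarrow> 'q \<Rightarrow> 'g \<times> 'h \<Rightarrow> 'l \<times> 'h" where
  "Psi' p \<gamma> x = - (fst (D'.DW (0, p) (0, \<gamma>) 1 (pr (fst x), 0)), snd (D.DE (0, s p) (0, s \<gamma>) 1 x))"

lemma Psi_linear: "linear (Psi q)" "linear (Psi' p \<gamma>)"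
proof -
  have 1: "linear (\<lambda>x :: 'g \<times> 'h. (pr (fst x), 0 :: 'q))"
    by (rule linearI) (simp_all add: pr_linear linear_cmul[OF real_linear_pr])
  have a: "linear (\<lambda>x :: 'g \<times> 'h. fst (D'.W (0, q) 1 (pr (fst x), 0)))"
    "linear (\<lambda>x :: 'g \<times> 'h. fst (D'.DW (0, p) (0, \<gamma>) 1 (pr (fst x), 0)))"
    by (rule linear_compose[OF linear_compose[OF 1 D'.linear_W] linear_fst, unfolded o_def]
        linear_compose[OF linear_compose[OF 1 D'.linear_DW] linear_fst, unfolded o_def])+
  have b: "linear (\<lambda>x. snd (D.E (0, s q) 1 x))" "linear (\<lambda>x. snd (D.DE (0, s p) (0, s \<gamma>) 1 x))"
    by (rule linear_compose[OF D.linear_E linear_snd, unfolded o_def] linear_compose[OF D.linear_DE linear_snd, unfolded o_def])+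
  have c: "linear (\<lambda>x. - (f x, g x))" if "linear f" "linear g" for f :: "'g \<times> 'h \<Rightarrow> 'l" and g :: "'g \<times> 'h \<Rightarrow> 'h"
    by (rule linearI) (simp_all add: linear_add[OF that(1)] linear_add[OF that(2)] linear_cmul[OF that(1)] linear_cmul[OF that(2)])
  show "linear (Psi q)" unfolding Psi_def by (rule c[OF a(1) b(1)])
  show "linear (Psi' p \<gamma>)" unfolding Psi'_def by (rule c[OF a(2) b(2)])
qed

lemma Psi_deriv: "((\<lambda>q. Psi q x) has_derivative (\<lambda>\<gamma>. Psi' p \<gamma> x)) (at p)"
  unfolding Psi_def Psi'_def
  by (intro has_derivative_minus has_derivative_Pair has_derivative_fst has_derivative_snd series_deriv)

text \<open>Near \<open>p\<close> the values lie in a fixed subspace cut out by bounded linear maps,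
  which therefore annihilate the derivative too.\<close>

lemma gstar_deriv:
  assumes p: "p \<in> U" and X: "\<And>q. q \<in> U \<Longrightarrow> X q \<in> gst 0" and X': "(X has_derivative X') (at p)"
  shows "X' \<gamma> \<in> gst 0"
proof -
  have van: "f (X' \<gamma>) = 0" if f: "bounded_linear f" and f0: "\<And>x. x \<in> gst 0 \<Longrightarrow> f x = 0"
    for f :: "'g \<times> 'h \<Rightarrow> 'z::real_normed_vector"
  proof -
    have 1: "((\<lambda>q. f (X q)) has_derivative (\<lambda>\<gamma>. f (X' \<gamma>))) (at p)" by (rule bounded_linear.has_derivative[OF f X'])
    have "\<forall>\<^sub>F q in nhds p. f (X q) = 0"
      using eventually_U[OF p] by (rule eventually_mono) (simp add: f0 X)
    then have "((\<lambda>q. f (X q)) has_derivative (\<lambda>\<gamma>. 0)) (at p)"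
      by (rule has_derivative_eventually_eq[OF has_derivative_const])
    from has_derivative_unique[OF 1 this] show ?thesis by meson
  qed
  have "bounded_linear (\<lambda>x :: 'g \<times> 'h. fst x - i (pr (fst x)))"
    by (intro bounded_linear_sub bounded_linear_fst bounded_linear_compose[OF bounded_linear_i]
        bounded_linear_compose[OF fin_dim_bounded_linear[OF dG.fin_dim_V real_linear_pr]])
  then have "fst (X' \<gamma>) - i (pr (fst (X' \<gamma>))) = 0"
  proof (rule van)
    fix x :: "'g \<times> 'h" assume "x \<in> gst 0"
    then obtain z where "fst x = i z" unfolding gstar_0 by blast
    then show "fst x - i (pr (fst x)) = 0" by simp
  qed
  moreover have "bounded_linear (\<lambda>x :: 'g \<times> 'h. rs (snd x))"
    by (intro bounded_linear_compose[OF fin_dim_bounded_linear[OF dG.fin_dim_V' linear_covectors(2)]] bounded_linear_snd)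
  then have "rs (snd (X' \<gamma>)) = 0" by (rule van) (simp add: gstar_0)
  ultimately show ?thesis unfolding gstar_0 by (metis eq_iff_diff_eq_0 rangeI)
qed

lemma theta_psi:
  assumes p: "p \<in> U" and \<alpha>: "(\<alpha> has_derivative \<alpha>') (at p)"
    and X: "\<And>q. q \<in> U \<Longrightarrow> X q \<in> gst 0" and X': "(X has_derivative X') (at p)"
  shows "Nbr (\<lambda>q. \<theta> q (\<alpha> q)) (\<lambda>q. \<psi> q (X q)) p = \<psi> p (X' (\<alpha> p))"
proof -
  obtain w \<eta> where Xp: "X p = (i w, \<eta>)" and \<eta>: "rs \<eta> = 0"
    using X[OF p] unfolding gstar_0 by (cases "X p") auto
  \<comment> \<open>With \<open>v = - A w\<close> the covector of \<open>\<psi> X\<close> is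
    \<open>s\<close> of the covector part of \<open>W v\<close> plus an element of
    \<open>\<ll>\<^sup>\<bottom>\<close>, the shape that \<open>l_can_deriv\<close> treats;
    \<open>v\<close> thus takes the place of a second section in
    \<open>flatness_form\<close>.\<close>
  define P u v where "P = (0 :: 'l, p)" and "u = (0 :: 'l, \<alpha> p)" and "v = (0 :: 'l, - coad G' w p)"
  define z where "z = fst (D'.W P 1 (w, 0))"
  obtain y \<zeta> where y: "D.E (0, s p) 1 (i w, \<eta>) = (y, \<zeta>)" by fastforce
  have ev: "\<forall>\<^sub>F q in nhds p. \<psi> q (X q) = Psi q (X q)"
    using eventually_U[OF p] by (rule eventually_mono) (simp add: psi_Psi X)
  have psi_p: "\<psi> p (X p) = (- z, - \<zeta>)"
    using psi_Psi[OF p X[OF p]] by (simp add: Psi_def Xp y z_def P_def)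
  have psi_d: "((\<lambda>q. \<psi> q (X q)) has_derivative (\<lambda>\<gamma>. Psi' p \<gamma> (X p) + Psi p (X' \<gamma>))) (at p)"
    by (rule has_derivative_eventually_eq[OF has_derivative_apply[OF fin_dim_GL(1) Psi_linear Psi_deriv X'] ev])
  \<comment> \<open>Because the anchor kills \<open>\<psi> X\<close>, the section
    \<open>\<theta>\<alpha>\<close> is differentiated along \<open>0\<close> only, and its
    derivative drops out of the bracket.\<close>
  have anchor0: "anc p (\<psi> p (X p)) = 0"
    using rs_E[OF \<eta>, of p w] snd_E_anchor[of p w] coad'_diff[of 0 z p]
    by (simp add: psi_p anchor_eq y z_def P_def linear_neg[OF linear_covectors(2)] coad'_0 del: G'_sel)
  obtain a \<xi> where a: "D.E (0, s p) 1 (0, \<eta>) = (a, \<xi>)" by fastforce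
  have \<xi>: "rs (- \<xi>) = 0"
    using E_M_ann(2)[of "(0, \<eta>)" p 1] \<eta> a by (simp add: M_sub linear_neg[OF linear_covectors(2)])
  have Wv: "D'.W P 1 v = (w, 0) - D'.E P 1 (w, 0)" and Tv: "D'.T P 1 v = (w, 0) - D'.W P 1 (w, 0)"
  proof -
    have "v = - db' P (w, 0)" by (simp add: v_def P_def ad_vector)
    then show "D'.W P 1 v = (w, 0) - D'.E P 1 (w, 0)" "D'.T P 1 v = (w, 0) - D'.W P 1 (w, 0)"
      by (simp_all add: D'.W_minus D'.T_minus D'.W_ad D'.T_ad)
  qed
  have \<zeta>: "s (snd (D'.W P 1 v)) + - \<xi> = - \<zeta>"
    using E_split[of p w \<eta>] unfolding y a Wv
    by (simp add: j_def P_def prod_eq_iff linear_neg[OF linear_covectors(1)])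
  define c where "c = bl (fst (D'.T P 1 u)) (fst (D'.T P 1 v)) - fst (D'.DT P u 1 v) + fst (D'.DT P v 1 u)"
  obtain dl where dl: "((\<lambda>q. lcan q (s (snd (D'.W (0, p) 1 v)) + - \<xi>)) has_derivative dl) (at p)"
    "\<And>\<alpha> \<gamma>. pG (s (snd (W1 p \<alpha>))) (dl \<gamma>) =
      pL (snd (W1 p \<alpha>)) (fst (D'.DW (0, p) (0, \<gamma>) 1 v) - fst (D'.DT (0, p) (0, \<gamma>) 1 v))
      + pL (snd (D'.DW (0, p) (0, \<gamma>) 1 v)) (fst (W1 p \<alpha>) - fst (T1 p \<alpha>))"
    using that unfolding v_def by (rule l_can_deriv[OF p \<xi>])
  have "((\<lambda>q. lcan q (snd (\<psi> p (X p)))) has_derivative dl) (at p)"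
    using dl(1) \<zeta> by (simp add: psi_p P_def)
  moreover have "pG (snd (\<theta> p (\<alpha> p))) (dl \<gamma>) = pL \<gamma> c" for \<gamma>
    unfolding theta_eq snd_conv dl(2) c_def u_def v_def P_def by (rule flatness_form)
  ultimately have N: "Nbr (\<lambda>q. \<theta> q (\<alpha> q)) (\<lambda>q. \<psi> q (X q)) p =
      (Psi' p (\<alpha> p) (X p) + Psi p (X' (\<alpha> p))) - (theta' p 0 (\<alpha> p) + \<theta> p (\<alpha>' 0))
      + (c - bl (fst (D'.T P 1 u)) (- z),
        coad G (i (fst (D'.T P 1 u))) (- \<zeta>) - coad G (i (- z)) (s (snd (D'.W P 1 u)))
        + covector_cobracket G (s (snd (D'.W P 1 u))) (- \<zeta>)
        + coad G (lcan p (s (snd (D'.W P 1 u)))) (- \<zeta>)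
        - coad G (lcan p (- \<zeta>)) (s (snd (D'.W P 1 u))))"
    using N_bracket_eq[OF theta_section_deriv[OF \<alpha>] psi_d, of dl c]
    by (simp add: anchor_theta anchor0) (simp add: psi_p theta_eq u_def P_def del: G'_sel)
  have lu: "lcan p (s (snd (D'.W P 1 u))) = i (fst (D'.W P 1 u)) - i (fst (D'.T P 1 u))"
    unfolding u_def P_def l_can_theta[OF p] linear_diff[OF real_linear_i] by (rule refl)
  have l\<zeta>: "lcan p (- \<zeta>) = - y + i z"
  proof -
    have m\<eta>: "rs (- \<eta>) = 0" using \<eta> by (simp add: linear_neg[OF linear_covectors(2)])
    have "D.E (0, s p) 1 (i (- w), - \<eta>) = - (y, \<zeta>)"
      using D.E_minus[of "(0, s p)" 1 "(i w, \<eta>)"] y by (simp add: linear_neg[OF real_linear_i])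
    moreover have "fst (D'.W (0, p) 1 (- w, 0)) = - z"
      using D'.W_minus[of "(0, p)" 1 "(w, 0)"] by (simp add: z_def P_def)
    ultimately show ?thesis
      using l_can_E[OF p m\<eta>, of "- w"] by (simp add: linear_neg[OF real_linear_i])
  qed
  have zero: "theta' p 0 (\<alpha> p) + \<theta> p (\<alpha>' 0) = 0"
  proof -
    have "\<alpha>' 0 = 0" by (rule linear_0[OF has_derivative_linear[OF \<alpha>]])
    moreover have "theta' p 0 (\<alpha> p) = 0"
      by (rule linear_0[OF has_derivative_linear[OF theta_deriv]])
    ultimately show ?thesis by (simp add: linear_0[OF real_linear_theta])
  qed
  \<comment> \<open>The derivative of \<open>T\<close> along \<open>u\<close> enters through
    \<open>T A = W - 1\<close>, and the one along \<open>v = [w, P]\<close> through equivariance;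
    together they produce the vector \<open>c\<close> of the flatness identity.\<close>
  have "fst (D'.DW P u 1 (w, 0)) = c - bl (fst (D'.T P 1 u)) (- z)"
  proof -
    have "D'.DT P u 1 (db' P (w, 0)) + D'.T P 1 (db' u (w, 0)) = D'.DW P u 1 (w, 0)" by (rule D'.DT_ad)
    moreover have "db' P (w, 0) = - v" by (simp add: v_def P_def ad_vector)
    ultimately have 1: "D'.DW P u 1 (w, 0) = D'.T P 1 (db' u (w, 0)) - D'.DT P u 1 v"
      by (simp add: linear_neg[OF D'.linear_DT])
    have "db' (w, 0) P = v" by (simp add: v_def P_def db'_vector bl.zero_right del: G'_sel)
    then have "D'.DT P v 1 u = db' (w, 0) (D'.T P 1 u) - D'.T P 1 (db' (w, 0) u)"
      using D'.DT_equivariant[of "(w, 0)" P 1 u] by simp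
    moreover have "D'.T P 1 (db' u (w, 0)) = - D'.T P 1 (db' (w, 0) u)"
      by (simp add: D'.skew[of u] D'.T_minus)
    ultimately have "D'.DW P u 1 (w, 0) = D'.DT P v 1 u - db' (w, 0) (D'.T P 1 u) - D'.DT P u 1 v"
      unfolding 1 by simp
    then have "fst (D'.DW P u 1 (w, 0)) = fst (D'.DT P v 1 u) - bl w (fst (D'.T P 1 u)) - fst (D'.DT P u 1 v)"
      by (simp add: db'_vector del: G'_sel)
    then show ?thesis
      unfolding c_def Tv by (simp add: z_def bl.diff_right bl.minus_right bracket'_skew[of w] del: G'_sel)
  qed
  moreover have "snd (D.DE (0, s p) (0, s (\<alpha> p)) 1 (i w, \<eta>)) =
      coad G y (s (snd (D'.W P 1 u))) - coad G (i (fst (D'.W P 1 u))) \<zeta> + covector_cobracket G \<zeta> (s (snd (D'.W P 1 u)))"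
  proof -
    have "D.W (j P) 1 (j u) = j (D'.W P 1 u)" by (rule W_j)
    then have "D.W (0, s p) 1 (0, s (\<alpha> p)) = (i (fst (D'.W P 1 u)), s (snd (D'.W P 1 u)))"
      by (simp add: j_def P_def u_def)
    then show ?thesis unfolding D.DE_eq[symmetric] y by (simp add: db_eq)
  qed
  \<comment> \<open>The derivative of \<open>Psi\<close> in the base point is the negative of the
    non-derivative part of the bracket, so only the derivative of \<open>X\<close> survives.\<close>
  ultimately have "Psi' p (\<alpha> p) (X p) = - (c - bl (fst (D'.T P 1 u)) (- z),
      coad G y (s (snd (D'.W P 1 u))) - coad G (i (fst (D'.W P 1 u))) \<zeta> + covector_cobracket G \<zeta> (s (snd (D'.W P 1 u))))"
    by (simp add: Psi'_def Xp P_def u_def del: G'_sel)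
  moreover have "covector_cobracket G (s (snd (D'.W P 1 u))) (- \<zeta>) = covector_cobracket G \<zeta> (s (snd (D'.W P 1 u)))"
    using covcob_skew[of "- \<zeta>" "s (snd (D'.W P 1 u))"]
    by (intro dG.covector_eqI) (simp add: covcob_pair cobracket_skew[of "s _"] dG.pair.minus_left)
  ultimately have "Nbr (\<lambda>q. \<theta> q (\<alpha> q)) (\<lambda>q. \<psi> q (X q)) p = Psi p (X' (\<alpha> p))"
    unfolding N zero lu l\<zeta> linear_neg[OF real_linear_i] coad_linear
    by (simp add: prod_eq_iff coad_linear del: G'_sel)
  then show ?thesis using psi_Psi[OF p gstar_deriv[OF p X X']] by simp
qed

end

theorem proposition7p2:
  fixes G :: "('k::real_or_complex, 'g::real_normed_vector, 'h::real_normed_vector) quasi_bialgebra"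
    and L :: "('k, 'l::real_normed_vector, 'q::real_normed_vector) dual_pair"
    and i :: "'l \<Rightarrow> 'g"
    and M :: "'g set"
  assumes "lie_quasi_bialgebra G"
    and "reductive_decomposition G L i M"
    and "canonically_compatible G i M"
  shows "(\<forall>p\<in>U_dom G L i M. \<forall>\<alpha>. theta_l G L i M p \<alpha> \<in> range i \<times> {0} \<and>
             theta_g G L i M p \<alpha> \<in> {0} \<times> UNIV) \<and>
         flat_connection G L i M (theta G L i M) \<and>
         (\<forall>\<alpha> X. smooth_on (U_dom G L i M) \<alpha> \<longrightarrow> smooth_on (U_dom G L i M) X \<longrightarrow>
            (\<forall>p\<in>U_dom G L i M. X p \<in> gstar G L i M 0) \<longrightarrow>
            (\<forall>p\<in>U_dom G L i M.
               N_bracket G L i M (\<lambda>q. theta G L i M q (\<alpha> q)) (\<lambda>q. psi G L i M q (X q)) p =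
               psi G L i M p (frechet_derivative X (at p) (\<alpha> p))))"
proof -
  interpret compatible_decomposition G L i M using assms by unfold_locales
  show ?thesis
  proof (intro conjI allI impI ballI)
    show "theta_l G L i M p \<alpha> \<in> range i \<times> {0}" "theta_g G L i M p \<alpha> \<in> {0} \<times> UNIV" for p \<alpha>
      by (simp_all add: theta_l_eq theta_g_eq)
    show "flat_connection G L i M (\<theta>)" by (rule flat_connection_theta)
    fix \<alpha> :: "'q \<Rightarrow> 'q" and X :: "'q \<Rightarrow> 'g \<times> 'h" and p
    assume s: "smooth_on U \<alpha>" "smooth_on U X" and X: "\<forall>p\<in>U. X p \<in> gst 0" and p: "p \<in> U"
    have "times_differentiable_on (Suc 0) U \<alpha>" "times_differentiable_on (Suc 0) U X"
      using s unfolding smooth_on_def by blast+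
    then have "\<alpha> differentiable at p" "X differentiable at p" using p by simp_all
    then show "Nbr (\<lambda>q. \<theta> q (\<alpha> q)) (\<lambda>q. \<psi> q (X q)) p =
        \<psi> p (frechet_derivative X (at p) (\<alpha> p))"
      using X by (intro theta_psi p) (simp_all add: frechet_derivative_works)
  qed
qed

end
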